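(* Let $\Bbbk$ be a commutative ring, let $\mathcal{P}=\bigoplus_{n\ge0}\Bbbk P_n$ be the Hopf algebra of uniform block permutations, and let $\Pi$ be the graded Hopf algebra of symmetric functions in non-commuting variables, with basis $\{p_{\mathcal{A}}\}$ indexed by the set partitions $\mathcal{A}$ of $[n]$, $n\ge0$. For a set partition $\mathcal{A}$ of $[n]$ let $Z_{\mathcal{A}}=\sum_{f:\mathcal{A}\to\mathcal{B}}f\in\Bbbk P_n$ be the sum of all uniform block permutations with domain $\mathcal{A}$ (and arbitrary codomain $\mathcal{B}$), let $\mathcal{Z}_n\subseteq\Bbbk P_n$ be the linear span of the $Z_{\mathcal{A}}$ over all set partitions $\mathcal{A}$ of $[n]$, and let $\mathcal{Z}=\bigoplus_{n\ge0}\mathcal{Z}_n\subset\mathcal{P}$. Then $\mathcal{Z}$ is a Hopf subalgebra of $\mathcal{P}$. Moreover, the linear map $$\mathcal{Z}\to\Pi,\qquad Z_{\mathcal{A}}\mapsto p_{\mathcal{A}},$$ is an isomorphism of graded Hopf algebras.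
   Context: **Uniform block permutations.** For $n\ge 0$ let $[n]=\{1,\dots,n\}$. A set partition of $[n]$ is a collection of non-empty disjoint subsets (blocks) of $[n]$ with union $[n]$. A uniform block permutation of $[n]$ is a bijection $f:\mathcal{A}\to\mathcal{B}$ between two set partitions of $[n]$ such that $|f(A)|=|A|$ for every $A\in\mathcal{A}$; $\mathcal A$ is its domain and $\mathcal B$ its codomain. $P_n$ is the (finite) set of uniform block permutations of $[n]$; $P_0=\{\emptyset\}$, where $\emptyset$ denotes the empty uniform block permutation. **Monoid structure.** For $f:\mathcal{A}\to\mathcal{B}$ and $g:\mathcal{C}\to\mathcal{D}$ in $P_n$, the product $g\cdot f$ ("first $f$, then $g$") is defined as follows: let $\mathcal{E}$ be the finest set partition of $[n]$ such that every block of $\mathcal{B}$ and every block of $\mathcal{C}$ is contained in a block of $\mathcal{E}$; for each $E\in\mathcal{E}$, $g\cdot f$ has the domain block $\bigcup\{f^{-1}(B): B\in\mathcal{B}, B\subseteq E\}$ and sends it to $\bigcup\{g(C): C\in\mathcal{C}, C\subseteq E\}$. A permutation $\sigma\in S_n$ is identified with the uniform block permutation $\{i\}\mapsto\{\sigma(i)\}$; thus $S_n$ is a submonoid of $P_n$. $\Bbbk P_n$ is the monoid algebra (free $\Bbbk$-module on $P_n$, product extended bilinearly). **Concatenation.** For $f\in P_n$, $g\in P_m$, $f\times g\in P_{n+m}$ is the uniform block permutation whose domain blocks are the domain blocks $A$ of $f$, with $A\mapsto f(A)$, and the sets $A'+n=\{a+n: a\in A'\}$ for $A'$ a domain block of $g$,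 with $A'+n\mapsto g(A')+n$. **The Hopf algebra $\mathcal{P}$.** An $(n,m)$-shuffle is $\xi\in S_{n+m}$ with $\xi(1)<\cdots<\xi(n)$ and $\xi(n+1)<\cdots<\xi(n+m)$. $\mathrm{Sh}(n,m)$ is the set of these and $sh_{n,m}=\sum_{\xi\in \mathrm{Sh}(n,m)}\xi$. The product of $\mathcal{P}$ is $f\ast g=sh_{n,m}\cdot(f\times g)$ for $f\in P_n$, $g\in P_m$, extended bilinearly. A breaking point of a set partition $\mathcal{B}$ of $[n]$ is $i\in\{0,\dots,n\}$ such that $\{1,\dots,i\}$ is a union of blocks of $\mathcal{B}$; for $f:\mathcal{A}\to\mathcal{B}$, $B(f)$ is the set of breaking points of $\mathcal{B}$. For each $i\in B(f)$ there are a unique $\xi\in\mathrm{Sh}(i,n-i)$ and unique $f_{(i)}\in P_i$, $f'_{(n-i)}\in P_{n-i}$ with $f=(f_{(i)}\times f'_{(n-i)})\cdot\xi^{-1}$. The coproduct is $\Delta(f)=\sum_{i\in B(f)}f_{(i)}\otimes f'_{(n-i)}$. The unit is $\emptyset$; the counit is $\varepsilon(\emptyset)=1$, $\varepsilon(f)=0$ for $f\in P_n$, $n\ge1$. With the grading in which $\Bbbk P_n$ has degree $n$, this is a graded connected Hopf algebra. **The Hopf algebra $\Pi$.** Let $X$ be a countably infinite set (the alphabet). A word of length $n$ is a function $w:[n]\to X$. Let $\Bbbk\langle\langle X\rangle\rangle$ be the algebra of non-commutative power series on $X$ (possibly infinite linear combinations of words, with product induced by concatenation). The kernel $\mathcal{K}(w)$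 of a word $w$ of length $n$ is the set partition of $[n]$ whose blocks are the non-empty fibers of $w$. Order set partitions of $[n]$ by: $\mathcal{A}\le\mathcal{B}$ iff every block of $\mathcal{B}$ is contained in a block of $\mathcal{A}$. Put $p_{\mathcal{A}}=\sum_{\mathcal{K}(w)\le\mathcal{A}}w$, i.e. the sum of all words $w:[n]\to X$ such that $w(i)=w(j)$ whenever $i,j$ lie in the same block of $\mathcal{A}$. $\Pi$ is the linear span of all $p_{\mathcal{A}}$ ($\mathcal{A}$ a set partition of $[n]$, $n\ge0$), a subalgebra of $\Bbbk\langle\langle X\rangle\rangle$ graded by length of words. It is a graded Hopf algebra with product and coproduct $$p_{\mathcal{A}}p_{\mathcal{B}}=p_{\mathcal{A}\times\mathcal{B}},\qquad \Delta(p_{\mathcal{A}})=\sum_{S\sqcup T=\mathcal{A}}p_{\mathcal{A}_S}\otimes p_{\mathcal{A}_T},$$ where the last sum is over all decompositions of $\mathcal{A}$ into disjoint (possibly empty) sets of blocks $S$ and $T$; for $\mathcal{A}$ a set partition of $[n]$ and $\mathcal{B}$ of $[m]$, $\mathcal{A}\times\mathcal{B}$ is the set partition of $[n+m]$ whose blocks are those of $\mathcal{A}$ and the sets $\{b+n: b\in B\}$, $B\in\mathcal{B}$; and for $S\subseteq\mathcal{A}$ with $\bigcup_{A\in S}A=\{j_1<\cdots<j_m\}$, $\mathcal{A}_S$ is the set partition of $[m]$ obtained from the blocks in $S$ by replacing each $j_t$ by $t$. The unit is $p$ of the empty set partition, and the counit is the projection onto degree $0$. *)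

theory Defs
  imports
    Complex_Main
    "HOL-Library.Poly_Mapping"
    "HOL-Library.Function_Algebras"
    "HOL-Library.Disjoint_Sets"
    "HOL-Library.Countable_Set"
    "HOL-Combinatorics.Permutations"
begin

section \<open>Linear algebra over a commutative ring\<close>

text \<open>The free module on a type of basis elements is the type of finitely supported functions.\<close>

definition fm_scale :: "'k::comm_ring_1 \<Rightarrow> ('b \<Rightarrow>\<^sub>0 'k) \<Rightarrow> ('b \<Rightarrow>\<^sub>0 'k)" where
  "fm_scale c x = Poly_Mapping.map ((*) c) x"

abbreviation basis_vec :: "'b \<Rightarrow> ('b \<Rightarrow>\<^sub>0 'k::comm_ring_1)" where
  "basis_vec b \<equiv> Poly_Mapping.single b 1"

definition lin_ext :: "('k \<Rightarrow> 'a \<Rightarrow> 'a) \<Rightarrow> ('b \<Rightarrow> 'a) \<Rightarrow> ('b \<Rightarrow>\<^sub>0 'k::comm_ring_1) \<Rightarrow> 'a::ab_group_add" where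
  "lin_ext s F x = (\<Sum>b \<in> Poly_Mapping.keys x. s (Poly_Mapping.lookup x b) (F b))"

definition linear_on ::
  "'a set \<Rightarrow> ('k \<Rightarrow> 'a::ab_group_add \<Rightarrow> 'a) \<Rightarrow> ('k \<Rightarrow> 'b::ab_group_add \<Rightarrow> 'b) \<Rightarrow> ('a \<Rightarrow> 'b) \<Rightarrow> bool" where
  "linear_on A s s' F \<longleftrightarrow>
     (\<forall>x\<in>A. \<forall>y\<in>A. F (x + y) = F x + F y) \<and> (\<forall>c. \<forall>x\<in>A. F (s c x) = s' c (F x))"

text \<open>
  Tensor powers. An element of \<open>A \<otimes> A\<close> (of \<open>A \<otimes> A \<otimes> A\<close>) is represented by a formal linear
  combination of pairs (triples) of elements of \<open>A\<close>; two of them represent the same tensor iff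
  they differ by an element of the submodule generated by the multilinearity relations. A slot is
  a function that inserts its argument into one coordinate, the other coordinates being fixed
  elements of \<open>A\<close>.
\<close>

definition multilinear_rels ::
  "('k::comm_ring_1 \<Rightarrow> 'a::ab_group_add \<Rightarrow> 'a) \<Rightarrow> 'a set \<Rightarrow> ('a \<Rightarrow> 't) set \<Rightarrow> ('t \<Rightarrow>\<^sub>0 'k) set" where
  "multilinear_rels s A slots = module.span fm_scale
     ({basis_vec (\<sigma> (a + b)) - basis_vec (\<sigma> a) - basis_vec (\<sigma> b) | \<sigma> a b. \<sigma> \<in> slots \<and> a \<in> A \<and> b \<in> A}
      \<union> {basis_vec (\<sigma> (s c a)) - fm_scale c (basis_vec (\<sigma> a)) | \<sigma> c a. \<sigma> \<in> slots \<and> a \<in> A})"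

definition slots2 :: "'a set \<Rightarrow> ('a \<Rightarrow> 'a \<times> 'a) set" where
  "slots2 A = (\<Union>b\<in>A. {\<lambda>x. (x, b), \<lambda>x. (b, x)})"

definition slots3 :: "'a set \<Rightarrow> ('a \<Rightarrow> 'a \<times> 'a \<times> 'a) set" where
  "slots3 A = (\<Union>b\<in>A. \<Union>c\<in>A. {\<lambda>x. (x, b, c), \<lambda>x. (b, x, c), \<lambda>x. (b, c, x)})"


section \<open>Graded Hopf algebras\<close>

text \<open>
  The coproduct takes values in representatives of tensors; all axioms about it are stated modulo
  the multilinearity relations.
\<close>

record (overloaded) ('k, 'a) hopf =
  carr :: "'a set"
  scal :: "'k \<Rightarrow> 'a \<Rightarrow> 'a"
  mul :: "'a \<Rightarrow> 'a \<Rightarrow> 'a"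
  one :: "'a"
  comul :: "'a \<Rightarrow> ('a \<times> 'a \<Rightarrow>\<^sub>0 'k)"
  counit :: "'a \<Rightarrow> 'k"
  deg_part :: "nat \<Rightarrow> 'a set"

definition tensor2_eq ::
  "('k::comm_ring_1, 'a::ab_group_add) hopf \<Rightarrow> ('a \<times> 'a \<Rightarrow>\<^sub>0 'k) \<Rightarrow> ('a \<times> 'a \<Rightarrow>\<^sub>0 'k) \<Rightarrow> bool" where
  "tensor2_eq H x y \<longleftrightarrow> x - y \<in> multilinear_rels (scal H) (carr H) (slots2 (carr H))"

definition tensor3_eq ::
  "('k::comm_ring_1, 'a::ab_group_add) hopf \<Rightarrow> ('a \<times> 'a \<times> 'a \<Rightarrow>\<^sub>0 'k) \<Rightarrow> ('a \<times> 'a \<times> 'a \<Rightarrow>\<^sub>0 'k) \<Rightarrow> bool" where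
  "tensor3_eq H x y \<longleftrightarrow> x - y \<in> multilinear_rels (scal H) (carr H) (slots3 (carr H))"

definition tensor2_mul ::
  "('k::comm_ring_1, 'a::ab_group_add) hopf \<Rightarrow> ('a \<times> 'a \<Rightarrow>\<^sub>0 'k) \<Rightarrow> ('a \<times> 'a \<Rightarrow>\<^sub>0 'k) \<Rightarrow> ('a \<times> 'a \<Rightarrow>\<^sub>0 'k)" where
  "tensor2_mul H x y =
     lin_ext fm_scale (\<lambda>(a, b). lin_ext fm_scale (\<lambda>(c, d). basis_vec (mul H a c, mul H b d)) y) x"

definition comul_left ::
  "('k::comm_ring_1, 'a::ab_group_add) hopf \<Rightarrow> ('a \<times> 'a \<Rightarrow>\<^sub>0 'k) \<Rightarrow> ('a \<times> 'a \<times> 'a \<Rightarrow>\<^sub>0 'k)" where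
  "comul_left H x =
     lin_ext fm_scale (\<lambda>(a, b). lin_ext fm_scale (\<lambda>(a1, a2). basis_vec (a1, a2, b)) (comul H a)) x"

definition comul_right ::
  "('k::comm_ring_1, 'a::ab_group_add) hopf \<Rightarrow> ('a \<times> 'a \<Rightarrow>\<^sub>0 'k) \<Rightarrow> ('a \<times> 'a \<times> 'a \<Rightarrow>\<^sub>0 'k)" where
  "comul_right H x =
     lin_ext fm_scale (\<lambda>(a, b). lin_ext fm_scale (\<lambda>(b1, b2). basis_vec (a, b1, b2)) (comul H b)) x"

definition is_antipode :: "('k::comm_ring_1, 'a::ab_group_add) hopf \<Rightarrow> ('a \<Rightarrow> 'a) \<Rightarrow> bool" where
  "is_antipode H S \<longleftrightarrow>
     S ` carr H \<subseteq> carr H \<and> linear_on (carr H) (scal H) (scal H) S \<and>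
     (\<forall>x\<in>carr H.
        lin_ext (scal H) (\<lambda>(a, b). mul H (S a) b) (comul H x) = scal H (counit H x) (one H) \<and>
        lin_ext (scal H) (\<lambda>(a, b). mul H a (S b)) (comul H x) = scal H (counit H x) (one H))"

locale hopf_algebra =
  fixes H :: "('k::comm_ring_1, 'a::ab_group_add) hopf"
  assumes module: "module (scal H)"
    and subspace: "module.subspace (scal H) (carr H)"
    and mul_closed: "\<And>x y. x \<in> carr H \<Longrightarrow> y \<in> carr H \<Longrightarrow> mul H x y \<in> carr H"
    and mul_linear_left: "\<And>y. y \<in> carr H \<Longrightarrow> linear_on (carr H) (scal H) (scal H) (\<lambda>x. mul H x y)"
    and mul_linear_right: "\<And>x. x \<in> carr H \<Longrightarrow> linear_on (carr H) (scal H) (scal H) (mul H x)"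
    and mul_assoc: "\<And>x y z. x \<in> carr H \<Longrightarrow> y \<in> carr H \<Longrightarrow> z \<in> carr H \<Longrightarrow>
      mul H (mul H x y) z = mul H x (mul H y z)"
    and one_closed: "one H \<in> carr H"
    and one_mul: "\<And>x. x \<in> carr H \<Longrightarrow> mul H (one H) x = x"
    and mul_one: "\<And>x. x \<in> carr H \<Longrightarrow> mul H x (one H) = x"
    and comul_closed: "\<And>x. x \<in> carr H \<Longrightarrow> Poly_Mapping.keys (comul H x) \<subseteq> carr H \<times> carr H"
    and comul_add: "\<And>x y. x \<in> carr H \<Longrightarrow> y \<in> carr H \<Longrightarrow>
      tensor2_eq H (comul H (x + y)) (comul H x + comul H y)"
    and comul_scal: "\<And>c x. x \<in> carr H \<Longrightarrow>
      tensor2_eq H (comul H (scal H c x)) (fm_scale c (comul H x))"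
    and coassoc: "\<And>x. x \<in> carr H \<Longrightarrow>
      tensor3_eq H (comul_left H (comul H x)) (comul_right H (comul H x))"
    and counit_linear: "linear_on (carr H) (scal H) (*) (counit H)"
    and counit_left: "\<And>x. x \<in> carr H \<Longrightarrow>
      lin_ext (scal H) (\<lambda>(a, b). scal H (counit H a) b) (comul H x) = x"
    and counit_right: "\<And>x. x \<in> carr H \<Longrightarrow>
      lin_ext (scal H) (\<lambda>(a, b). scal H (counit H b) a) (comul H x) = x"
    and comul_mul: "\<And>x y. x \<in> carr H \<Longrightarrow> y \<in> carr H \<Longrightarrow>
      tensor2_eq H (comul H (mul H x y)) (tensor2_mul H (comul H x) (comul H y))"
    and comul_one: "tensor2_eq H (comul H (one H)) (basis_vec (one H, one H))"
    and counit_mul: "\<And>x y. x \<in> carr H \<Longrightarrow> y \<in> carr H \<Longrightarrow>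
      counit H (mul H x y) = counit H x * counit H y"
    and counit_one: "counit H (one H) = 1"
    and antipode: "\<exists>S. is_antipode H S"

locale graded_hopf_algebra = hopf_algebra H
  for H :: "('k::comm_ring_1, 'a::ab_group_add) hopf" +
  assumes deg_subset: "\<And>n. deg_part H n \<subseteq> carr H"
    and deg_subspace: "\<And>n. module.subspace (scal H) (deg_part H n)"
    and deg_direct_sum: "\<And>x. x \<in> carr H \<Longrightarrow>
      \<exists>!c :: nat \<Rightarrow>\<^sub>0 'a. (\<forall>n. Poly_Mapping.lookup c n \<in> deg_part H n) \<and>
        x = (\<Sum>n \<in> Poly_Mapping.keys c. Poly_Mapping.lookup c n)"
    and deg_mul: "\<And>m n x y. x \<in> deg_part H m \<Longrightarrow> y \<in> deg_part H n \<Longrightarrow> mul H x y \<in> deg_part H (m + n)"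
    and deg_one: "one H \<in> deg_part H 0"
    and deg_comul: "\<And>n x. x \<in> deg_part H n \<Longrightarrow>
      \<exists>t. Poly_Mapping.keys t \<subseteq> (\<Union>i\<le>n. deg_part H i \<times> deg_part H (n - i)) \<and> tensor2_eq H (comul H x) t"
    and deg_counit: "\<And>n x. n > 0 \<Longrightarrow> x \<in> deg_part H n \<Longrightarrow> counit H x = 0"
    and deg_antipode: "\<And>S n. is_antipode H S \<Longrightarrow> S ` deg_part H n \<subseteq> deg_part H n"

text \<open>
  Over a ring the canonical map \<open>B \<otimes> B \<rightarrow> A \<otimes> A\<close> need not be injective. Its injectivity
  (\<open>sub_tensor_inj\<close>) is part of the definition, so that \<open>B \<otimes> B\<close> is a submodule of \<open>A \<otimes> A\<close> and
  the restricted coproduct below is well defined as a tensor over \<open>B\<close>.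
\<close>

locale hopf_subalgebra = hopf_algebra H
  for H :: "('k::comm_ring_1, 'a::ab_group_add) hopf" and B :: "'a set" +
  assumes sub_subset: "B \<subseteq> carr H"
    and sub_subspace: "module.subspace (scal H) B"
    and sub_one: "one H \<in> B"
    and sub_mul: "\<And>x y. x \<in> B \<Longrightarrow> y \<in> B \<Longrightarrow> mul H x y \<in> B"
    and sub_tensor_inj: "\<And>s t. Poly_Mapping.keys s \<subseteq> B \<times> B \<Longrightarrow> Poly_Mapping.keys t \<subseteq> B \<times> B \<Longrightarrow>
      tensor2_eq H s t \<Longrightarrow> tensor2_eq (H\<lparr>carr := B\<rparr>) s t"
    and sub_comul: "\<And>x. x \<in> B \<Longrightarrow> \<exists>t. Poly_Mapping.keys t \<subseteq> B \<times> B \<and> tensor2_eq H t (comul H x)"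
    and sub_antipode: "\<And>S. is_antipode H S \<Longrightarrow> S ` B \<subseteq> B"

text \<open>The structure inherited by \<open>B\<close>, graded by \<open>C\<close>.\<close>

definition restrict_hopf ::
  "('k::comm_ring_1, 'a::ab_group_add) hopf \<Rightarrow> 'a set \<Rightarrow> (nat \<Rightarrow> 'a set) \<Rightarrow> ('k, 'a) hopf" where
  "restrict_hopf H B C = H\<lparr>carr := B,
     comul := (\<lambda>x. SOME t. Poly_Mapping.keys t \<subseteq> B \<times> B \<and> tensor2_eq H t (comul H x)),
     deg_part := C\<rparr>"

locale graded_hopf_iso = H: graded_hopf_algebra H + K: graded_hopf_algebra K
  for H :: "('k::comm_ring_1, 'a::ab_group_add) hopf"
    and K :: "('k, 'b::ab_group_add) hopf" +
  fixes \<phi> :: "'a \<Rightarrow> 'b"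
  assumes iso_linear: "linear_on (carr H) (scal H) (scal K) \<phi>"
    and iso_bij: "bij_betw \<phi> (carr H) (carr K)"
    and iso_mul: "\<And>x y. x \<in> carr H \<Longrightarrow> y \<in> carr H \<Longrightarrow> \<phi> (mul H x y) = mul K (\<phi> x) (\<phi> y)"
    and iso_one: "\<phi> (one H) = one K"
    and iso_comul: "\<And>x. x \<in> carr H \<Longrightarrow>
      tensor2_eq K (lin_ext fm_scale (\<lambda>(a, b). basis_vec (\<phi> a, \<phi> b)) (comul H x)) (comul K (\<phi> x))"
    and iso_counit: "\<And>x. x \<in> carr H \<Longrightarrow> counit K (\<phi> x) = counit H x"
    and iso_antipode: "\<And>S T x. is_antipode H S \<Longrightarrow> is_antipode K T \<Longrightarrow> x \<in> carr H \<Longrightarrow>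
      \<phi> (S x) = T (\<phi> x)"
    and iso_deg: "\<And>n. \<phi> ` deg_part H n = deg_part K n"


section \<open>Uniform block permutations\<close>

text \<open>
  A uniform block permutation is encoded by its graph, a set of pairs (domain block, codomain
  block). The union of the domain blocks is \<open>{1..n}\<close>, so \<open>n\<close> can be recovered from the graph and
  the sets \<open>ubp n\<close> are pairwise disjoint.
\<close>

type_synonym blockmap = "(nat set \<times> nat set) set"

definition ubp :: "nat \<Rightarrow> blockmap set" where
  "ubp n = {f. partition_on {1..n} (Domain f) \<and> partition_on {1..n} (Range f) \<and>
     single_valued f \<and> single_valued (f\<inverse>) \<and> (\<forall>(A, B)\<in>f. card A = card B)}"

definition ubp_size :: "blockmap \<Rightarrow> nat" where
  "ubp_size f = card (\<Union>(Domain f))"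

definition part_join :: "nat set set \<Rightarrow> nat set set \<Rightarrow> nat set set" where
  "part_join B C = (THE E. refines (\<Union>B) B E \<and> refines (\<Union>B) C E \<and>
     (\<forall>E'. refines (\<Union>B) B E' \<and> refines (\<Union>B) C E' \<longrightarrow> refines (\<Union>B) E E'))"

text \<open>\<open>ubp_comp g f\<close> is the product ``first \<open>f\<close>, then \<open>g\<close>''.\<close>

definition ubp_comp :: "blockmap \<Rightarrow> blockmap \<Rightarrow> blockmap" where
  "ubp_comp g f =
     (\<lambda>E. (\<Union>{A. \<exists>B. (A, B) \<in> f \<and> B \<subseteq> E}, \<Union>{D. \<exists>C. (C, D) \<in> g \<and> C \<subseteq> E}))
       ` part_join (Range f) (Domain g)"

definition perm_ubp :: "nat \<Rightarrow> (nat \<Rightarrow> nat) \<Rightarrow> blockmap" where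
  "perm_ubp n \<sigma> = (\<lambda>i. ({i}, {\<sigma> i})) ` {1..n}"

definition shift :: "nat \<Rightarrow> nat set \<Rightarrow> nat set" where
  "shift n A = (\<lambda>a. a + n) ` A"

definition ubp_concat :: "blockmap \<Rightarrow> blockmap \<Rightarrow> blockmap" where
  "ubp_concat f g = f \<union> map_prod (shift (ubp_size f)) (shift (ubp_size f)) ` g"

definition shuffles_perm :: "nat \<Rightarrow> nat \<Rightarrow> (nat \<Rightarrow> nat) set" where
  "shuffles_perm n m = {\<xi>. \<xi> permutes {1..n + m} \<and>
     strict_mono_on {1..n} \<xi> \<and> strict_mono_on {n + 1..n + m} \<xi>}"

definition monoid_alg_mul ::
  "(blockmap \<Rightarrow>\<^sub>0 'k::comm_ring_1) \<Rightarrow> (blockmap \<Rightarrow>\<^sub>0 'k) \<Rightarrow> (blockmap \<Rightarrow>\<^sub>0 'k)" where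
  "monoid_alg_mul x y =
     lin_ext fm_scale (\<lambda>g. lin_ext fm_scale (\<lambda>f. basis_vec (ubp_comp g f)) y) x"

definition shuffle_sum :: "nat \<Rightarrow> nat \<Rightarrow> (blockmap \<Rightarrow>\<^sub>0 'k::comm_ring_1)" where
  "shuffle_sum n m = (\<Sum>\<xi>\<in>shuffles_perm n m. basis_vec (perm_ubp (n + m) \<xi>))"

definition ubp_star :: "blockmap \<Rightarrow> blockmap \<Rightarrow> (blockmap \<Rightarrow>\<^sub>0 'k::comm_ring_1)" where
  "ubp_star f g =
     monoid_alg_mul (shuffle_sum (ubp_size f) (ubp_size g)) (basis_vec (ubp_concat f g))"

definition breaking_points :: "blockmap \<Rightarrow> nat set" where
  "breaking_points f = {i. i \<le> ubp_size f \<and> (\<exists>S\<subseteq>Range f. {1..i} = \<Union>S)}"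

definition ubp_split :: "blockmap \<Rightarrow> nat \<Rightarrow> blockmap \<times> blockmap" where
  "ubp_split f i = (THE (g, h). g \<in> ubp i \<and> h \<in> ubp (ubp_size f - i) \<and>
     (\<exists>\<xi>\<in>shuffles_perm i (ubp_size f - i).
        f = ubp_comp (ubp_concat g h) (perm_ubp (ubp_size f) (inv \<xi>))))"

definition ubp_coproduct :: "blockmap \<Rightarrow> ((blockmap \<Rightarrow>\<^sub>0 'k) \<times> (blockmap \<Rightarrow>\<^sub>0 'k) \<Rightarrow>\<^sub>0 'k::comm_ring_1)" where
  "ubp_coproduct f = (\<Sum>i\<in>breaking_points f.
     basis_vec (basis_vec (fst (ubp_split f i)), basis_vec (snd (ubp_split f i))))"

definition ubp_hopf :: "('k::comm_ring_1, blockmap \<Rightarrow>\<^sub>0 'k) hopf" where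
  "ubp_hopf = \<lparr>
     carr = {x. Poly_Mapping.keys x \<subseteq> (\<Union>n. ubp n)},
     scal = fm_scale,
     mul = (\<lambda>x y. lin_ext fm_scale (\<lambda>f. lin_ext fm_scale (\<lambda>g. ubp_star f g) y) x),
     one = basis_vec {},
     comul = lin_ext fm_scale ubp_coproduct,
     counit = (\<lambda>x. Poly_Mapping.lookup x {}),
     deg_part = (\<lambda>n. {x. Poly_Mapping.keys x \<subseteq> ubp n})\<rparr>"

definition Z_elem :: "nat set set \<Rightarrow> (blockmap \<Rightarrow>\<^sub>0 'k::comm_ring_1)" where
  "Z_elem A = (\<Sum>f | f \<in> (\<Union>n. ubp n) \<and> Domain f = A. basis_vec f)"

definition Z_part :: "nat \<Rightarrow> (blockmap \<Rightarrow>\<^sub>0 'k::comm_ring_1) set" where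
  "Z_part n = module.span fm_scale (Z_elem ` {A. partition_on {1..n} A})"

text \<open>The sum of the submodules \<open>Z_part n\<close>. It is direct because \<open>Z_part n\<close> lies in degree \<open>n\<close>.\<close>

definition Z_space :: "(blockmap \<Rightarrow>\<^sub>0 'k::comm_ring_1) set" where
  "Z_space = module.span fm_scale (\<Union>n. Z_part n)"


section \<open>Symmetric functions in non-commuting variables\<close>

text \<open>
  A word \<open>w : [n] \<rightarrow> X\<close> is a list, with \<open>w(i) = w ! (i - 1)\<close>; a non-commutative power series is the
  function sending a word to its coefficient.
\<close>

type_synonym ('k, 'x) ncseries = "'x list \<Rightarrow> 'k"

definition ncs_scale :: "'k::comm_ring_1 \<Rightarrow> ('k, 'x) ncseries \<Rightarrow> ('k, 'x) ncseries" where
  "ncs_scale c x = (\<lambda>w. c * x w)"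

definition ncs_mul :: "('k::comm_ring_1, 'x) ncseries \<Rightarrow> ('k, 'x) ncseries \<Rightarrow> ('k, 'x) ncseries" where
  "ncs_mul x y = (\<lambda>w. \<Sum>i\<le>length w. x (take i w) * y (drop i w))"

definition word_kernel :: "'x list \<Rightarrow> nat set set" where
  "word_kernel w = (\<lambda>a. {i \<in> {1..length w}. w ! (i - 1) = a}) ` set w"

definition p_elem :: "'x set \<Rightarrow> nat set set \<Rightarrow> ('k::comm_ring_1, 'x) ncseries" where
  "p_elem X A = (\<lambda>w. if w \<in> lists X \<and> refines {1..length w} A (word_kernel w) then 1 else 0)"

definition set_partitions :: "nat set set set" where
  "set_partitions = (\<Union>n. {A. partition_on {1..n} A})"

text \<open>The standardization \<open>\<A>\<^sub>S\<close>: an element of \<open>\<Union>S\<close> is replaced by its rank there.\<close>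

definition part_std :: "nat set set \<Rightarrow> nat set set" where
  "part_std S = (\<lambda>A. (\<lambda>j. card {i \<in> \<Union>S. i \<le> j}) ` A) ` S"

definition p_coproduct ::
  "'x set \<Rightarrow> nat set set \<Rightarrow> (('k, 'x) ncseries \<times> ('k, 'x) ncseries \<Rightarrow>\<^sub>0 'k::comm_ring_1)" where
  "p_coproduct X A = (\<Sum>S\<in>Pow A. basis_vec (p_elem X (part_std S), p_elem X (part_std (A - S))))"

definition p_coords :: "'x set \<Rightarrow> ('k::comm_ring_1, 'x) ncseries \<Rightarrow> (nat set set \<Rightarrow>\<^sub>0 'k)" where
  "p_coords X x = (THE c. Poly_Mapping.keys c \<subseteq> set_partitions \<and> lin_ext ncs_scale (p_elem X) c = x)"

definition Pi_hopf :: "'x set \<Rightarrow> ('k::comm_ring_1, ('k, 'x) ncseries) hopf" where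
  "Pi_hopf X = \<lparr>
     carr = module.span ncs_scale (p_elem X ` set_partitions),
     scal = ncs_scale,
     mul = ncs_mul,
     one = p_elem X {},
     comul = (\<lambda>x. lin_ext fm_scale (p_coproduct X) (p_coords X x)),
     counit = (\<lambda>x. x []),
     deg_part = (\<lambda>n. module.span ncs_scale (p_elem X ` {A. partition_on {1..n} A}))\<rparr>"

end

theory Submission
  imports Defs
begin

text \<open>
  Read a uniform block permutation as a word in its domain blocks. Then the product of \<open>P\<close> is the
  shuffle product of a word with a shifted word, and the coproduct is the deconcatenation at the
  cuts that separate no two equal letters, followed by standardization. Letters of the two factors
  of a product are distinct, so a shuffle is determined by its two subwords, and the axioms of a
  bialgebra become bijections given by filtering and cutting words. The element \<open>Z\<^sub>A\<close> is the sum of all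
  words with set of letters \<open>A\<close>. Shuffling these sums yields all words with letters in \<open>A \<times> B\<close>, and
  cutting them yields the pairs of sums for \<open>S\<close> and \<open>A - S\<close>, \<open>S \<subseteq> A\<close>. Thus \<open>Z\<^sub>A\<close> and \<open>p\<^sub>A\<close> have the same structure
  constants. An antipode on a connected graded bialgebra is determined by a recursion on the degree,
  which shows its existence and its compatibility with \<open>Z\<close>, with the grading and with the isomorphism.
\<close>

section \<open>Linear extensions and multilinearity relations\<close>

text \<open>Words are taken in the domain blocks because the two sides of a uniform block
  permutation are acted on differently: left multiplication by a shuffle moves positions and keeps
  the letters, whereas splitting off \<open>inv \<xi>\<close> on the right relabels the elements
  inside the letters. Fixing the domain therefore fixes the letters. The obstacle is the tensor
  product over a ring. Tensors are classes of formal sums, so a pure tensor of two sums is a double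
  sum only modulo relations, and a tensor that vanishes over a module may fail to vanish over a
  submodule. Hence the axioms are checked on a basis and carried over by maps that are linear modulo
  a submodule. That tensors over \<open>Z_space\<close> embed comes from a linear projection: the
  coordinate at \<open>Z_elem A\<close> is the coefficient at the identity map of the partition
  \<open>A\<close>. The same projection makes an arbitrary choice of representatives for the
  coproduct of \<open>Z_space\<close> linear modulo the relations of \<open>Z_space\<close> itself.
  On the other side an infinite alphabet provides, for each set partition, a word with this kernel,
  and evaluation at such words shows that the series \<open>p_elem X A\<close> are
  independent.\<close>

lemma lookup_fm_scale [simp]: "Poly_Mapping.lookup (fm_scale c x) b = c * Poly_Mapping.lookup x b"
  by (simp add: fm_scale_def Poly_Mapping.map.rep_eq when_def)

lemma keys_fm_scale: "Poly_Mapping.keys (fm_scale c x) \<subseteq> Poly_Mapping.keys x"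
  by (auto simp: in_keys_iff)

lemma module_fm_scale: "module fm_scale"
  by standard (auto intro!: poly_mapping_eqI simp: lookup_add algebra_simps)

interpretation fm: module fm_scale
  by (rule module_fm_scale)

context module
begin

text \<open>Terms of a sum or of a multiple may cancel, so linearity is proved over a common finite
  superset of the supports.\<close>

lemma lin_ext_superset:
  assumes "finite K" "Poly_Mapping.keys x \<subseteq> K"
  shows "lin_ext scale F x = (\<Sum>b\<in>K. scale (Poly_Mapping.lookup x b) (F b))"
  unfolding lin_ext_def using assms
  by (intro sum.mono_neutral_left) (auto simp: in_keys_iff)

lemma lin_ext_add [simp]: "lin_ext scale F (x + y) = lin_ext scale F x + lin_ext scale F y"
proof -
  let ?K = "Poly_Mapping.keys x \<union> Poly_Mapping.keys y"
  have "Poly_Mapping.keys (x + y) \<subseteq> ?K"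
    by (rule keys_add)
  then show ?thesis
    by (simp add: lin_ext_superset[of ?K] lookup_add scale_left_distrib sum.distrib)
qed

lemma lin_ext_scale [simp]: "lin_ext scale F (fm_scale c x) = scale c (lin_ext scale F x)"
proof -
  show ?thesis
    using keys_fm_scale[of c x] by (simp add: lin_ext_superset[of "Poly_Mapping.keys x"] scale_sum_right)
qed

lemma lin_ext_zero [simp]: "lin_ext scale F 0 = 0"
  by (simp add: lin_ext_def)

lemma lin_ext_single [simp]: "lin_ext scale F (Poly_Mapping.single b c) = scale c (F b)"
  by (subst lin_ext_superset[of "{b}"]) auto

lemma lin_ext_diff [simp]: "lin_ext scale F (x - y) = lin_ext scale F x - lin_ext scale F y"
  by (metis lin_ext_add diff_add_cancel add_diff_cancel)

lemma lin_ext_sum [simp]: "lin_ext scale F (\<Sum>i\<in>J. f i) = (\<Sum>i\<in>J. lin_ext scale F (f i))"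
  by (induction J rule: infinite_finite_induct) auto

lemma lin_ext_cong:
  "x = y \<Longrightarrow> (\<And>b. b \<in> Poly_Mapping.keys y \<Longrightarrow> F b = G b) \<Longrightarrow> lin_ext scale F x = lin_ext scale G y"
  by (simp add: lin_ext_def)

lemma lin_ext_zero_fun [simp]: "lin_ext scale (\<lambda>_. 0) x = 0"
  by (simp add: lin_ext_def)

lemma lin_ext_add_fun: "lin_ext scale (\<lambda>b. F b + G b) x = lin_ext scale F x + lin_ext scale G x"
  by (simp add: lin_ext_def scale_right_distrib sum.distrib)

lemma lin_ext_diff_fun: "lin_ext scale (\<lambda>b. F b - G b) x = lin_ext scale F x - lin_ext scale G x"
  by (simp add: lin_ext_def scale_right_diff_distrib sum_subtractf)

lemma lin_ext_scale_fun: "lin_ext scale (\<lambda>b. scale c (F b)) x = scale c (lin_ext scale F x)"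
  by (simp add: lin_ext_def scale_sum_right mult.commute)

lemma lin_ext_in_subspace:
  assumes "subspace A" "\<And>b. b \<in> Poly_Mapping.keys x \<Longrightarrow> F b \<in> A"
  shows "lin_ext scale F x \<in> A"
  unfolding lin_ext_def using assms by (intro subspace_sum) (auto intro: subspace_scale)

text \<open>The map \<open>L\<close> is linear only on \<open>A\<close>, so the induction over the
  support keeps all partial sums inside \<open>A\<close>.\<close>

lemma linear_on_lin_ext:
  assumes "module s'" "subspace A" "linear_on A scale s' L" "\<And>b. b \<in> Poly_Mapping.keys x \<Longrightarrow> F b \<in> A"
  shows "L (lin_ext scale F x) = lin_ext s' (\<lambda>b. L (F b)) x"
proof -
  interpret s': module s' by fact
  have L0: "L 0 = 0"
    using assms(2,3) subspace_0[OF assms(2)] unfolding linear_on_def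
    by (metis add_cancel_right_right)
  have "L (\<Sum>b\<in>K. scale (Poly_Mapping.lookup x b) (F b)) = (\<Sum>b\<in>K. s' (Poly_Mapping.lookup x b) (L (F b)))"
    if "finite K" "K \<subseteq> Poly_Mapping.keys x" for K
    using that
  proof (induction K rule: finite_induct)
    case (insert b K)
    have "(\<Sum>b\<in>K. scale (Poly_Mapping.lookup x b) (F b)) \<in> A"
      using insert.prems assms(2,4) by (intro subspace_sum subspace_scale) auto
    moreover have "F b \<in> A" "scale (Poly_Mapping.lookup x b) (F b) \<in> A"
      using insert.prems assms(2,4) by (auto intro: subspace_scale)
    ultimately show ?case
      using insert assms(3) by (simp add: linear_on_def)
  qed (simp add: L0)
  then show ?thesis
    by (simp add: lin_ext_def)
qed

lemma lin_ext_lin_ext: "lin_ext scale F (lin_ext fm_scale G x) = lin_ext scale (\<lambda>b. lin_ext scale F (G b)) x"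
  by (rule fm.linear_on_lin_ext[where A=UNIV]) (auto simp: linear_on_def module_axioms)

lemma lin_ext_commute:
  "lin_ext scale (\<lambda>a. lin_ext scale (F a) y) x = lin_ext scale (\<lambda>b. lin_ext scale (\<lambda>a. F a b) x) y"
  unfolding lin_ext_def scale_sum_right by (subst sum.swap) (simp add: mult.commute)

lemma subspace_lin_ext_image:
  "subspace (lin_ext scale F ` {c. Poly_Mapping.keys c \<subseteq> K})"
proof (rule subspaceI)
  show "0 \<in> lin_ext scale F ` {c. Poly_Mapping.keys c \<subseteq> K}"
    by (rule image_eqI[where x=0]) auto
next
  fix x y assume "x \<in> lin_ext scale F ` {c. Poly_Mapping.keys c \<subseteq> K}" "y \<in> lin_ext scale F ` {c. Poly_Mapping.keys c \<subseteq> K}"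
  then obtain c c' where *: "x = lin_ext scale F c" "y = lin_ext scale F c'" "Poly_Mapping.keys c \<subseteq> K" "Poly_Mapping.keys c' \<subseteq> K"
    by auto
  have "Poly_Mapping.keys (c + c') \<subseteq> K"
    using * keys_add[of c c'] by auto
  then show "x + y \<in> lin_ext scale F ` {c. Poly_Mapping.keys c \<subseteq> K}"
    using * by (intro image_eqI[where x="c + c'"]) auto
next
  fix a x assume "x \<in> lin_ext scale F ` {c. Poly_Mapping.keys c \<subseteq> K}"
  then obtain c where *: "x = lin_ext scale F c" "Poly_Mapping.keys c \<subseteq> K"
    by auto
  have "Poly_Mapping.keys (fm_scale a c) \<subseteq> K"
    using *(2) keys_fm_scale[of a c] by (rule order.trans[rotated])
  then show "scale a x \<in> lin_ext scale F ` {c. Poly_Mapping.keys c \<subseteq> K}"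
    unfolding *(1) lin_ext_scale[symmetric] by blast
qed

text \<open>Provides elements of a span with coordinates, bundled as one finitely supported
  function, so that linear maps can be evaluated through a single \<open>lin_ext\<close>.\<close>

lemma span_eq_lin_ext_image:
  "span (F ` K) = lin_ext scale F ` {c. Poly_Mapping.keys c \<subseteq> K}"
proof
  have "F b \<in> lin_ext scale F ` {c. Poly_Mapping.keys c \<subseteq> K}" if "b \<in> K" for b
    using that by (intro image_eqI[where x="basis_vec b"]) auto
  then show "span (F ` K) \<subseteq> lin_ext scale F ` {c. Poly_Mapping.keys c \<subseteq> K}"
    by (intro span_minimal subspace_lin_ext_image) auto
  show "lin_ext scale F ` {c. Poly_Mapping.keys c \<subseteq> K} \<subseteq> span (F ` K)"
    by (intro image_subsetI lin_ext_in_subspace subspace_span) (auto intro: span_base)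
qed

end

lemma lin_ext_basis_vec: "lin_ext fm_scale basis_vec x = x"
proof (rule poly_mapping_eqI)
  fix k
  have "Poly_Mapping.lookup (lin_ext fm_scale basis_vec x) k
      = (\<Sum>b\<in>Poly_Mapping.keys x. if b = k then Poly_Mapping.lookup x k else 0)"
    unfolding lin_ext_def lookup_sum by (intro sum.cong) (auto simp: lookup_single when_def)
  then show "Poly_Mapping.lookup (lin_ext fm_scale basis_vec x) k = Poly_Mapping.lookup x k"
    by (auto simp: in_keys_iff)
qed

lemma keys_lin_ext:
  "Poly_Mapping.keys (lin_ext fm_scale F x) \<subseteq> (\<Union>b\<in>Poly_Mapping.keys x. Poly_Mapping.keys (F b))"
  unfolding lin_ext_def
  by (rule order.trans[OF keys_sum]) (intro UN_mono order_refl keys_fm_scale)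

text \<open>The axioms of a Hopf algebra that concern its coproduct only hold modulo the multilinearity
  relations \<open>W\<close>.\<close>

definition lin_mod ::
  "'a set \<Rightarrow> ('k \<Rightarrow> 'a::ab_group_add \<Rightarrow> 'a) \<Rightarrow> ('k \<Rightarrow> 'b::ab_group_add \<Rightarrow> 'b) \<Rightarrow> 'b set \<Rightarrow> ('a \<Rightarrow> 'b) \<Rightarrow> bool"
  where "lin_mod A s s' W F \<longleftrightarrow>
    (\<forall>x\<in>A. \<forall>y\<in>A. F (x + y) - F x - F y \<in> W) \<and> (\<forall>c. \<forall>x\<in>A. F (s c x) - s' c (F x) \<in> W)"

lemma lin_mod_linear_on: "0 \<in> W \<Longrightarrow> linear_on A s s' F \<Longrightarrow> lin_mod A s s' W F"
  by (simp add: lin_mod_def linear_on_def)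

lemma lin_mod_0_iff: "lin_mod A s s' {0} F \<longleftrightarrow> linear_on A s s' F"
  by (simp add: lin_mod_def linear_on_def algebra_simps)

text \<open>Universal property of the tensor power: the relations are generated by the failures of
  linearity in a slot, and \<open>F\<close> turns each of these into an element of \<open>W\<close>.
  With \<open>W = {0}\<close> this gives multilinear maps into a module; with relations for
  \<open>W\<close> it gives maps between tensor powers.\<close>

lemma multilinear_rels_lin_ext:
  fixes s :: "'k::comm_ring_1 \<Rightarrow> 'a::ab_group_add \<Rightarrow> 'a"
  assumes "module s'" "module.subspace s' W"
    and "\<And>\<sigma>. \<sigma> \<in> slots \<Longrightarrow> lin_mod A s s' W (\<lambda>x. F (\<sigma> x))"
    and x: "x \<in> multilinear_rels s A slots"
  shows "lin_ext s' F x \<in> W"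
proof -
  interpret s': module s' by fact
  show ?thesis
    using x unfolding multilinear_rels_def
  proof (induction rule: fm.span_induct)
    case base
    show "fm.subspace {a. lin_ext s' F a \<in> W}"
      using assms(2) by (auto intro!: fm.subspaceI simp: s'.subspace_add s'.subspace_scale s'.subspace_0)
  next
    case (step x)
    then show ?case
      using assms(3) by (force simp: lin_mod_def)
  qed
qed

text \<open>The universal multilinear map itself: its failures of linearity are the generators of
  the relations.\<close>

lemma slot_lin_mod:
  fixes s :: "'k::comm_ring_1 \<Rightarrow> 'a::ab_group_add \<Rightarrow> 'a"
  assumes "\<sigma> \<in> slots"
  shows "lin_mod A s fm_scale (multilinear_rels s A slots) (\<lambda>x. basis_vec (\<sigma> x))"
  unfolding lin_mod_def multilinear_rels_def using assms
  by (intro conjI ballI allI fm.span_base) blast+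

lemma (in module) lin_mod_eq_on_span:
  assumes "module s'" "module.subspace s' W" "lin_mod A scale s' W F" "lin_mod A scale s' W G"
    and "span E \<subseteq> A" "\<And>b. b \<in> E \<Longrightarrow> F b - G b \<in> W" and x: "x \<in> span E"
  shows "F x - G x \<in> W"
proof -
  interpret s': module s' by fact
  \<comment> \<open>Linearity modulo \<open>W\<close> is known only on \<open>A\<close>, so
    membership in the span has to be carried through the induction.\<close>
  have "x \<in> span E \<and> F x - G x \<in> W"
    using x
  proof (induction rule: span_induct_alt)
    case base
    have 0: "0 \<in> A"
      using assms(5) span_zero by blast
    \<comment> \<open>\<open>lin_mod\<close> does not speak of zero; its scaling clause at the
      scalar 0 yields that \<open>F 0\<close> and \<open>G 0\<close> lie in
      \<open>W\<close>.\<close>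
    have "F (scale 0 0) - s' 0 (F 0) \<in> W" "G (scale 0 0) - s' 0 (G 0) \<in> W"
      using 0 assms(3,4) unfolding lin_mod_def by blast+
    then show ?case
      using span_zero s'.subspace_diff[OF assms(2)] by fastforce
  next
    case (step c b y)
    have span: "b \<in> span E" "scale c b \<in> span E" "scale c b + y \<in> span E"
      using step by (auto intro: span_base span_scale span_add)
    then have A: "b \<in> A" "scale c b \<in> A" "y \<in> A"
      using step assms(5) by auto
    have 1: "F (scale c b + y) - F (scale c b) - F y \<in> W" "G (scale c b + y) - G (scale c b) - G y \<in> W"
      "F (scale c b) - s' c (F b) \<in> W" "G (scale c b) - s' c (G b) \<in> W"
      using A assms(3,4) unfolding lin_mod_def by blast+
    have 2: "s' c (F b - G b) \<in> W"
      using step assms(2,6) s'.subspace_scale by blast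
    have "F (scale c b + y) - G (scale c b + y) = (F (scale c b + y) - F (scale c b) - F y)
        - (G (scale c b + y) - G (scale c b) - G y)
        + ((F (scale c b) - s' c (F b)) - (G (scale c b) - s' c (G b))) + s' c (F b - G b) + (F y - G y)"
      by (simp add: s'.scale_right_diff_distrib algebra_simps)
    also have "\<dots> \<in> W"
      by (rule s'.subspace_add s'.subspace_diff assms(2) 1 2 conjunct2[OF step.IH])+
    finally show ?case
      using span by simp
  qed
  then show ?thesis by simp
qed

lemma (in module) lin_mod_sum:
  assumes "module s'" "module.subspace s' W" "subspace A" "lin_mod A scale s' W F" "\<And>j. j \<in> J \<Longrightarrow> f j \<in> A" "finite J"
  shows "F (\<Sum>j\<in>J. f j) - (\<Sum>j\<in>J. F (f j)) \<in> W"
proof -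
  interpret s': module s' by fact
  show ?thesis
    using assms(6,5)
  proof (induction J rule: finite_induct)
    case empty
    have "F (scale 0 0) - s' 0 (F 0) \<in> W"
      using assms(4) subspace_0[OF assms(3)] unfolding lin_mod_def by blast
    then show ?case by simp
  next
    case (insert j J)
    have "(\<Sum>j\<in>J. f j) \<in> A" "f j \<in> A"
      using insert by (auto intro!: subspace_sum assms(3))
    then have "F (f j + (\<Sum>j\<in>J. f j)) - F (f j) - F (\<Sum>j\<in>J. f j) \<in> W"
      using assms(4) unfolding lin_mod_def by blast
    from s'.subspace_add[OF assms(2) this insert.IH] show ?case
      using insert by (simp add: algebra_simps)
  qed
qed

text \<open>A pair of two sums is a single formal basis vector. It may be expanded into the double
  sum of pairs only modulo the relations, by distributing over one slot after the other.\<close>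

lemma (in module) tensor2_sum:
  assumes "subspace A" "\<And>j. j \<in> J \<Longrightarrow> f j \<in> A" "\<And>k. k \<in> K \<Longrightarrow> g k \<in> A" "finite J" "finite K"
  shows "basis_vec (\<Sum>j\<in>J. f j, \<Sum>k\<in>K. g k) - (\<Sum>j\<in>J. \<Sum>k\<in>K. basis_vec (f j, g k))
    \<in> multilinear_rels scale A (slots2 A)"
proof -
  let ?R = "multilinear_rels scale A (slots2 A)"
  have sub: "fm.subspace ?R"
    by (simp add: multilinear_rels_def)
  have G: "(\<Sum>k\<in>K. g k) \<in> A"
    using assms by (intro subspace_sum) auto
  have slots: "(\<lambda>x. (x, b)) \<in> slots2 A" "(\<lambda>x. (b, x)) \<in> slots2 A" if "b \<in> A" for b
    using that by (auto simp: slots2_def)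
  have 1: "basis_vec (\<Sum>j\<in>J. f j, \<Sum>k\<in>K. g k) - (\<Sum>j\<in>J. basis_vec (f j, \<Sum>k\<in>K. g k)) \<in> ?R"
    using assms by (intro lin_mod_sum[OF module_fm_scale sub assms(1) slot_lin_mod[OF slots(1)[OF G]]]) auto
  have "basis_vec (f j, \<Sum>k\<in>K. g k) - (\<Sum>k\<in>K. basis_vec (f j, g k)) \<in> ?R" if "j \<in> J" for j
    using assms that by (intro lin_mod_sum[OF module_fm_scale sub assms(1) slot_lin_mod[OF slots(2)]]) auto
  then have "(\<Sum>j\<in>J. basis_vec (f j, \<Sum>k\<in>K. g k) - (\<Sum>k\<in>K. basis_vec (f j, g k))) \<in> ?R"
    by (intro fm.subspace_sum sub)
  from fm.subspace_add[OF sub 1 this] show ?thesis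
    by (simp add: sum_subtractf)
qed

lemma span_basis_vec: "fm.span (basis_vec ` K) = {x. Poly_Mapping.keys x \<subseteq> K}"
  by (simp add: fm.span_eq_lin_ext_image lin_ext_basis_vec)

lemma lookup_lin_ext_inj:
  assumes "inj_on f I" "Poly_Mapping.keys c \<subseteq> I" "i \<in> I"
  shows "Poly_Mapping.lookup (lin_ext fm_scale (\<lambda>j. basis_vec (f j)) c) (f i) = Poly_Mapping.lookup c i"
proof -
  have "Poly_Mapping.lookup (lin_ext fm_scale (\<lambda>j. basis_vec (f j)) c) (f i)
      = (\<Sum>j\<in>Poly_Mapping.keys c. if j = i then Poly_Mapping.lookup c i else 0)"
    unfolding lin_ext_def lookup_sum using assms
    by (intro sum.cong) (auto simp: lookup_single when_def inj_on_eq_iff[OF assms(1)] subset_iff)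
  then show ?thesis
    by (auto simp: in_keys_iff)
qed

lemma linear_on_lin_ext_id: "module s \<Longrightarrow> linear_on A fm_scale s (lin_ext s F)"
  by (simp add: linear_on_def module.lin_ext_add module.lin_ext_scale)

section \<open>Modules with a free basis\<close>

locale free_basis = module s for s :: "'k::comm_ring_1 \<Rightarrow> 'a::ab_group_add \<Rightarrow> 'a" +
  fixes I :: "'i set" and e :: "'i \<Rightarrow> 'a"
  assumes indep: "Poly_Mapping.keys c \<subseteq> I \<Longrightarrow> lin_ext s e c = 0 \<Longrightarrow> c = 0"
begin

text \<open>Has the same shape as \<open>p_coords\<close>, so that the coproduct of
  \<open>Pi_hopf\<close> can be recognized as a linear extension from the basis.\<close>

definition coords :: "'a \<Rightarrow> ('i \<Rightarrow>\<^sub>0 'k)" where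
  "coords x = (THE c. Poly_Mapping.keys c \<subseteq> I \<and> lin_ext s e c = x)"

lemma basis_inj:
  assumes "Poly_Mapping.keys c \<subseteq> I" "Poly_Mapping.keys c' \<subseteq> I" "lin_ext s e c = lin_ext s e c'"
  shows "c = c'"
proof -
  have "Poly_Mapping.keys (c - c') \<subseteq> I"
    using keys_diff[of c c'] assms by blast
  then have "c - c' = 0"
    using assms by (intro indep) auto
  then show ?thesis by simp
qed

lemma coords_lin_ext: "Poly_Mapping.keys c \<subseteq> I \<Longrightarrow> coords (lin_ext s e c) = c"
  unfolding coords_def by (rule the_equality) (auto intro: basis_inj)

lemma spanE:
  assumes "x \<in> span (e ` I)"
  obtains c where "x = lin_ext s e c" "Poly_Mapping.keys c \<subseteq> I"
  using assms unfolding span_eq_lin_ext_image by auto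

lemma coords_basis: "i \<in> I \<Longrightarrow> coords (e i) = basis_vec i"
  using coords_lin_ext[of "basis_vec i"] by simp

lemma linear_on_coords: "linear_on (span (e ` I)) s fm_scale coords"
  unfolding linear_on_def
proof (intro conjI ballI allI)
  fix x y assume "x \<in> span (e ` I)" "y \<in> span (e ` I)"
  then obtain c c' where *: "x = lin_ext s e c" "Poly_Mapping.keys c \<subseteq> I"
     "y = lin_ext s e c'" "Poly_Mapping.keys c' \<subseteq> I"
    by (metis spanE)
  moreover have "Poly_Mapping.keys (c + c') \<subseteq> I"
    using * keys_add[of c c'] by blast
  ultimately show "coords (x + y) = coords x + coords y"
    using coords_lin_ext[of "c + c'"] by (simp add: coords_lin_ext)
next
  fix a x assume "x \<in> span (e ` I)"
  then obtain c where *: "x = lin_ext s e c" "Poly_Mapping.keys c \<subseteq> I"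
    by (metis spanE)
  moreover have "Poly_Mapping.keys (fm_scale a c) \<subseteq> I"
    using * keys_fm_scale[of a c] by blast
  ultimately show "coords (s a x) = fm_scale a (coords x)"
    using coords_lin_ext[of "fm_scale a c"] by (simp add: coords_lin_ext)
qed

definition extend :: "('k \<Rightarrow> 'm \<Rightarrow> 'm) \<Rightarrow> ('i \<Rightarrow> 'm::ab_group_add) \<Rightarrow> 'a \<Rightarrow> 'm" where
  "extend s' F x = lin_ext s' F (coords x)"

lemma extend_lin_ext: "Poly_Mapping.keys c \<subseteq> I \<Longrightarrow> extend s' F (lin_ext s e c) = lin_ext s' F c"
  by (simp add: extend_def coords_lin_ext)

lemma extend_basis: "module s' \<Longrightarrow> i \<in> I \<Longrightarrow> extend s' F (e i) = F i"
  by (simp add: extend_def coords_basis module.lin_ext_single module.scale_one)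

lemma extend_linear_on:
  assumes "module s'" shows "linear_on (span (e ` I)) s s' (extend s' F)"
proof -
  interpret s': module s' by fact
  show ?thesis
    using linear_on_coords by (auto simp: linear_on_def extend_def)
qed

end

section \<open>Connected graded Hopf algebras with a basis\<close>

text \<open>Meant for a coproduct followed by a map on tensors: the coproduct is linear modulo
  \<open>R\<close>, and the second map sends \<open>R\<close> into \<open>W\<close>.\<close>

lemma lin_mod_comp_lin_ext:
  fixes s :: "'k::comm_ring_1 \<Rightarrow> 'a::ab_group_add \<Rightarrow> 'a"
  assumes "module s'" "lin_mod A s fm_scale R F" "\<And>x. x \<in> R \<Longrightarrow> lin_ext s' G x \<in> W"
  shows "lin_mod A s s' W (\<lambda>x. lin_ext s' G (F x))"
proof -
  interpret s': module s' by fact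
  show ?thesis
    using assms(2,3) unfolding lin_mod_def
    by (metis s'.lin_ext_diff s'.lin_ext_scale)
qed

lemma lin_mod_lin_ext_fun:
  fixes s :: "'k::comm_ring_1 \<Rightarrow> 'a::ab_group_add \<Rightarrow> 'a"
  assumes "module s'" "module.subspace s' W" "\<And>b. b \<in> Poly_Mapping.keys y \<Longrightarrow> lin_mod A s s' W (F b)"
  shows "lin_mod A s s' W (\<lambda>x. lin_ext s' (\<lambda>b. F b x) y)"
proof -
  interpret s': module s' by fact
  have "lin_ext s' (\<lambda>b. F b (x + x') - F b x - F b x') y \<in> W" if "x \<in> A" "x' \<in> A" for x x'
    using assms(3) that by (intro s'.lin_ext_in_subspace assms(2)) (auto simp: lin_mod_def)
  moreover have "lin_ext s' (\<lambda>b. F b (s c x) - s' c (F b x)) y \<in> W" if "x \<in> A" for x c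
    using assms(3) that by (intro s'.lin_ext_in_subspace assms(2)) (auto simp: lin_mod_def)
  ultimately show ?thesis
    by (simp add: lin_mod_def s'.lin_ext_diff_fun s'.lin_ext_scale_fun)
qed

lemma lin_mod_comp_linear_on:
  assumes "lin_mod A s s' W F" "linear_on A s s L" "L ` A \<subseteq> A"
  shows "lin_mod A s s' W (\<lambda>x. F (L x))"
  using assms by (auto simp: lin_mod_def linear_on_def image_subset_iff)

text \<open>A structure that is free on a basis \<open>e\<close> indexed by \<open>I\<close>; the coproduct of \<open>e i\<close> is given by
  its structure constants \<open>D i\<close>. Connectedness is \<open>deg_0_iff\<close>.\<close>

locale hopf_basis =
  fixes H :: "('k::comm_ring_1, 'a::ab_group_add) hopf"
    and I :: "'i set" and e :: "'i \<Rightarrow> 'a" and i0 :: 'i and d :: "'i \<Rightarrow> nat"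
    and D :: "'i \<Rightarrow> ('i \<times> 'i \<Rightarrow>\<^sub>0 'k)"
  assumes module_scal: "module (scal H)"
    and carr_eq: "carr H = module.span (scal H) (e ` I)"
    and deg_part_eq: "deg_part H n = module.span (scal H) (e ` {i \<in> I. d i = n})"
    and indep: "Poly_Mapping.keys c \<subseteq> I \<Longrightarrow> lin_ext (scal H) e c = 0 \<Longrightarrow> c = 0"
    and i0_in: "i0 \<in> I"
    and one_eq: "one H = e i0"
    and deg_0_iff: "i \<in> I \<Longrightarrow> d i = 0 \<longleftrightarrow> i = i0"
    and mul_left: "y \<in> carr H \<Longrightarrow> linear_on (carr H) (scal H) (scal H) (\<lambda>x. mul H x y)"
    and mul_right: "x \<in> carr H \<Longrightarrow> linear_on (carr H) (scal H) (scal H) (mul H x)"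
    and mul_basis_deg: "i \<in> I \<Longrightarrow> j \<in> I \<Longrightarrow> mul H (e i) (e j) \<in> deg_part H (d i + d j)"
    and assoc_basis: "i \<in> I \<Longrightarrow> j \<in> I \<Longrightarrow> k \<in> I \<Longrightarrow>
      mul H (mul H (e i) (e j)) (e k) = mul H (e i) (mul H (e j) (e k))"
    and one_mul_basis: "i \<in> I \<Longrightarrow> mul H (e i0) (e i) = e i"
    and mul_one_basis: "i \<in> I \<Longrightarrow> mul H (e i) (e i0) = e i"
    and counit_lin: "linear_on (carr H) (scal H) (*) (counit H)"
    and counit_basis: "i \<in> I \<Longrightarrow> counit H (e i) = (if i = i0 then 1 else 0)"
    and comul_keys: "x \<in> carr H \<Longrightarrow> Poly_Mapping.keys (comul H x) \<subseteq> carr H \<times> carr H"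
    and comul_lin_mod: "lin_mod (carr H) (scal H) fm_scale
      (multilinear_rels (scal H) (carr H) (slots2 (carr H))) (comul H)"
    and comul_basis: "i \<in> I \<Longrightarrow>
      tensor2_eq H (comul H (e i)) (lin_ext fm_scale (\<lambda>(a, b). basis_vec (e a, e b)) (D i))"
    and D_keys: "i \<in> I \<Longrightarrow> (a, b) \<in> Poly_Mapping.keys (D i) \<Longrightarrow> a \<in> I \<and> b \<in> I \<and> d a + d b = d i"
    and D_coassoc: "i \<in> I \<Longrightarrow>
      lin_ext fm_scale (\<lambda>(a, b). lin_ext fm_scale (\<lambda>(a1, a2). basis_vec (a1, a2, b)) (D a)) (D i) =
      lin_ext fm_scale (\<lambda>(a, b). lin_ext fm_scale (\<lambda>(b1, b2). basis_vec (a, b1, b2)) (D b)) (D i)"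
    and D_counit_left: "i \<in> I \<Longrightarrow>
      lin_ext fm_scale (\<lambda>(a, b). if a = i0 then basis_vec b else 0) (D i) = basis_vec i"
    and D_counit_right: "i \<in> I \<Longrightarrow>
      lin_ext fm_scale (\<lambda>(a, b). if b = i0 then basis_vec a else 0) (D i) = basis_vec i"
    and comul_mul_basis: "i \<in> I \<Longrightarrow> j \<in> I \<Longrightarrow> tensor2_eq H (comul H (mul H (e i) (e j)))
      (tensor2_mul H (lin_ext fm_scale (\<lambda>(a, b). basis_vec (e a, e b)) (D i))
         (lin_ext fm_scale (\<lambda>(a, b). basis_vec (e a, e b)) (D j)))"
begin

section \<open>Extension of the bialgebra axioms from the basis to all elements\<close>

interpretation s: module "scal H" by (rule module_scal)

abbreviation "rels2 \<equiv> multilinear_rels (scal H) (carr H) (slots2 (carr H))"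
abbreviation "rels3 \<equiv> multilinear_rels (scal H) (carr H) (slots3 (carr H))"

text \<open>The representative of the coproduct of \<open>e i\<close> that is built from the
  structure constants; \<open>comul\<close> agrees with it only modulo \<open>rels2\<close>.\<close>

definition De :: "'i \<Rightarrow> ('a \<times> 'a \<Rightarrow>\<^sub>0 'k)" where
  "De i = lin_ext fm_scale (\<lambda>(a, b). basis_vec (e a, e b)) (D i)"

lemma subspace_rels: "fm.subspace (multilinear_rels (scal H) (carr H) sl)"
  by (simp add: multilinear_rels_def)

lemma carr_subspace: "s.subspace (carr H)"
  by (simp add: carr_eq)

lemma e_in [simp]: "i \<in> I \<Longrightarrow> e i \<in> carr H"
  by (auto simp: carr_eq intro: s.span_base)

lemma deg_part_subset: "deg_part H n \<subseteq> carr H"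
  unfolding carr_eq deg_part_eq by (intro s.span_mono) auto

lemma eq_on_carr:
  assumes "module s'" "linear_on (carr H) (scal H) s' F" "linear_on (carr H) (scal H) s' G"
    and "\<And>i. i \<in> I \<Longrightarrow> F (e i) = G (e i)" "x \<in> carr H"
  shows "F x = G x"
  using s.lin_mod_eq_on_span[of s' "{0}" "carr H" F G "e ` I" x] assms
  by (auto simp: lin_mod_0_iff carr_eq module.subspace_single_0)

lemma eq_mod_on_carr:
  assumes "module s'" "module.subspace s' W" "lin_mod (carr H) (scal H) s' W F" "lin_mod (carr H) (scal H) s' W G"
    and "\<And>i. i \<in> I \<Longrightarrow> F (e i) - G (e i) \<in> W" "x \<in> carr H"
  shows "F x - G x \<in> W"
  using s.lin_mod_eq_on_span[of s' W "carr H" F G "e ` I" x] assms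
  by (auto simp: carr_eq)

lemma mul_in: assumes "x \<in> carr H" "y \<in> carr H" shows "mul H x y \<in> carr H"
proof -
  have 1: "mul H (e i) y \<in> carr H" if "i \<in> I" "y \<in> carr H" for i y
    using that(2) unfolding carr_eq[unfolded s.span_eq_lin_ext_image]
  proof clarify
    fix c :: "'i \<Rightarrow>\<^sub>0 'k" assume c: "Poly_Mapping.keys c \<subseteq> I"
    have "mul H (e i) (lin_ext (scal H) e c) = lin_ext (scal H) (\<lambda>j. mul H (e i) (e j)) c"
      using c that by (intro s.linear_on_lin_ext[OF module_scal carr_subspace mul_right]) auto
    also have "\<dots> \<in> carr H"
      using c that deg_part_subset mul_basis_deg by (intro s.lin_ext_in_subspace carr_subspace) blast
    finally show "mul H (e i) (lin_ext (scal H) e c) \<in> lin_ext (scal H) e ` {c. Poly_Mapping.keys c \<subseteq> I}"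
      by (simp add: carr_eq s.span_eq_lin_ext_image)
  qed
  obtain c where c: "x = lin_ext (scal H) e c" "Poly_Mapping.keys c \<subseteq> I"
    using assms(1) unfolding carr_eq s.span_eq_lin_ext_image by auto
  have "mul H x y = lin_ext (scal H) (\<lambda>i. mul H (e i) y) c"
    unfolding c(1) using c(2) assms
    by (intro s.linear_on_lin_ext[where L="\<lambda>x. mul H x y", OF module_scal carr_subspace mul_left]) auto
  also have "\<dots> \<in> carr H"
    using c 1 assms by (intro s.lin_ext_in_subspace carr_subspace) auto
  finally show ?thesis .
qed

lemma tensor2_map:
  assumes "module s'" "module.subspace s' W"
    and "\<And>b. b \<in> carr H \<Longrightarrow> lin_mod (carr H) (scal H) s' W (\<lambda>x. F (x, b))"
    and "\<And>b. b \<in> carr H \<Longrightarrow> lin_mod (carr H) (scal H) s' W (\<lambda>x. F (b, x))"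
    and "x \<in> rels2"
  shows "lin_ext s' F x \<in> W"
  using assms(5) by (rule multilinear_rels_lin_ext[OF assms(1,2), rotated]) (auto simp: slots2_def assms(3,4))

text \<open>The case \<open>W = {0}\<close> of the universal property. It allows
  \<open>comul\<close> to be replaced by any other representative inside a bilinear
  expression.\<close>

lemma tensor2_eq_bilinear:
  assumes "module s'" "tensor2_eq H x y"
    and "\<And>b. b \<in> carr H \<Longrightarrow> linear_on (carr H) (scal H) s' (\<lambda>x. F (x, b))"
    and "\<And>b. b \<in> carr H \<Longrightarrow> linear_on (carr H) (scal H) s' (\<lambda>x. F (b, x))"
  shows "lin_ext s' F x = lin_ext s' F y"
proof -
  interpret s': module s' by fact
  have "lin_ext s' F (x - y) \<in> {0}"
    using assms by (intro tensor2_map) (auto simp: tensor2_eq_def lin_mod_0_iff)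
  then show ?thesis by simp
qed

lemma comul_bilinear_lin:
  assumes "module s'"
    and "\<And>b. b \<in> carr H \<Longrightarrow> linear_on (carr H) (scal H) s' (\<lambda>x. F (x, b))"
    and "\<And>b. b \<in> carr H \<Longrightarrow> linear_on (carr H) (scal H) s' (\<lambda>x. F (b, x))"
  shows "linear_on (carr H) (scal H) s' (\<lambda>x. lin_ext s' F (comul H x))"
proof -
  interpret s': module s' by fact
  have "lin_mod (carr H) (scal H) s' {0} (\<lambda>x. lin_ext s' F (comul H x))"
    by (intro lin_mod_comp_lin_ext[OF _ comul_lin_mod] tensor2_map)
      (auto simp: assms lin_mod_0_iff)
  then show ?thesis by (simp add: lin_mod_0_iff)
qed

lemma comul_bilinear_basis:
  assumes "module s'"
    and "\<And>b. b \<in> carr H \<Longrightarrow> linear_on (carr H) (scal H) s' (\<lambda>x. F (x, b))"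
    and "\<And>b. b \<in> carr H \<Longrightarrow> linear_on (carr H) (scal H) s' (\<lambda>x. F (b, x))"
    and "i \<in> I"
  shows "lin_ext s' F (comul H (e i)) = lin_ext s' (\<lambda>(a, b). F (e a, e b)) (D i)"
proof -
  interpret s': module s' by fact
  have "lin_ext s' F (comul H (e i)) = lin_ext s' F (De i)"
    unfolding De_def by (intro tensor2_eq_bilinear comul_basis assms)
  also have "\<dots> = lin_ext s' (\<lambda>(a, b). F (e a, e b)) (D i)"
    unfolding De_def s'.lin_ext_lin_ext by (intro s'.lin_ext_cong) auto
  finally show ?thesis .
qed

lemma slot2_lin_mod:
  assumes "b \<in> carr H"
  shows "lin_mod (carr H) (scal H) fm_scale rels2 (\<lambda>x. basis_vec (x, b))"
    "lin_mod (carr H) (scal H) fm_scale rels2 (\<lambda>x. basis_vec (b, x))"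
  by (rule slot_lin_mod; use assms in \<open>auto simp: slots2_def\<close>)+

lemma slot3_lin_mod:
  assumes "b \<in> carr H" "c \<in> carr H"
  shows "lin_mod (carr H) (scal H) fm_scale rels3 (\<lambda>x. basis_vec (x, b, c))"
    "lin_mod (carr H) (scal H) fm_scale rels3 (\<lambda>x. basis_vec (b, x, c))"
    "lin_mod (carr H) (scal H) fm_scale rels3 (\<lambda>x. basis_vec (b, c, x))"
  by (rule slot_lin_mod; use assms in \<open>auto simp: slots3_def\<close>)+

lemma keys_De: "i \<in> I \<Longrightarrow> Poly_Mapping.keys (De i) \<subseteq> (\<Union>k\<le>d i. deg_part H k \<times> deg_part H (d i - k))"
proof -
  assume i: "i \<in> I"
  let ?K = "\<Union>k\<le>d i. deg_part H k \<times> deg_part H (d i - k)"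
  have "Poly_Mapping.keys (De i) \<subseteq> (\<Union>p\<in>Poly_Mapping.keys (D i). {(e (fst p), e (snd p))})"
    unfolding De_def by (rule order.trans[OF keys_lin_ext]) (auto simp: case_prod_unfold split: if_splits)
  also have "\<dots> \<subseteq> ?K"
  proof clarify
    fix a b assume "(a, b) \<in> Poly_Mapping.keys (D i)"
    then have "a \<in> I" "b \<in> I" "d a + d b = d i"
      using D_keys[OF i] by blast+
    then show "(e (fst (a, b)), e (snd (a, b))) \<in> ?K"
      by (intro UN_I[of "d a"]) (auto simp: deg_part_eq intro!: s.span_base)
  qed
  finally show ?thesis .
qed

lemma keys_De_carr: "i \<in> I \<Longrightarrow> Poly_Mapping.keys (De i) \<subseteq> carr H \<times> carr H"
  using keys_De[of i] deg_part_subset by fastforce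

text \<open>\<open>comul_left\<close> is defined on representatives, so it has to be shown to
  descend to tensors. Varying the first factor uses that \<open>comul\<close> is linear modulo
  \<open>rels2\<close>; varying the second factor moves a single slot of each triple.\<close>

lemma comul_left_rels:
  assumes "x \<in> rels2" shows "comul_left H x \<in> rels3"
  unfolding comul_left_def
proof (rule tensor2_map[OF module_fm_scale subspace_rels _ _ assms])
  fix b assume b: "b \<in> carr H"
  have "lin_ext fm_scale (\<lambda>(a1, a2). basis_vec (a1, a2, b)) x \<in> rels3" if "x \<in> rels2" for x
    using that b by (intro tensor2_map[OF module_fm_scale subspace_rels]) (auto intro: slot3_lin_mod)
  then show "lin_mod (carr H) (scal H) fm_scale rels3
     (\<lambda>x. case (x, b) of (a, b) \<Rightarrow> lin_ext fm_scale (\<lambda>(a1, a2). basis_vec (a1, a2, b)) (comul H a))"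
    unfolding prod.case by (intro lin_mod_comp_lin_ext[OF module_fm_scale comul_lin_mod])
  have "lin_mod (carr H) (scal H) fm_scale rels3
     (\<lambda>x. lin_ext fm_scale (\<lambda>p. basis_vec (fst p, snd p, x)) (comul H b))"
    using comul_keys[OF b] by (intro lin_mod_lin_ext_fun module_fm_scale subspace_rels slot3_lin_mod) auto
  then show "lin_mod (carr H) (scal H) fm_scale rels3
     (\<lambda>x. case (b, x) of (a, b) \<Rightarrow> lin_ext fm_scale (\<lambda>(a1, a2). basis_vec (a1, a2, b)) (comul H a))"
    by (simp add: case_prod_unfold)
qed

lemma comul_right_rels:
  assumes "x \<in> rels2" shows "comul_right H x \<in> rels3"
  unfolding comul_right_def
proof (rule tensor2_map[OF module_fm_scale subspace_rels _ _ assms])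
  fix b assume b: "b \<in> carr H"
  have "lin_ext fm_scale (\<lambda>(b1, b2). basis_vec (b, b1, b2)) x \<in> rels3" if "x \<in> rels2" for x
    using that b by (intro tensor2_map[OF module_fm_scale subspace_rels]) (auto intro: slot3_lin_mod)
  then show "lin_mod (carr H) (scal H) fm_scale rels3
     (\<lambda>x. case (b, x) of (a, b) \<Rightarrow> lin_ext fm_scale (\<lambda>(b1, b2). basis_vec (a, b1, b2)) (comul H b))"
    unfolding prod.case by (intro lin_mod_comp_lin_ext[OF module_fm_scale comul_lin_mod])
  have "lin_mod (carr H) (scal H) fm_scale rels3
     (\<lambda>x. lin_ext fm_scale (\<lambda>p. basis_vec (x, fst p, snd p)) (comul H b))"
    using comul_keys[OF b] by (intro lin_mod_lin_ext_fun module_fm_scale subspace_rels slot3_lin_mod) auto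
  then show "lin_mod (carr H) (scal H) fm_scale rels3
     (\<lambda>x. case (x, b) of (a, b) \<Rightarrow> lin_ext fm_scale (\<lambda>(b1, b2). basis_vec (a, b1, b2)) (comul H b))"
    by (simp add: case_prod_unfold)
qed

text \<open>Replaces the inner \<open>comul\<close> by structure constants, term by term. What
  remains is a statement about indices alone, to which \<open>D_coassoc\<close> applies.\<close>

lemma comul_left_De:
  assumes "i \<in> I"
  shows "comul_left H (De i) - lin_ext fm_scale (\<lambda>(a, b, c). basis_vec (e a, e b, e c))
    (lin_ext fm_scale (\<lambda>(a, b). lin_ext fm_scale (\<lambda>(a1, a2). basis_vec (a1, a2, b)) (D a)) (D i)) \<in> rels3"
proof -
  let ?L = "\<lambda>b. lin_ext fm_scale (\<lambda>(a1, a2). basis_vec (a1, a2, b))"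
  have "comul_left H (De i) - lin_ext fm_scale (\<lambda>(a, b, c). basis_vec (e a, e b, e c))
     (lin_ext fm_scale (\<lambda>(a, b). lin_ext fm_scale (\<lambda>(a1, a2). basis_vec (a1, a2, b)) (D a)) (D i))
    = lin_ext fm_scale (\<lambda>(a, b). ?L (e b) (comul H (e a)) - ?L (e b) (De a)) (D i)"
    unfolding comul_left_def De_def fm.lin_ext_lin_ext fm.lin_ext_diff_fun[symmetric]
    by (intro fm.lin_ext_cong) (auto simp: fm.lin_ext_lin_ext case_prod_unfold)
  also have "\<dots> \<in> rels3"
  proof (intro fm.lin_ext_in_subspace subspace_rels, clarify)
    fix a b assume "(a, b) \<in> Poly_Mapping.keys (D i)"
    then have ab: "a \<in> I" "b \<in> I"
      using D_keys[OF assms] by blast+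
    have "?L (e b) (comul H (e a) - De a) \<in> rels3"
      using ab comul_basis[of a]
      by (intro tensor2_map[OF module_fm_scale subspace_rels]) (auto simp: tensor2_eq_def De_def intro: slot3_lin_mod)
    then show "?L (e b) (comul H (e a)) - ?L (e b) (De a) \<in> rels3"
      by simp
  qed
  finally show ?thesis .
qed

lemma comul_right_De:
  assumes "i \<in> I"
  shows "comul_right H (De i) - lin_ext fm_scale (\<lambda>(a, b, c). basis_vec (e a, e b, e c))
    (lin_ext fm_scale (\<lambda>(a, b). lin_ext fm_scale (\<lambda>(b1, b2). basis_vec (a, b1, b2)) (D b)) (D i)) \<in> rels3"
proof -
  let ?L = "\<lambda>b. lin_ext fm_scale (\<lambda>(b1, b2). basis_vec (b, b1, b2))"
  have "comul_right H (De i) - lin_ext fm_scale (\<lambda>(a, b, c). basis_vec (e a, e b, e c))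
     (lin_ext fm_scale (\<lambda>(a, b). lin_ext fm_scale (\<lambda>(b1, b2). basis_vec (a, b1, b2)) (D b)) (D i))
    = lin_ext fm_scale (\<lambda>(a, b). ?L (e a) (comul H (e b)) - ?L (e a) (De b)) (D i)"
    unfolding comul_right_def De_def fm.lin_ext_lin_ext fm.lin_ext_diff_fun[symmetric]
    by (intro fm.lin_ext_cong) (auto simp: fm.lin_ext_lin_ext case_prod_unfold)
  also have "\<dots> \<in> rels3"
  proof (intro fm.lin_ext_in_subspace subspace_rels, clarify)
    fix a b assume "(a, b) \<in> Poly_Mapping.keys (D i)"
    then have ab: "a \<in> I" "b \<in> I"
      using D_keys[OF assms] by blast+
    have "?L (e a) (comul H (e b) - De b) \<in> rels3"
      using ab comul_basis[of b]
      by (intro tensor2_map[OF module_fm_scale subspace_rels]) (auto simp: tensor2_eq_def De_def intro: slot3_lin_mod)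
    then show "?L (e a) (comul H (e b)) - ?L (e a) (De b) \<in> rels3"
      by simp
  qed
  finally show ?thesis .
qed

lemma coassoc_carr:
  assumes "x \<in> carr H"
  shows "tensor3_eq H (comul_left H (comul H x)) (comul_right H (comul H x))"
  unfolding tensor3_eq_def
proof (rule eq_mod_on_carr[OF module_fm_scale subspace_rels _ _ _ assms])
  show "lin_mod (carr H) (scal H) fm_scale rels3 (\<lambda>x. comul_left H (comul H x))"
    using comul_left_rels unfolding comul_left_def
    by (intro lin_mod_comp_lin_ext[OF module_fm_scale comul_lin_mod]) auto
  show "lin_mod (carr H) (scal H) fm_scale rels3 (\<lambda>x. comul_right H (comul H x))"
    using comul_right_rels unfolding comul_right_def
    by (intro lin_mod_comp_lin_ext[OF module_fm_scale comul_lin_mod]) auto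
  fix i assume i: "i \<in> I"
  have *: "comul H (e i) - De i \<in> rels2"
    using comul_basis[OF i] by (simp add: tensor2_eq_def De_def)
  \<comment> \<open>Both sides are compared with their values at \<open>De i\<close>, where
    coassociativity is that of the structure constants.\<close>
  have 1: "comul_left H (comul H (e i)) - comul_left H (De i) \<in> rels3"
    using comul_left_rels[OF *] by (simp add: comul_left_def)
  have 2: "comul_right H (comul H (e i)) - comul_right H (De i) \<in> rels3"
    using comul_right_rels[OF *] by (simp add: comul_right_def)
  have 3: "comul_left H (De i) - comul_right H (De i) \<in> rels3"
    using fm.subspace_diff[OF subspace_rels comul_left_De[OF i] comul_right_De[OF i]] D_coassoc[OF i] by simp
  show "comul_left H (comul H (e i)) - comul_right H (comul H (e i)) \<in> rels3"
    using fm.subspace_diff[OF subspace_rels fm.subspace_add[OF subspace_rels 1 3] 2] by simp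
qed

lemma counit_in_UNIV: "module ((*) :: 'k \<Rightarrow> 'k \<Rightarrow> 'k)"
  by standard (auto simp: algebra_simps)

lemma linear_on_counit_scal: "linear_on (carr H) (scal H) (scal H) (\<lambda>a. scal H (counit H a) b)"
  using counit_lin by (auto simp: linear_on_def s.scale_left_distrib)

lemma linear_on_scal: "linear_on (carr H) (scal H) (scal H) (\<lambda>a. scal H c a)"
  by (auto simp: linear_on_def s.scale_right_distrib mult.commute)

lemma linear_on_id: "linear_on (carr H) (scal H) (scal H) (\<lambda>a. a)"
  by (auto simp: linear_on_def)

lemma counit_left_carr:
  assumes "x \<in> carr H"
  shows "lin_ext (scal H) (\<lambda>(a, b). scal H (counit H a) b) (comul H x) = x"
proof (rule eq_on_carr[OF module_scal _ linear_on_id _ assms])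
  show "linear_on (carr H) (scal H) (scal H) (\<lambda>x. lin_ext (scal H) (\<lambda>(a, b). scal H (counit H a) b) (comul H x))"
    by (intro comul_bilinear_lin module_scal) (auto simp: linear_on_counit_scal linear_on_scal)
  fix i assume i: "i \<in> I"
  have "lin_ext (scal H) (\<lambda>(a, b). scal H (counit H a) b) (comul H (e i))
    = lin_ext (scal H) (\<lambda>(a, b). scal H (counit H (e a)) (e b)) (D i)"
    by (subst comul_bilinear_basis[OF module_scal _ _ i]) (auto simp: linear_on_counit_scal linear_on_scal)
  also have "\<dots> = lin_ext (scal H) e (lin_ext fm_scale (\<lambda>(a, b). if a = i0 then basis_vec b else 0) (D i))"
    unfolding s.lin_ext_lin_ext using D_keys[OF i] by (intro s.lin_ext_cong) (auto simp: counit_basis)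
  finally show "lin_ext (scal H) (\<lambda>(a, b). scal H (counit H a) b) (comul H (e i)) = e i"
    by (simp add: D_counit_left i)
qed

lemma counit_right_carr:
  assumes "x \<in> carr H"
  shows "lin_ext (scal H) (\<lambda>(a, b). scal H (counit H b) a) (comul H x) = x"
proof (rule eq_on_carr[OF module_scal _ linear_on_id _ assms])
  show "linear_on (carr H) (scal H) (scal H) (\<lambda>x. lin_ext (scal H) (\<lambda>(a, b). scal H (counit H b) a) (comul H x))"
    by (intro comul_bilinear_lin module_scal) (auto simp: linear_on_counit_scal linear_on_scal)
  fix i assume i: "i \<in> I"
  have "lin_ext (scal H) (\<lambda>(a, b). scal H (counit H b) a) (comul H (e i))
    = lin_ext (scal H) (\<lambda>(a, b). scal H (counit H (e b)) (e a)) (D i)"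
    by (subst comul_bilinear_basis[OF module_scal _ _ i]) (auto simp: linear_on_counit_scal linear_on_scal)
  also have "\<dots> = lin_ext (scal H) e (lin_ext fm_scale (\<lambda>(a, b). if b = i0 then basis_vec a else 0) (D i))"
    unfolding s.lin_ext_lin_ext using D_keys[OF i] by (intro s.lin_ext_cong) (auto simp: counit_basis)
  finally show "lin_ext (scal H) (\<lambda>(a, b). scal H (counit H b) a) (comul H (e i)) = e i"
    by (simp add: D_counit_right i)
qed

lemma linear_on_mul_left: "y \<in> carr H \<Longrightarrow> linear_on (carr H) (scal H) s' f \<Longrightarrow> linear_on (carr H) (scal H) s' (\<lambda>x. f (mul H x y))"
  using mul_left[of y] mul_in by (auto simp: linear_on_def)

lemma linear_on_mul_right: "x \<in> carr H \<Longrightarrow> linear_on (carr H) (scal H) s' f \<Longrightarrow> linear_on (carr H) (scal H) s' (\<lambda>y. f (mul H x y))"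
  using mul_right[of x] mul_in by (auto simp: linear_on_def)

lemma linear_on_mul_left': "y \<in> carr H \<Longrightarrow> f ` carr H \<subseteq> carr H \<Longrightarrow> linear_on (carr H) (scal H) (scal H) f \<Longrightarrow> linear_on (carr H) (scal H) (scal H) (\<lambda>x. mul H (f x) y)"
  using mul_left[of y] by (auto simp: linear_on_def image_subset_iff)

lemma linear_on_mul_right': "x \<in> carr H \<Longrightarrow> f ` carr H \<subseteq> carr H \<Longrightarrow> linear_on (carr H) (scal H) (scal H) f \<Longrightarrow> linear_on (carr H) (scal H) (scal H) (\<lambda>y. mul H x (f y))"
  using mul_right[of x] by (auto simp: linear_on_def image_subset_iff)

text \<open>By trilinearity the arguments can be freed from the basis one at a time, the others
  being held fixed.\<close>

lemma mul_assoc_carr: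
  assumes "x \<in> carr H" "y \<in> carr H" "z \<in> carr H"
  shows "mul H (mul H x y) z = mul H x (mul H y z)"
proof -
  have 1: "mul H (mul H x (e j)) (e k) = mul H x (mul H (e j) (e k))" if "j \<in> I" "k \<in> I" "x \<in> carr H" for j k x
    by (rule eq_on_carr[OF module_scal linear_on_mul_left[where f="\<lambda>x. mul H x (e k)"] mul_left _ that(3)])
      (simp_all add: that mul_left mul_in assoc_basis)
  have 2: "mul H (mul H x y) (e k) = mul H x (mul H y (e k))" if "k \<in> I" "x \<in> carr H" "y \<in> carr H" for k x y
    by (rule eq_on_carr[OF module_scal linear_on_mul_right[where f="\<lambda>x. mul H x (e k)"]
          linear_on_mul_left[where f="mul H x"] _ that(3)])
      (simp_all add: that mul_left mul_right mul_in 1)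
  show ?thesis
    by (rule eq_on_carr[OF module_scal mul_right linear_on_mul_right[where f="mul H x"] _ assms(3)])
      (simp_all add: assms mul_left mul_right mul_in 2)
qed

lemma one_in: "one H \<in> carr H"
  by (simp add: one_eq i0_in)

lemma one_mul_carr: "x \<in> carr H \<Longrightarrow> mul H (one H) x = x"
  by (rule eq_on_carr[OF module_scal mul_right linear_on_id]) (simp_all add: one_in, simp add: one_eq one_mul_basis)

lemma mul_one_carr: "x \<in> carr H \<Longrightarrow> mul H x (one H) = x"
  by (rule eq_on_carr[OF module_scal mul_left linear_on_id]) (simp_all add: one_in, simp add: one_eq mul_one_basis)

lemma counit_deg: "x \<in> deg_part H n \<Longrightarrow> n > 0 \<Longrightarrow> counit H x = 0"
proof -
  assume x: "x \<in> deg_part H n" and n: "n > 0"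
  then obtain c where c: "x = lin_ext (scal H) e c" "Poly_Mapping.keys c \<subseteq> {i \<in> I. d i = n}"
    by (auto simp: deg_part_eq s.span_eq_lin_ext_image)
  have "counit H x = lin_ext (*) (\<lambda>i. counit H (e i)) c"
    unfolding c(1) using c(2) by (intro s.linear_on_lin_ext[OF counit_in_UNIV carr_subspace counit_lin]) auto
  also have "\<dots> = lin_ext (*) (\<lambda>i. 0) c"
    using c(2) n deg_0_iff[OF i0_in] by (intro module.lin_ext_cong[OF counit_in_UNIV] refl) (force simp: counit_basis)
  finally show ?thesis
    by (simp add: module.lin_ext_zero_fun[OF counit_in_UNIV])
qed

lemma counit_mul_carr:
  assumes "x \<in> carr H" "y \<in> carr H"
  shows "counit H (mul H x y) = counit H x * counit H y"
proof -
  \<comment> \<open>Unless both factors are the unit, the product has positive degree and both sides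
    vanish.\<close>
  have 0: "counit H (mul H (e i) (e j)) = counit H (e i) * counit H (e j)" if "i \<in> I" "j \<in> I" for i j
  proof (cases "i = i0 \<and> j = i0")
    case True
    then show ?thesis by (simp add: one_mul_basis i0_in counit_basis)
  next
    case False
    then show ?thesis
      using counit_deg[OF mul_basis_deg[OF that]] that deg_0_iff by (auto simp: counit_basis)
  qed
  have lin: "linear_on (carr H) (scal H) (*) (\<lambda>x. counit H x * c)" "linear_on (carr H) (scal H) (*) (\<lambda>x. c * counit H x)" for c
    using counit_lin by (auto simp: linear_on_def algebra_simps)
  have 1: "counit H (mul H x (e j)) = counit H x * counit H (e j)" if "j \<in> I" "x \<in> carr H" for x j
    by (rule eq_on_carr[OF counit_in_UNIV linear_on_mul_left[where f="counit H"] lin(1) _ that(2)])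
      (simp_all add: that counit_lin 0)
  show ?thesis
    by (rule eq_on_carr[OF counit_in_UNIV linear_on_mul_right[where f="counit H"] lin(2) _ assms(2)])
      (simp_all add: assms counit_lin 1)
qed

lemma tensor2_mul_rels_left:
  assumes "x \<in> rels2" "Poly_Mapping.keys y \<subseteq> carr H \<times> carr H"
  shows "tensor2_mul H x y \<in> rels2"
  unfolding tensor2_mul_def
proof (rule tensor2_map[OF module_fm_scale subspace_rels _ _ assms(1)])
  have y: "fst p \<in> carr H" "snd p \<in> carr H" if "p \<in> Poly_Mapping.keys y" for p
    using assms(2) that by auto
  fix b assume b: "b \<in> carr H"
  have "lin_mod (carr H) (scal H) fm_scale rels2 (\<lambda>a. lin_ext fm_scale (\<lambda>p. basis_vec (mul H a (fst p), mul H b (snd p))) y)"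
    using b
    by (intro lin_mod_lin_ext_fun module_fm_scale subspace_rels lin_mod_comp_linear_on[OF slot2_lin_mod(1)] mul_left)
       (simp_all add: y mul_in image_subset_iff)
  then show "lin_mod (carr H) (scal H) fm_scale rels2
    (\<lambda>x. case (x, b) of (a, b) \<Rightarrow> lin_ext fm_scale (\<lambda>(c, d). basis_vec (mul H a c, mul H b d)) y)"
    by (simp add: case_prod_unfold)
  have "lin_mod (carr H) (scal H) fm_scale rels2 (\<lambda>a. lin_ext fm_scale (\<lambda>p. basis_vec (mul H b (fst p), mul H a (snd p))) y)"
    using b
    by (intro lin_mod_lin_ext_fun module_fm_scale subspace_rels lin_mod_comp_linear_on[OF slot2_lin_mod(2)] mul_left)
       (simp_all add: y mul_in image_subset_iff)
  then show "lin_mod (carr H) (scal H) fm_scale rels2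
    (\<lambda>x. case (b, x) of (a, b) \<Rightarrow> lin_ext fm_scale (\<lambda>(c, d). basis_vec (mul H a c, mul H b d)) y)"
    by (simp add: case_prod_unfold)
qed

lemma tensor2_mul_rels_right:
  assumes "x \<in> rels2" "Poly_Mapping.keys y \<subseteq> carr H \<times> carr H"
  shows "tensor2_mul H y x \<in> rels2"
proof -
  have y: "fst p \<in> carr H" "snd p \<in> carr H" if "p \<in> Poly_Mapping.keys y" for p
    using assms(2) that by auto
  \<comment> \<open>The definition sums over the left argument outside. Exchanging the two sums
    makes the right argument, which carries the relation, the outer one.\<close>
  have "tensor2_mul H y x = lin_ext fm_scale (\<lambda>q. lin_ext fm_scale (\<lambda>p. basis_vec (mul H (fst p) (fst q), mul H (snd p) (snd q))) y) x"
    unfolding tensor2_mul_def case_prod_unfold by (rule fm.lin_ext_commute)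
  also have "\<dots> \<in> rels2"
  proof (rule tensor2_map[OF module_fm_scale subspace_rels _ _ assms(1)])
    fix b assume b: "b \<in> carr H"
    show "lin_mod (carr H) (scal H) fm_scale rels2
      (\<lambda>x. lin_ext fm_scale (\<lambda>p. basis_vec (mul H (fst p) (fst (x, b)), mul H (snd p) (snd (x, b)))) y)"
      unfolding fst_conv snd_conv using b
      by (intro lin_mod_lin_ext_fun module_fm_scale subspace_rels lin_mod_comp_linear_on[OF slot2_lin_mod(1)] mul_right)
         (simp_all add: y mul_in image_subset_iff)
    show "lin_mod (carr H) (scal H) fm_scale rels2
      (\<lambda>x. lin_ext fm_scale (\<lambda>p. basis_vec (mul H (fst p) (fst (b, x)), mul H (snd p) (snd (b, x)))) y)"
      unfolding fst_conv snd_conv using b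
      by (intro lin_mod_lin_ext_fun module_fm_scale subspace_rels lin_mod_comp_linear_on[OF slot2_lin_mod(2)] mul_right)
         (simp_all add: y mul_in image_subset_iff)
  qed
  finally show ?thesis .
qed

lemma tensor2_mul_diff_left: "tensor2_mul H (x - x') y = tensor2_mul H x y - tensor2_mul H x' y"
  by (simp add: tensor2_mul_def)

lemma tensor2_mul_diff_right: "tensor2_mul H x (y - y') = tensor2_mul H x y - tensor2_mul H x y'"
  by (simp add: tensor2_mul_def case_prod_unfold fm.lin_ext_diff_fun)

lemma comul_mul_carr:
  assumes "x \<in> carr H" "y \<in> carr H"
  shows "tensor2_eq H (comul H (mul H x y)) (tensor2_mul H (comul H x) (comul H y))"
proof -
  have e: "comul H (e i) - De i \<in> rels2" if "i \<in> I" for i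
    using comul_basis[OF that] by (simp add: tensor2_eq_def De_def)
  have 1: "comul H (mul H x (e j)) - tensor2_mul H (comul H x) (De j) \<in> rels2" if "j \<in> I" "x \<in> carr H" for j x
  proof (rule eq_mod_on_carr[OF module_fm_scale subspace_rels _ _ _ \<open>x \<in> carr H\<close>])
    show "lin_mod (carr H) (scal H) fm_scale rels2 (\<lambda>x. comul H (mul H x (e j)))"
      using that by (intro lin_mod_comp_linear_on[OF comul_lin_mod] mul_left) (auto intro: mul_in)
    show "lin_mod (carr H) (scal H) fm_scale rels2 (\<lambda>x. tensor2_mul H (comul H x) (De j))"
      using tensor2_mul_rels_left[OF _ keys_De_carr[OF \<open>j \<in> I\<close>]] unfolding tensor2_mul_def
      by (intro lin_mod_comp_lin_ext[OF module_fm_scale comul_lin_mod]) auto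
    fix i assume i: "i \<in> I"
    have "comul H (mul H (e i) (e j)) - tensor2_mul H (De i) (De j) \<in> rels2"
      using comul_mul_basis[OF i \<open>j \<in> I\<close>] by (simp add: tensor2_eq_def De_def)
    from fm.subspace_diff[OF subspace_rels this tensor2_mul_rels_left[OF e[OF i] keys_De_carr[OF \<open>j \<in> I\<close>]]]
    show "comul H (mul H (e i) (e j)) - tensor2_mul H (comul H (e i)) (De j) \<in> rels2"
      by (simp add: tensor2_mul_diff_left)
  qed
  have "comul H (mul H x y) - tensor2_mul H (comul H x) (comul H y) \<in> rels2"
  proof (rule eq_mod_on_carr[OF module_fm_scale subspace_rels _ _ _ \<open>y \<in> carr H\<close>])
    show "lin_mod (carr H) (scal H) fm_scale rels2 (\<lambda>y. comul H (mul H x y))"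
      using assms by (intro lin_mod_comp_linear_on[OF comul_lin_mod] mul_right) (auto intro: mul_in)
    have "lin_mod (carr H) (scal H) fm_scale rels2 (\<lambda>y. lin_ext fm_scale (\<lambda>q. lin_ext fm_scale (\<lambda>p. basis_vec (mul H (fst p) (fst q), mul H (snd p) (snd q))) (comul H x)) (comul H y))"
      using tensor2_mul_rels_right[OF _ comul_keys[OF \<open>x \<in> carr H\<close>]]
      unfolding tensor2_mul_def case_prod_unfold fm.lin_ext_commute[where x="comul H x"]
      by (intro lin_mod_comp_lin_ext[OF module_fm_scale comul_lin_mod]) auto
    then show "lin_mod (carr H) (scal H) fm_scale rels2 (\<lambda>y. tensor2_mul H (comul H x) (comul H y))"
      unfolding tensor2_mul_def case_prod_unfold fm.lin_ext_commute[where x="comul H x"] .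
    fix j assume j: "j \<in> I"
    from fm.subspace_diff[OF subspace_rels 1[OF j assms(1)] tensor2_mul_rels_right[OF e[OF j] comul_keys[OF assms(1)]]]
    show "comul H (mul H x (e j)) - tensor2_mul H (comul H x) (comul H (e j)) \<in> rels2"
      by (simp add: tensor2_mul_diff_right)
  qed
  then show ?thesis by (simp add: tensor2_eq_def)
qed

end

section \<open>Antipode and grading\<close>

context hopf_basis
begin

interpretation s: module "scal H" by (rule module_scal)

sublocale free: free_basis "scal H" I e
  by (intro free_basis.intro module_scal free_basis_axioms.intro indep)

lemma carrE:
  assumes "x \<in> carr H"
  obtains c where "x = lin_ext (scal H) e c" "Poly_Mapping.keys c \<subseteq> I"
  using assms unfolding carr_eq by (rule free.spanE)

lemma deg_partE:
  assumes "x \<in> deg_part H n"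
  obtains c where "x = lin_ext (scal H) e c" "Poly_Mapping.keys c \<subseteq> {i \<in> I. d i = n}"
  using assms unfolding deg_part_eq s.span_eq_lin_ext_image by auto

lemma extend_linear_on: "module s' \<Longrightarrow> linear_on (carr H) (scal H) s' (free.extend s' F)"
  unfolding carr_eq by (rule free.extend_linear_on)

lemma comul_lin_ext:
  assumes "Poly_Mapping.keys c \<subseteq> I"
  shows "tensor2_eq H (comul H (lin_ext (scal H) e c)) (lin_ext fm_scale De c)"
proof -
  have x: "lin_ext (scal H) e c \<in> carr H"
    using assms by (intro s.lin_ext_in_subspace carr_subspace) auto
  have "comul H (lin_ext (scal H) e c) - free.extend fm_scale De (lin_ext (scal H) e c) \<in> rels2"
  proof (rule eq_mod_on_carr[OF module_fm_scale subspace_rels comul_lin_mod _ _ x])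
    show "lin_mod (carr H) (scal H) fm_scale rels2 (free.extend fm_scale De)"
      by (intro lin_mod_linear_on extend_linear_on module_fm_scale fm.subspace_0 subspace_rels)
    show "comul H (e i) - free.extend fm_scale De (e i) \<in> rels2" if "i \<in> I" for i
      using comul_basis[OF that] by (simp add: free.extend_basis module_fm_scale that tensor2_eq_def De_def)
  qed
  then show ?thesis
    by (simp add: free.extend_lin_ext assms tensor2_eq_def)
qed

text \<open>By the counit axiom the part of \<open>D i\<close> with right factor \<open>i0\<close>
  is the single term \<open>(i, i0)\<close>. By connectedness the other terms are those whose left
  factor has smaller degree, which makes recursion on the degree possible.\<close>

lemma D_split_right:
  assumes "i \<in> I" "module s'"
  shows "lin_ext s' (\<lambda>(a, b). F a b) (D i) = F i i0 + lin_ext s' (\<lambda>(a, b). if d a < d i then F a b else 0) (D i)"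
proof -
  interpret s': module s' by fact
  have "lin_ext s' (\<lambda>(a, b). F a b) (D i) = lin_ext s' (\<lambda>(a, b). (if b = i0 then F a i0 else 0) + (if d a < d i then F a b else 0)) (D i)"
  proof (intro s'.lin_ext_cong refl, clarify)
    fix a b assume "(a, b) \<in> Poly_Mapping.keys (D i)"
    then have "a \<in> I" "b \<in> I" "d a + d b = d i"
      using D_keys[OF assms(1)] by blast+
    then show "F a b = (if b = i0 then F a i0 else 0) + (if d a < d i then F a b else 0)"
      using deg_0_iff[of b] by auto
  qed
  also have "\<dots> = lin_ext s' (\<lambda>(a, b). if b = i0 then F a i0 else 0) (D i) + lin_ext s' (\<lambda>(a, b). if d a < d i then F a b else 0) (D i)"
    by (simp add: case_prod_unfold s'.lin_ext_add_fun)
  also have "lin_ext s' (\<lambda>(a, b). if b = i0 then F a i0 else 0) (D i)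
     = lin_ext s' (\<lambda>a. F a i0) (lin_ext fm_scale (\<lambda>(a, b). if b = i0 then basis_vec a else 0) (D i))"
    unfolding s'.lin_ext_lin_ext by (intro s'.lin_ext_cong) auto
  finally show ?thesis
    by (simp add: D_counit_right assms)
qed

lemma D_one: assumes "module s'" shows "lin_ext s' F (D i0) = F (i0, i0)"
proof -
  interpret s': module s' by fact
  have "lin_ext s' F (D i0) = lin_ext s' (\<lambda>(a, b). F (a, b)) (D i0)"
    by simp
  also have "\<dots> = F (i0, i0) + lin_ext s' (\<lambda>(a, b). if d a < d i0 then F (a, b) else 0) (D i0)"
    by (rule D_split_right[OF i0_in assms])
  also have "lin_ext s' (\<lambda>(a, b). if d a < d i0 then F (a, b) else 0) (D i0) = lin_ext s' (\<lambda>_. 0) (D i0)"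
    using deg_0_iff[OF i0_in] by (intro s'.lin_ext_cong) auto
  finally show ?thesis by simp
qed

text \<open>In the equation at \<open>i\<close>, the term with right factor \<open>i0\<close> is
  \<open>S i\<close> itself, because \<open>f i0\<close> is the unit; so the equation determines
  \<open>S i\<close> from values of smaller degree. The normalization \<open>S i0 = e i0\<close> is
  recorded so that the construction can be applied to \<open>S\<close> in turn.\<close>

lemma convolution_left_inverse:
  assumes f: "\<And>i. i \<in> I \<Longrightarrow> f i \<in> carr H" "f i0 = e i0"
  shows "\<exists>S. (\<forall>i\<in>I. S i \<in> carr H) \<and> S i0 = e i0 \<and>
     (\<forall>i\<in>I. lin_ext (scal H) (\<lambda>(a, b). mul H (S a) (f b)) (D i) = scal H (counit H (e i)) (e i0))"
proof -
  let ?R = "\<lambda>S i. if i = i0 then e i0 else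
      - lin_ext (scal H) (\<lambda>(a, b). if d a < d i then mul H (S a) (f b) else 0) (D i)"
  \<comment> \<open>The guard \<open>d a < d i\<close> in \<open>?R\<close> makes the right-hand
    side depend on values of smaller degree only, as well-founded choice demands.\<close>
  have "\<exists>S. \<forall>i. S i = ?R S i"
  proof (rule dependent_wf_choice[where R="measure d" and P="\<lambda>S i r. r = ?R S i"])
    fix S T i r assume "\<And>z. (z, i) \<in> measure d \<Longrightarrow> S z = (T z :: 'a)"
    then have "lin_ext (scal H) (\<lambda>(a, b). if d a < d i then mul H (S a) (f b) else 0) (D i)
      = lin_ext (scal H) (\<lambda>(a, b). if d a < d i then mul H (T a) (f b) else 0) (D i)"
      by (intro s.lin_ext_cong) auto
    then show "(r = ?R S i) = (r = ?R T i)"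
      by simp
  qed auto
  then obtain S where S: "\<And>i. S i = ?R S i" by blast
  have S_i0: "S i0 = e i0" by (subst S) simp
  have S_in: "S i \<in> carr H" if "i \<in> I" for i
    using that
  proof (induction "d i" arbitrary: i rule: less_induct)
    case less
    have "(if d a < d i then mul H (S a) (f b) else 0) \<in> carr H" if "(a, b) \<in> Poly_Mapping.keys (D i)" for a b
      using less.hyps[of a] less.hyps[of b] D_keys[OF less.prems that] s.subspace_0[OF carr_subspace]
      by (simp add: mul_in f)
    then have "lin_ext (scal H) (\<lambda>(a, b). if d a < d i then mul H (S a) (f b) else 0) (D i) \<in> carr H"
      by (intro s.lin_ext_in_subspace carr_subspace) auto
    then show ?case
      by (subst S) (simp add: i0_in s.subspace_neg carr_subspace)
  qed
  moreover have "lin_ext (scal H) (\<lambda>(a, b). mul H (S a) (f b)) (D i) = scal H (counit H (e i)) (e i0)" if i: "i \<in> I" for i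
  proof (cases "i = i0")
    case True
    then show ?thesis
      by (simp add: S_i0 f D_one[OF module_scal] one_mul_basis i0_in counit_basis)
  next
    case False
    have "mul H (S i) (f i0) = S i"
      using mul_one_carr[OF S_in[OF i]] by (simp add: one_eq f)
    moreover have "S i = - lin_ext (scal H) (\<lambda>(a, b). if d a < d i then mul H (S a) (f b) else 0) (D i)"
      using S[of i] False by simp
    ultimately show ?thesis
      using False i by (subst D_split_right[OF i module_scal]) (simp add: counit_basis)
  qed
  ultimately show ?thesis
    using S_i0 by (intro exI[of _ S]) simp
qed

text \<open>Both sides are evaluations of the convolution product of \<open>S\<close>, \<open>f\<close> and \<open>R\<close>.\<close>

lemma convolution_inverse_unique:
  assumes f: "\<And>i. i \<in> I \<Longrightarrow> f i \<in> carr H"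
    and S: "\<And>i. i \<in> I \<Longrightarrow> S i \<in> carr H"
      "\<And>i. i \<in> I \<Longrightarrow> lin_ext (scal H) (\<lambda>(a, b). mul H (S a) (f b)) (D i) = scal H (counit H (e i)) (e i0)"
    and R: "\<And>i. i \<in> I \<Longrightarrow> R i \<in> carr H"
      "\<And>i. i \<in> I \<Longrightarrow> lin_ext (scal H) (\<lambda>(a, b). mul H (f a) (R b)) (D i) = scal H (counit H (e i)) (e i0)"
    and i: "i \<in> I"
  shows "S i = R i"
proof -
  let ?F = "\<lambda>(a, b, c). mul H (mul H (S a) (f b)) (R c)"
  have "lin_ext (scal H) ?F (lin_ext fm_scale (\<lambda>(a, b). lin_ext fm_scale (\<lambda>(a1, a2). basis_vec (a1, a2, b)) (D a)) (D i))
     = lin_ext (scal H) (\<lambda>(a, b). if a = i0 then R b else 0) (D i)"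
    unfolding s.lin_ext_lin_ext
  proof (intro s.lin_ext_cong refl, clarify)
    fix a b assume "(a, b) \<in> Poly_Mapping.keys (D i)"
    then have ab: "a \<in> I" "b \<in> I"
      using D_keys[OF i] by blast+
    have "lin_ext (scal H) (\<lambda>p. mul H (mul H (S (fst p)) (f (snd p))) (R b)) (D a)
        = mul H (lin_ext (scal H) (\<lambda>p. mul H (S (fst p)) (f (snd p))) (D a)) (R b)"
      using D_keys[OF ab(1)] ab R S f
      by (intro s.linear_on_lin_ext[symmetric, where L="\<lambda>x. mul H x (R b)", OF module_scal carr_subspace mul_left]) (auto intro!: mul_in f)
    also have "\<dots> = mul H (scal H (counit H (e a)) (e i0)) (R b)"
      using S(2)[OF ab(1)] by (simp add: case_prod_unfold)
    also have "\<dots> = (if a = i0 then R b else 0)"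
      using one_mul_carr[OF R(1)[OF ab(2)]] mul_left[OF R(1)[OF ab(2)]] i0_in e_in[OF i0_in] ab
      by (auto simp: counit_basis one_eq linear_on_def)
    finally show "lin_ext (scal H) ?F (lin_ext fm_scale (\<lambda>(a1, a2). basis_vec (a1, a2, b)) (D a)) = (if a = i0 then R b else 0)"
      by (simp add: s.lin_ext_lin_ext case_prod_unfold)
  qed
  also have "\<dots> = lin_ext (scal H) R (lin_ext fm_scale (\<lambda>(a, b). if a = i0 then basis_vec b else 0) (D i))"
    unfolding s.lin_ext_lin_ext by (intro s.lin_ext_cong) auto
  also have "\<dots> = R i"
    by (simp add: D_counit_left i)
  finally have 1: "lin_ext (scal H) ?F (lin_ext fm_scale (\<lambda>(a, b). lin_ext fm_scale (\<lambda>(a1, a2). basis_vec (a1, a2, b)) (D a)) (D i)) = R i" .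
  have "lin_ext (scal H) ?F (lin_ext fm_scale (\<lambda>(a, b). lin_ext fm_scale (\<lambda>(b1, b2). basis_vec (a, b1, b2)) (D b)) (D i))
     = lin_ext (scal H) (\<lambda>(a, b). if b = i0 then S a else 0) (D i)"
    unfolding s.lin_ext_lin_ext
  proof (intro s.lin_ext_cong refl, clarify)
    fix a b assume "(a, b) \<in> Poly_Mapping.keys (D i)"
    then have ab: "a \<in> I" "b \<in> I"
      using D_keys[OF i] by blast+
    have "lin_ext (scal H) (\<lambda>p. mul H (mul H (S a) (f (fst p))) (R (snd p))) (D b)
      = lin_ext (scal H) (\<lambda>p. mul H (S a) (mul H (f (fst p)) (R (snd p)))) (D b)"
      using D_keys[OF ab(2)] ab R S f by (intro s.lin_ext_cong mul_assoc_carr) auto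
    also have "\<dots> = mul H (S a) (lin_ext (scal H) (\<lambda>p. mul H (f (fst p)) (R (snd p))) (D b))"
      using D_keys[OF ab(2)] ab R S f
      by (intro s.linear_on_lin_ext[symmetric, OF module_scal carr_subspace mul_right]) (auto intro!: mul_in f)
    also have "\<dots> = mul H (S a) (scal H (counit H (e b)) (e i0))"
      using R(2)[OF ab(2)] by (simp add: case_prod_unfold)
    also have "\<dots> = (if b = i0 then S a else 0)"
      using mul_one_carr[OF S(1)[OF ab(1)]] mul_right[OF S(1)[OF ab(1)]] i0_in e_in[OF i0_in] ab
      by (auto simp: counit_basis one_eq linear_on_def)
    finally show "lin_ext (scal H) ?F (lin_ext fm_scale (\<lambda>(b1, b2). basis_vec (a, b1, b2)) (D b)) = (if b = i0 then S a else 0)"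
      by (simp add: s.lin_ext_lin_ext case_prod_unfold)
  qed
  also have "\<dots> = lin_ext (scal H) S (lin_ext fm_scale (\<lambda>(a, b). if b = i0 then basis_vec a else 0) (D i))"
    unfolding s.lin_ext_lin_ext by (intro s.lin_ext_cong) auto
  also have "\<dots> = S i"
    by (simp add: D_counit_right i)
  finally show ?thesis
    using 1 D_coassoc[OF i] by simp
qed

text \<open>A left convolution inverse \<open>S\<close> of \<open>e\<close> has itself a left
  inverse \<open>T\<close>. Associativity of convolution gives \<open>T = e\<close> on the basis, so
  \<open>S\<close> is a right inverse of \<open>e\<close> as well.\<close>

lemma antipode_basis_exists:
  "\<exists>S. (\<forall>i\<in>I. S i \<in> carr H) \<and>
     (\<forall>i\<in>I. lin_ext (scal H) (\<lambda>(a, b). mul H (S a) (e b)) (D i) = scal H (counit H (e i)) (e i0)) \<and>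
     (\<forall>i\<in>I. lin_ext (scal H) (\<lambda>(a, b). mul H (e a) (S b)) (D i) = scal H (counit H (e i)) (e i0))"
proof -
  obtain S where S: "\<And>i. i \<in> I \<Longrightarrow> S i \<in> carr H" "S i0 = e i0"
     "\<And>i. i \<in> I \<Longrightarrow> lin_ext (scal H) (\<lambda>(a, b). mul H (S a) (e b)) (D i) = scal H (counit H (e i)) (e i0)"
    using convolution_left_inverse[of e] by auto
  obtain T where T: "\<And>i. i \<in> I \<Longrightarrow> T i \<in> carr H"
     "\<And>i. i \<in> I \<Longrightarrow> lin_ext (scal H) (\<lambda>(a, b). mul H (T a) (S b)) (D i) = scal H (counit H (e i)) (e i0)"
    using convolution_left_inverse[where f=S, OF S(1,2)] by blast
  have "T i = e i" if "i \<in> I" for i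
    by (rule convolution_inverse_unique[of S T e]) (simp_all add: S T that)
  then have "lin_ext (scal H) (\<lambda>(a, b). mul H (e a) (S b)) (D i) = lin_ext (scal H) (\<lambda>(a, b). mul H (T a) (S b)) (D i)" if "i \<in> I" for i
    using D_keys[OF that] by (intro s.lin_ext_cong) auto
  then show ?thesis
    using S T by (intro exI[of _ S]) auto
qed

lemma antipode_exists: "\<exists>S. is_antipode H S"
proof -
  obtain S where S: "\<And>i. i \<in> I \<Longrightarrow> S i \<in> carr H"
     "\<And>i. i \<in> I \<Longrightarrow> lin_ext (scal H) (\<lambda>(a, b). mul H (S a) (e b)) (D i) = scal H (counit H (e i)) (e i0)"
     "\<And>i. i \<in> I \<Longrightarrow> lin_ext (scal H) (\<lambda>(a, b). mul H (e a) (S b)) (D i) = scal H (counit H (e i)) (e i0)"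
    using antipode_basis_exists by blast
  let ?T = "free.extend (scal H) S"
  have T_in: "?T ` carr H \<subseteq> carr H"
    by (auto elim!: carrE simp: free.extend_lin_ext intro!: s.lin_ext_in_subspace carr_subspace S)
  have T_lin: "linear_on (carr H) (scal H) (scal H) ?T"
    by (intro extend_linear_on module_scal)
  have T_e: "?T (e i) = S i" if "i \<in> I" for i
    using that by (simp add: free.extend_basis module_scal)
  have counit: "linear_on (carr H) (scal H) (scal H) (\<lambda>x. scal H (counit H x) (one H))"
    by (rule linear_on_counit_scal)
  have bil: "linear_on (carr H) (scal H) (scal H) (\<lambda>x. mul H (?T x) b)" "linear_on (carr H) (scal H) (scal H) (\<lambda>x. mul H (?T b) x)"
      "linear_on (carr H) (scal H) (scal H) (\<lambda>x. mul H x (?T b))" "linear_on (carr H) (scal H) (scal H) (\<lambda>x. mul H b (?T x))" if "b \<in> carr H" for b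
    using that T_in by (auto intro!: linear_on_mul_left' linear_on_mul_right' T_lin mul_left mul_right)
  have "lin_ext (scal H) (\<lambda>(a, b). mul H (?T a) b) (comul H x) = scal H (counit H x) (one H)" if "x \<in> carr H" for x
  proof (rule eq_on_carr[OF module_scal _ counit _ that])
    show "linear_on (carr H) (scal H) (scal H) (\<lambda>x. lin_ext (scal H) (\<lambda>(a, b). mul H (?T a) b) (comul H x))"
      by (intro comul_bilinear_lin module_scal) (simp_all add: bil)
    fix i assume i: "i \<in> I"
    have "lin_ext (scal H) (\<lambda>(a, b). mul H (?T a) b) (comul H (e i)) = lin_ext (scal H) (\<lambda>(a, b). mul H (?T (e a)) (e b)) (D i)"
      by (subst comul_bilinear_basis[OF module_scal _ _ i]) (simp_all add: bil)
    also have "\<dots> = lin_ext (scal H) (\<lambda>(a, b). mul H (S a) (e b)) (D i)"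
      using D_keys[OF i] by (intro s.lin_ext_cong) (auto simp: T_e)
    finally show "lin_ext (scal H) (\<lambda>(a, b). mul H (?T a) b) (comul H (e i)) = scal H (counit H (e i)) (one H)"
      by (simp add: S i one_eq)
  qed
  moreover have "lin_ext (scal H) (\<lambda>(a, b). mul H a (?T b)) (comul H x) = scal H (counit H x) (one H)" if "x \<in> carr H" for x
  proof (rule eq_on_carr[OF module_scal _ counit _ that])
    show "linear_on (carr H) (scal H) (scal H) (\<lambda>x. lin_ext (scal H) (\<lambda>(a, b). mul H a (?T b)) (comul H x))"
      by (intro comul_bilinear_lin module_scal) (simp_all add: bil)
    fix i assume i: "i \<in> I"
    have "lin_ext (scal H) (\<lambda>(a, b). mul H a (?T b)) (comul H (e i)) = lin_ext (scal H) (\<lambda>(a, b). mul H (e a) (?T (e b))) (D i)"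
      by (subst comul_bilinear_basis[OF module_scal _ _ i]) (simp_all add: bil)
    also have "\<dots> = lin_ext (scal H) (\<lambda>(a, b). mul H (e a) (S b)) (D i)"
      using D_keys[OF i] by (intro s.lin_ext_cong) (auto simp: T_e)
    finally show "lin_ext (scal H) (\<lambda>(a, b). mul H a (?T b)) (comul H (e i)) = scal H (counit H (e i)) (one H)"
      by (simp add: S i one_eq)
  qed
  ultimately have "is_antipode H ?T"
    using T_in T_lin by (simp add: is_antipode_def)
  then show ?thesis
    by (intro exI[of _ ?T])
qed

lemma antipode_one:
  assumes "is_antipode H S" shows "S (e i0) = e i0"
proof -
  have S: "S ` carr H \<subseteq> carr H" "linear_on (carr H) (scal H) (scal H) S"
    using assms by (auto simp: is_antipode_def)
  have "lin_ext (scal H) (\<lambda>(a, b). mul H (S a) b) (comul H (e i0)) = lin_ext (scal H) (\<lambda>(a, b). mul H (S (e a)) (e b)) (D i0)"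
    using S by (subst comul_bilinear_basis[OF module_scal _ _ i0_in]) (auto intro!: linear_on_mul_left' mul_right)
  moreover have "mul H (S (e i0)) (e i0) = S (e i0)"
    using mul_one_carr[of "S (e i0)"] S i0_in by (auto simp: one_eq image_subset_iff)
  ultimately show ?thesis
    using assms i0_in by (simp add: is_antipode_def D_one[OF module_scal] counit_basis one_eq)
qed

text \<open>Follows from the antipode axiom alone and so holds for every antipode. Compatibility
  with the grading and with isomorphisms is proved by induction along this recursion.\<close>

lemma antipode_rec:
  assumes "is_antipode H S" "i \<in> I" "i \<noteq> i0"
  shows "S (e i) = - lin_ext (scal H) (\<lambda>(a, b). if d a < d i then mul H (S (e a)) (e b) else 0) (D i)"
proof -
  have S: "S ` carr H \<subseteq> carr H" "linear_on (carr H) (scal H) (scal H) S"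
    using assms by (auto simp: is_antipode_def)
  have "0 = lin_ext (scal H) (\<lambda>(a, b). mul H (S a) b) (comul H (e i))"
    using assms by (simp add: is_antipode_def counit_basis)
  also have "\<dots> = lin_ext (scal H) (\<lambda>(a, b). mul H (S (e a)) (e b)) (D i)"
    using S by (subst comul_bilinear_basis[OF module_scal _ _ assms(2)]) (auto intro!: linear_on_mul_left' mul_right)
  also have "\<dots> = mul H (S (e i)) (e i0) + lin_ext (scal H) (\<lambda>(a, b). if d a < d i then mul H (S (e a)) (e b) else 0) (D i)"
    by (rule D_split_right[OF assms(2) module_scal])
  also have "mul H (S (e i)) (e i0) = S (e i)"
    using mul_one_carr[of "S (e i)"] S assms(2) by (auto simp: one_eq image_subset_iff)
  finally show ?thesis
    by (simp add: eq_neg_iff_add_eq_0)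
qed

lemma antipode_deg_basis:
  assumes "is_antipode H S" "i \<in> I" shows "S (e i) \<in> deg_part H (d i)"
  using assms(2)
proof (induction "d i" arbitrary: i rule: less_induct)
  case less
  have sub: "s.subspace (deg_part H n)" for n
    by (simp add: deg_part_eq)
  show ?case
  proof (cases "i = i0")
    case True
    then show ?thesis
      using i0_in by (auto simp: antipode_one[OF assms(1)] deg_part_eq intro: s.span_base)
  next
    case False
    have "mul H x (e b) \<in> deg_part H (m + d b)" if x: "x \<in> deg_part H m" and b: "b \<in> I" for x b m
    proof -
      obtain c where c: "x = lin_ext (scal H) e c" "Poly_Mapping.keys c \<subseteq> {i \<in> I. d i = m}"
        using x by (rule deg_partE)
      have "mul H x (e b) = lin_ext (scal H) (\<lambda>i. mul H (e i) (e b)) c"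
        unfolding c(1) using c(2) b
        by (intro s.linear_on_lin_ext[where L="\<lambda>x. mul H x (e b)", OF module_scal carr_subspace mul_left]) auto
      also have "\<dots> \<in> deg_part H (m + d b)"
        using c(2) b by (intro s.lin_ext_in_subspace sub) (use mul_basis_deg in force)
      finally show ?thesis .
    qed
    then have "(if d a < d i then mul H (S (e a)) (e b) else 0) \<in> deg_part H (d i)"
      if "(a, b) \<in> Poly_Mapping.keys (D i)" for a b
      using less D_keys[OF \<open>i \<in> I\<close> that] s.subspace_0[OF sub] by (metis (no_types, lifting))
    then show ?thesis
      unfolding antipode_rec[OF assms(1) less.prems False]
      by (intro s.subspace_neg s.lin_ext_in_subspace sub) auto
  qed
qed

lemma deg_part_direct:
  assumes "x \<in> carr H"
  shows "\<exists>!c :: nat \<Rightarrow>\<^sub>0 'a. (\<forall>n. Poly_Mapping.lookup c n \<in> deg_part H n) \<and>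
        x = (\<Sum>n \<in> Poly_Mapping.keys c. Poly_Mapping.lookup c n)"
proof -
  have sub: "s.subspace (deg_part H n)" for n
    by (simp add: deg_part_eq)
  obtain c where c: "x = lin_ext (scal H) e c" "Poly_Mapping.keys c \<subseteq> I"
    using assms by (rule carrE)
  define p where "p = (\<Sum>i\<in>Poly_Mapping.keys c. Poly_Mapping.single (d i) (scal H (Poly_Mapping.lookup c i) (e i)))"
  have p: "Poly_Mapping.lookup p n = (\<Sum>i\<in>Poly_Mapping.keys c. if d i = n then scal H (Poly_Mapping.lookup c i) (e i) else 0)" for n
    by (simp add: p_def lookup_sum lookup_single when_def)
  have "Poly_Mapping.lookup p n \<in> deg_part H n" for n
  proof (unfold p, intro s.subspace_sum sub)
    fix i assume "i \<in> Poly_Mapping.keys c"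
    then have "e i \<in> deg_part H (d i)"
      using c(2) by (auto simp: deg_part_eq intro: s.span_base)
    then show "(if d i = n then scal H (Poly_Mapping.lookup c i) (e i) else 0) \<in> deg_part H n"
      using s.subspace_0[OF sub] s.subspace_scale[OF sub] by auto
  qed
  moreover have "(\<Sum>n \<in> Poly_Mapping.keys p. Poly_Mapping.lookup p n) = x"
  proof -
    have "Poly_Mapping.keys p \<subseteq> d ` Poly_Mapping.keys c"
    proof
      fix n assume "n \<in> Poly_Mapping.keys p"
      then obtain i where "i \<in> Poly_Mapping.keys c" "(if d i = n then scal H (Poly_Mapping.lookup c i) (e i) else 0) \<noteq> 0"
        unfolding in_keys_iff[of n] p by (rule sum.not_neutral_contains_not_neutral)
      then show "n \<in> d ` Poly_Mapping.keys c"
        by (auto split: if_splits)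
    qed
    then have "(\<Sum>n \<in> Poly_Mapping.keys p. Poly_Mapping.lookup p n) = (\<Sum>n \<in> d ` Poly_Mapping.keys c. Poly_Mapping.lookup p n)"
      by (intro sum.mono_neutral_left) (auto simp: in_keys_iff)
    also have "\<dots> = (\<Sum>i\<in>Poly_Mapping.keys c. \<Sum>n \<in> d ` Poly_Mapping.keys c. if d i = n then scal H (Poly_Mapping.lookup c i) (e i) else 0)"
      unfolding p by (rule sum.swap)
    also have "\<dots> = x"
      unfolding c(1) lin_ext_def by (intro sum.cong) auto
    finally show ?thesis .
  qed
  moreover have "q = q'" if
    q: "\<forall>n. Poly_Mapping.lookup q n \<in> deg_part H n" "x = (\<Sum>n \<in> Poly_Mapping.keys q. Poly_Mapping.lookup q n)" and
    q': "\<forall>n. Poly_Mapping.lookup q' n \<in> deg_part H n" "x = (\<Sum>n \<in> Poly_Mapping.keys q'. Poly_Mapping.lookup q' n)" for q q' :: "nat \<Rightarrow>\<^sub>0 'a"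
  proof -
    let ?N = "Poly_Mapping.keys q \<union> Poly_Mapping.keys q'"
    define u where "u n = Poly_Mapping.lookup q n - Poly_Mapping.lookup q' n" for n
    have "u n \<in> deg_part H n" for n
      using q q' sub by (simp add: u_def s.subspace_diff)
    then have "\<exists>c. u n = lin_ext (scal H) e c \<and> Poly_Mapping.keys c \<subseteq> {i \<in> I. d i = n}" for n
      using deg_partE[of "u n" n] by metis
    \<comment> \<open>\<open>C n\<close> is supported on indices of degree \<open>n\<close>, so
      these coordinates have disjoint supports; once their sum vanishes, each of them does.\<close>
    then obtain C where C: "\<And>n. u n = lin_ext (scal H) e (C n)" "\<And>n. Poly_Mapping.keys (C n) \<subseteq> {i \<in> I. d i = n}"
      by metis
    have "x = (\<Sum>n\<in>?N. Poly_Mapping.lookup q n)" "x = (\<Sum>n\<in>?N. Poly_Mapping.lookup q' n)"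
      unfolding q(2)[THEN trans] q'(2)[THEN trans]
      by (subst q(2), intro sum.mono_neutral_left; auto simp: in_keys_iff)
         (subst q'(2), intro sum.mono_neutral_left; auto simp: in_keys_iff)
    then have "(\<Sum>n\<in>?N. u n) = 0"
      by (simp add: u_def sum_subtractf)
    then have "lin_ext (scal H) e (\<Sum>n\<in>?N. C n) = 0"
      by (simp add: C)
    moreover have "Poly_Mapping.keys (\<Sum>n\<in>?N. C n) \<subseteq> I"
      using C(2) by (intro order.trans[OF keys_sum]) auto
    ultimately have 0: "(\<Sum>n\<in>?N. C n) = 0"
      by (intro indep)
    have "C n = 0" if n: "n \<in> ?N" for n
    proof (rule poly_mapping_eqI)
      fix i
      have *: "Poly_Mapping.lookup (C m) i = 0" if "d i \<noteq> m" for m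
        using C(2)[of m] that by (auto simp: in_keys_iff)
      have "Poly_Mapping.lookup (C n) i = 0" if i: "d i = n"
      proof -
        have "0 = (\<Sum>m\<in>?N. Poly_Mapping.lookup (C m) i)"
          using 0 by (metis lookup_sum lookup_zero)
        also have "\<dots> = (\<Sum>m\<in>{n}. Poly_Mapping.lookup (C m) i)"
          using n i by (intro sum.mono_neutral_right) (auto intro!: *)
        finally show ?thesis by simp
      qed
      then show "Poly_Mapping.lookup (C n) i = Poly_Mapping.lookup 0 i"
        using *[of n] by auto
    qed
    then have "u n = 0" if "n \<in> ?N" for n
      using C(1)[of n] that by simp
    then have "u n = 0" for n
      by (cases "n \<in> ?N") (auto simp: u_def in_keys_iff)
    then show "q = q'"
      by (intro poly_mapping_eqI) (simp add: u_def)
  qed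
  ultimately show ?thesis
    by (intro ex1I[of _ p]) auto
qed

theorem graded_hopf: "graded_hopf_algebra H"
proof -
  have sub: "s.subspace (deg_part H n)" for n
    by (simp add: deg_part_eq)
  have deg_mul: "mul H x y \<in> deg_part H (m + n)" if xy: "x \<in> deg_part H m" "y \<in> deg_part H n" for x y m n
  proof -
    obtain c where c: "x = lin_ext (scal H) e c" "Poly_Mapping.keys c \<subseteq> {i \<in> I. d i = m}"
      using xy(1) by (rule deg_partE)
    obtain c' where c': "y = lin_ext (scal H) e c'" "Poly_Mapping.keys c' \<subseteq> {i \<in> I. d i = n}"
      using xy(2) by (rule deg_partE)
    have y: "y \<in> carr H"
      using xy deg_part_subset by auto
    have "mul H x y = lin_ext (scal H) (\<lambda>i. mul H (e i) y) c"
      unfolding c(1) using c(2) y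
      by (intro s.linear_on_lin_ext[where L="\<lambda>x. mul H x y", OF module_scal carr_subspace mul_left]) auto
    also have "\<dots> = lin_ext (scal H) (\<lambda>i. lin_ext (scal H) (\<lambda>j. mul H (e i) (e j)) c') c"
      unfolding c'(1) using c(2) c'(2)
      by (intro s.lin_ext_cong refl s.linear_on_lin_ext[OF module_scal carr_subspace mul_right]) auto
    also have "\<dots> \<in> deg_part H (m + n)"
      using c(2) c'(2) by (intro s.lin_ext_in_subspace sub) (use mul_basis_deg in force)
    finally show ?thesis .
  qed
  have deg_comul: "\<exists>t. Poly_Mapping.keys t \<subseteq> (\<Union>i\<le>n. deg_part H i \<times> deg_part H (n - i)) \<and> tensor2_eq H (comul H x) t"
    if x: "x \<in> deg_part H n" for x n
  proof -
    obtain c where c: "x = lin_ext (scal H) e c" "Poly_Mapping.keys c \<subseteq> {i \<in> I. d i = n}"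
      using x by (rule deg_partE)
    have "Poly_Mapping.keys (lin_ext fm_scale De c) \<subseteq> (\<Union>i\<le>n. deg_part H i \<times> deg_part H (n - i))"
      using keys_De c(2) by (intro order.trans[OF keys_lin_ext]) blast
    moreover have "tensor2_eq H (comul H x) (lin_ext fm_scale De c)"
      unfolding c(1) using c(2) by (intro comul_lin_ext) auto
    ultimately show ?thesis by blast
  qed
  have deg_antipode: "S ` deg_part H n \<subseteq> deg_part H n" if S: "is_antipode H S" for S n
  proof clarify
    fix x assume "x \<in> deg_part H n"
    then obtain c where c: "x = lin_ext (scal H) e c" "Poly_Mapping.keys c \<subseteq> {i \<in> I. d i = n}"
      by (rule deg_partE)
    have "S x = lin_ext (scal H) (\<lambda>i. S (e i)) c"
      unfolding c(1) using c(2) S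
      by (intro s.linear_on_lin_ext[OF module_scal carr_subspace]) (auto simp: is_antipode_def)
    also have "\<dots> \<in> deg_part H n"
      using c(2) antipode_deg_basis[OF S] by (intro s.lin_ext_in_subspace sub) auto
    finally show "S x \<in> deg_part H n" .
  qed
  have comul_one: "tensor2_eq H (comul H (one H)) (basis_vec (one H, one H))"
    using comul_basis[OF i0_in] by (simp add: one_eq D_one[OF module_fm_scale])
  have comul_add: "tensor2_eq H (comul H (x + y)) (comul H x + comul H y)" if "x \<in> carr H" "y \<in> carr H" for x y
    using comul_lin_mod that by (auto simp: lin_mod_def tensor2_eq_def diff_diff_eq)
  have comul_scal: "tensor2_eq H (comul H (scal H c x)) (fm_scale c (comul H x))" if "x \<in> carr H" for c x
    using comul_lin_mod that by (auto simp: lin_mod_def tensor2_eq_def)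
  have counit_one: "counit H (one H) = 1"
    by (simp add: one_eq counit_basis i0_in)
  have one_deg: "one H \<in> deg_part H 0"
    using i0_in deg_0_iff[OF i0_in] by (auto simp: one_eq deg_part_eq intro: s.span_base)
  show ?thesis
    by unfold_locales
      (simp_all add: module_scal carr_subspace mul_in mul_left mul_right mul_assoc_carr one_in one_mul_carr mul_one_carr
        coassoc_carr counit_lin counit_left_carr counit_right_carr comul_mul_carr comul_one counit_mul_carr comul_add comul_scal
        antipode_exists sub deg_part_direct deg_mul deg_comul counit_deg counit_one one_deg comul_keys deg_part_subset deg_antipode)
qed

end

section \<open>Words\<close>

definition rk :: "nat set \<Rightarrow> nat \<Rightarrow> nat" where
  "rk U j = card {i \<in> U. i \<le> j}"

lemma rk_strict_mono: "finite U \<Longrightarrow> strict_mono_on U (rk U)"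
proof (rule strict_mono_onI)
  fix i j assume "finite U" and ij: "j \<in> U" "i < j"
  have "j \<in> {k \<in> U. k \<le> j}" "j \<notin> {k \<in> U. k \<le> i}"
    using ij by auto
  moreover have "{k \<in> U. k \<le> i} \<subseteq> {k \<in> U. k \<le> j}"
    using ij by auto
  ultimately have "{k \<in> U. k \<le> i} \<subset> {k \<in> U. k \<le> j}"
    by blast
  then show "rk U i < rk U j"
    unfolding rk_def using \<open>finite U\<close> by (intro psubset_card_mono) auto
qed

lemma rk_inj: "finite U \<Longrightarrow> inj_on (rk U) U"
  by (intro strict_mono_on_imp_inj_on rk_strict_mono)

lemma rk_image: assumes "finite U" shows "rk U ` U = {1..card U}"
proof (rule card_subset_eq)
  show "rk U ` U \<subseteq> {1..card U}"
  proof clarify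
    fix j assume "j \<in> U"
    then have "{i \<in> U. i \<le> j} \<noteq> {}" "{i \<in> U. i \<le> j} \<subseteq> U"
      by auto
    then show "rk U j \<in> {1..card U}"
      using assms by (auto simp: rk_def Suc_le_eq card_gt_0_iff intro: card_mono)
  qed
qed (use assms in \<open>auto simp: card_image rk_inj\<close>)

text \<open>Ranks depend on the relative order only. This is why standardization forgets an
  increasing relabelling, such as that of the two factors by a shuffle.\<close>

lemma rk_comp:
  assumes "finite U" "strict_mono_on U \<phi>" "j \<in> U"
  shows "rk (\<phi> ` U) (\<phi> j) = rk U j"
proof -
  have "{i \<in> \<phi> ` U. i \<le> \<phi> j} = \<phi> ` {i \<in> U. i \<le> j}"
    using assms by (auto simp: strict_mono_on_less_eq)
  moreover have "inj_on \<phi> {i \<in> U. i \<le> j}"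
    using strict_mono_on_imp_inj_on[OF assms(2)] by (rule inj_on_subset) auto
  ultimately show ?thesis
    by (simp add: rk_def card_image)
qed

lemma rk_interval: assumes "j \<in> {1..n}" shows "rk {1..n} j = j"
proof -
  have "{i \<in> {1..n}. i \<le> j} = {1..j}"
    using assms by auto
  then show ?thesis by (simp add: rk_def)
qed

lemma rk_Un_left:
  assumes "\<And>a b. a \<in> U \<Longrightarrow> b \<in> V \<Longrightarrow> a < b" "j \<in> U"
  shows "rk (U \<union> V) j = rk U j"
proof -
  have "{i \<in> U \<union> V. i \<le> j} = {i \<in> U. i \<le> j}"
    using assms by force
  then show ?thesis by (simp add: rk_def)
qed

lemma rk_Un_right:
  assumes "\<And>a b. a \<in> U \<Longrightarrow> b \<in> V \<Longrightarrow> a < b" "j \<in> V" "finite U" "finite V"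
  shows "rk (U \<union> V) j = rk V j + card U"
proof -
  have "{i \<in> U \<union> V. i \<le> j} = {i \<in> V. i \<le> j} \<union> U"
    using assms by force
  moreover have "{i \<in> V. i \<le> j} \<inter> U = {}"
    using assms(1) by force
  ultimately show ?thesis
    using assms by (simp add: rk_def card_Un_disjoint)
qed

text \<open>One relabelling is applied to all letters: for a finite union, its increasing bijection
  onto an initial segment. On sets of letters this is \<open>part_std\<close>.\<close>

definition std :: "nat set list \<Rightarrow> nat set list" where
  "std w = map ((`) (rk (\<Union>(set w)))) w"

text \<open>A uniform block permutation of \<open>[n]\<close> is encoded by the word of length \<open>n\<close> whose \<open>j\<close>-th letter
  is the domain block that is mapped to the codomain block containing \<open>j\<close>. So a letter is a set and
  occurs as many times as it has elements. Subwords need not be standard: their letters only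
  partition some finite set.\<close>

definition block_word :: "nat set list \<Rightarrow> bool" where
  "block_word w \<longleftrightarrow> disjoint (set w) \<and> (\<forall>A\<in>set w. finite A \<and> count_list w A = card A)"

lemma block_word_Nil [simp]: "block_word []"
  by (simp add: block_word_def)

lemma length_std [simp]: "length (std w) = length w"
  by (simp add: std_def)

lemma std_eq_Nil_iff [simp]: "std w = [] \<longleftrightarrow> w = []"
  by (simp add: std_def)

lemma block_word_finite [simp]: "block_word w \<Longrightarrow> finite (\<Union>(set w))"
  by (auto simp: block_word_def)

lemma block_word_nonempty: "block_word w \<Longrightarrow> {} \<notin> set w"
  by (metis block_word_def card.empty count_list_0_iff)

text \<open>Counting positions letter by letter, each letter contributes its cardinality. So the
  length can be recovered from the set of letters.\<close>

lemma block_word_length: assumes "block_word w" shows "length w = card (\<Union>(set w))"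
proof -
  have "card (\<Union>(set w)) = (\<Sum>A\<in>set w. card A)"
    using assms by (intro card_Union_disjoint) (auto simp: block_word_def disjoint_def pairwise_def disjnt_def)
  also have "\<dots> = (\<Sum>A\<in>set w. count_list w A)"
    using assms by (intro sum.cong) (auto simp: block_word_def)
  also have "\<dots> = length w"
    by (rule sum_count_set) auto
  finally show ?thesis by simp
qed

lemma Union_map_image: "\<Union>(set (map ((`) \<phi>) w)) = \<phi> ` \<Union>(set w)"
  by auto

lemma block_word_map:
  assumes "block_word w" "inj_on \<phi> (\<Union>(set w))"
  shows "block_word (map ((`) \<phi>) w)"
proof -
  have "inj_on ((`) \<phi>) (set w)"
    using assms(2) by (rule inj_on_image)
  moreover have "inj_on \<phi> A" if "A \<in> set w" for A
    using assms(2) by (rule inj_on_subset) (use that in auto)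
  ultimately show ?thesis
    using assms disjoint_image[OF assms(2)]
    by (auto simp: block_word_def count_list_inj_map card_image)
qed

lemma std_map:
  assumes "block_word w" "strict_mono_on (\<Union>(set w)) \<phi>"
  shows "std (map ((`) \<phi>) w) = std w"
proof -
  have "rk (\<phi> ` \<Union>(set w)) ` \<phi> ` A = rk (\<Union>(set w)) ` A" if "A \<in> set w" for A
    unfolding image_image using that assms by (intro image_cong refl rk_comp) auto
  then show ?thesis
    unfolding std_def Union_map_image by (simp add: image_comp)
qed

lemma std_eq_self: "\<Union>(set w) = {1..n} \<Longrightarrow> std w = w"
proof -
  assume w: "\<Union>(set w) = {1..n}"
  have "rk (\<Union>(set w)) ` A = A" if "A \<in> set w" for A
  proof -
    have "rk (\<Union>(set w)) ` A = id ` A"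
      unfolding w using that w by (intro image_cong refl) (auto simp del: One_nat_def intro!: rk_interval)
    then show ?thesis by simp
  qed
  then show ?thesis
    unfolding std_def by (intro map_idI) auto
qed

lemma block_word_std: "block_word w \<Longrightarrow> block_word (std w)"
  unfolding std_def by (intro block_word_map rk_inj) auto

lemma Union_set_std: "block_word w \<Longrightarrow> \<Union>(set (std w)) = {1..length w}"
  unfolding std_def Union_map_image by (simp add: rk_image block_word_length)

definition std_words :: "nat \<Rightarrow> nat set list set" where
  "std_words n = {w. block_word w \<and> \<Union>(set w) = {1..n}}"

lemma std_words_length: "w \<in> std_words n \<Longrightarrow> length w = n"
  by (auto simp: std_words_def block_word_length)

lemma std_in_std_words: "block_word w \<Longrightarrow> std w \<in> std_words (length w)"
  using Union_set_std[of w] by (simp add: std_words_def block_word_std)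

lemma std_std_words: "w \<in> std_words n \<Longrightarrow> std w = w"
  using std_eq_self[of w n] by (simp only: std_words_def mem_Collect_eq)

lemma std_words_0: "std_words 0 = {[]}"
proof -
  have "w = []" if "w \<in> std_words 0" for w
    using std_words_length[OF that] by simp
  then show ?thesis
    by (auto simp: std_words_def)
qed

text \<open>In terms of words, breaking points are the cuts between two subwords without common letters.\<close>

definition cuts :: "'a list \<Rightarrow> ('a list \<times> 'a list) set" where
  "cuts w = {(u, v). u @ v = w \<and> set u \<inter> set v = {}}"

lemma finite_cuts [simp]: "finite (cuts w)"
proof (rule finite_subset)
  show "cuts w \<subseteq> (\<lambda>i. (take i w, drop i w)) ` {..length w}"
  proof clarify
    fix u v assume "(u, v) \<in> cuts w"
    then have "w = u @ v"
      by (simp add: cuts_def)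
    then show "(u, v) \<in> (\<lambda>i. (take i w, drop i w)) ` {..length w}"
      by (intro image_eqI[where x="length u"]) auto
  qed
qed auto

text \<open>A letter occurs in only one of the two pieces, so all its copies are found
  there.\<close>

lemma cuts_block_word:
  assumes "(u, v) \<in> cuts w" "block_word w"
  shows "block_word u" "block_word v"
proof -
  have w: "w = u @ v" "set u \<inter> set v = {}"
    using assms by (auto simp: cuts_def)
  then have "count_list w A = count_list u A" if "A \<in> set u" for A
    using that by (auto simp: count_list_0_iff)
  moreover have "count_list w A = count_list v A" if "A \<in> set v" for A
    using that w by (auto simp: count_list_0_iff)
  moreover have "set u \<subseteq> set w" "set v \<subseteq> set w"
    using w by auto
  ultimately show "block_word u" "block_word v"
    using assms(2) unfolding block_word_def disjoint_def pairwise_def by (metis subsetD)+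
qed

text \<open>A relabelling that is injective on letters creates no new coincidences, so it preserves
  which cuts are admissible.\<close>

lemma cuts_map:
  assumes "inj_on f (set w)"
  shows "cuts (map f w) = map_prod (map f) (map f) ` cuts w"
proof (intro set_eqI iffI)
  fix p assume "p \<in> cuts (map f w)"
  then obtain u v where uv: "p = (u, v)" "map f w = u @ v" "set u \<inter> set v = {}"
    by (auto simp: cuts_def)
  then obtain u' v' where "w = u' @ v'" "u = map f u'" "v = map f v'"
    by (auto simp: map_eq_append_conv)
  then show "p \<in> map_prod (map f) (map f) ` cuts w"
    using uv by (intro image_eqI[where x="(u', v')"]) (auto simp: cuts_def)
next
  fix p assume "p \<in> map_prod (map f) (map f) ` cuts w"
  then obtain u v where uv: "p = (map f u, map f v)" "w = u @ v" "set u \<inter> set v = {}"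
    by (auto simp: cuts_def)
  then show "p \<in> cuts (map f w)"
    using assms by (auto simp: cuts_def inj_on_def)
qed

lemma inj_on_cuts_map:
  assumes "inj_on f (set w)"
  shows "inj_on (map_prod (map f) (map f)) (cuts w)"
proof (rule inj_onI)
  fix p q assume pq: "p \<in> cuts w" "q \<in> cuts w" "map_prod (map f) (map f) p = map_prod (map f) (map f) q"
  then have "length (fst p) = length (fst q)" "fst p @ snd p = fst q @ snd q"
    by (auto simp: cuts_def dest: map_eq_imp_length_eq)
  then show "p = q"
    by (simp add: prod_eq_iff)
qed

lemma sum_cuts_map:
  fixes G :: "nat set list \<Rightarrow> nat set list \<Rightarrow> 'm::comm_monoid_add"
  assumes w: "block_word w" and \<phi>: "strict_mono_on (\<Union>(set w)) \<phi>"
  shows "(\<Sum>p\<in>cuts (map ((`) \<phi>) w). G (std (fst p)) (std (snd p))) = (\<Sum>p\<in>cuts w. G (std (fst p)) (std (snd p)))"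
proof -
  have inj: "inj_on ((`) \<phi>) (set w)"
    by (intro inj_on_image strict_mono_on_imp_inj_on \<phi>)
  have "(\<Sum>p\<in>cuts (map ((`) \<phi>) w). G (std (fst p)) (std (snd p)))
     = (\<Sum>p\<in>cuts w. G (std (map ((`) \<phi>) (fst p))) (std (map ((`) \<phi>) (snd p))))"
    unfolding cuts_map[OF inj] by (subst sum.reindex[OF inj_on_cuts_map[OF inj]]) (simp add: o_def)
  also have "\<dots> = (\<Sum>p\<in>cuts w. G (std (fst p)) (std (snd p)))"
  proof (intro sum.cong refl)
    fix p assume p: "p \<in> cuts w"
    have "block_word (fst p)" "block_word (snd p)"
      using cuts_block_word[of "fst p" "snd p" w] w p by simp_all
    moreover have "\<Union>(set (fst p)) \<subseteq> \<Union>(set w)" "\<Union>(set (snd p)) \<subseteq> \<Union>(set w)"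
      using p by (auto simp: cuts_def)
    ultimately show "G (std (map ((`) \<phi>) (fst p))) (std (map ((`) \<phi>) (snd p))) = G (std (fst p)) (std (snd p))"
      by (simp add: std_map monotone_on_subset[OF \<phi>])
  qed
  finally show ?thesis .
qed

text \<open>Reduces an iterated coproduct to repeated cuts of one word, without standardization in
  between.\<close>

lemma sum_cuts_std:
  fixes G :: "nat set list \<Rightarrow> nat set list \<Rightarrow> 'm::comm_monoid_add"
  assumes "block_word w"
  shows "(\<Sum>p\<in>cuts (std w). G (std (fst p)) (std (snd p))) = (\<Sum>p\<in>cuts w. G (std (fst p)) (std (snd p)))"
  using sum_cuts_map[OF assms rk_strict_mono] assms by (simp add: std_def[of w])

text \<open>Both sides run over the factorizations of \<open>w\<close> into three words without
  common letters; the witnesses pass between the two bracketings.\<close>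

lemma sum_cuts_assoc:
  fixes F :: "'a list \<Rightarrow> 'a list \<Rightarrow> 'a list \<Rightarrow> 'm::comm_monoid_add"
  shows "(\<Sum>p\<in>cuts w. \<Sum>q\<in>cuts (fst p). F (fst q) (snd q) (snd p)) = (\<Sum>p\<in>cuts w. \<Sum>q\<in>cuts (snd p). F (fst p) (fst q) (snd q))"
  unfolding sum.Sigma[OF finite_cuts ballI[OF finite_cuts]]
  by (rule sum.reindex_bij_witness[where
        i="\<lambda>(p, q). ((fst p @ fst q, snd q), (fst p, fst q))" and
        j="\<lambda>(p, q). ((fst q, snd q @ snd p), (snd q, snd p))"])
     (auto simp: cuts_def disjoint_iff)

lemma coassoc_cuts:
  fixes F :: "nat set list \<Rightarrow> nat set list \<Rightarrow> nat set list \<Rightarrow> 'm::comm_monoid_add"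
  assumes w: "block_word w"
  shows "(\<Sum>p\<in>cuts w. \<Sum>q\<in>cuts (std (fst p)). F (std (fst q)) (std (snd q)) (std (snd p)))
     = (\<Sum>p\<in>cuts w. \<Sum>q\<in>cuts (std (snd p)). F (std (fst p)) (std (fst q)) (std (snd q)))"
proof -
  have bw: "block_word (fst p)" "block_word (snd p)" if "p \<in> cuts w" for p
    using that cuts_block_word[of "fst p" "snd p" w] w by simp_all
  have "(\<Sum>p\<in>cuts w. \<Sum>q\<in>cuts (std (fst p)). F (std (fst q)) (std (snd q)) (std (snd p)))
    = (\<Sum>p\<in>cuts w. \<Sum>q\<in>cuts (fst p). F (std (fst q)) (std (snd q)) (std (snd p)))"
    using bw by (intro sum.cong refl sum_cuts_std)
  also have "\<dots> = (\<Sum>p\<in>cuts w. \<Sum>q\<in>cuts (snd p). F (std (fst p)) (std (fst q)) (std (snd q)))"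
    by (rule sum_cuts_assoc)
  also have "\<dots> = (\<Sum>p\<in>cuts w. \<Sum>q\<in>cuts (std (snd p)). F (std (fst p)) (std (fst q)) (std (snd q)))"
    using bw by (intro sum.cong refl sum_cuts_std[symmetric])
  finally show ?thesis .
qed

section \<open>Shuffles of words and their compatibility with cuts\<close>

lemma shuffles_iff_filter:
  assumes "set u \<inter> set v = {}"
  shows "z \<in> shuffles u v \<longleftrightarrow> filter (\<lambda>x. x \<in> set u) z = u \<and> filter (\<lambda>x. x \<notin> set u) z = v"
  using filter_shuffles_disjoint1[OF assms] partition_in_shuffles by metis

lemma map_shuffles: "map f ` shuffles u v = shuffles (map f u) (map f v)"
proof (induction u v rule: shuffles.induct)
  case (3 x xs y ys)
  have "map f ` (#) a ` A = (#) (f a) ` map f ` A" for a A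
    by (auto simp: image_image)
  with 3 show ?case
    by (simp add: image_Un)
qed auto

text \<open>The image of each letter tells from which of the two words it was taken, and the
  sequence of these choices determines the shuffle. Thus \<open>f\<close> may identify letters
  within one word, as the map from positions to letters does.\<close>

lemma inj_on_map_shuffles:
  assumes "f ` set u \<inter> f ` set v = {}" "z \<in> shuffles u v" "z' \<in> shuffles u v" "map f z = map f z'"
  shows "z = z'"
  using assms
proof (induction u v arbitrary: z z' rule: shuffles.induct)
  case (3 x xs y ys)
  from "3.prems"(2,3) obtain c d t t' where z: "z = c # t" "z' = d # t'"
    by (cases z; cases z') auto
  have neq: "f x \<noteq> f y" and
    disj: "f ` set xs \<inter> f ` set (y # ys) = {}" "f ` set (x # xs) \<inter> f ` set ys = {}"
    using "3.prems"(1) by auto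
  have "c = x \<and> t \<in> shuffles xs (y # ys) \<or> c = y \<and> t \<in> shuffles (x # xs) ys"
    "d = x \<and> t' \<in> shuffles xs (y # ys) \<or> d = y \<and> t' \<in> shuffles (x # xs) ys"
    using "3.prems"(2,3) z by auto
  then show ?case
    using "3.prems"(4) neq "3.IH"(1)[OF disj(1)] "3.IH"(2)[OF disj(2)] unfolding z by force
qed auto

lemma count_list_shuffles:
  assumes "z \<in> shuffles u v" shows "count_list z A = count_list u A + count_list v A"
proof -
  have "filter ((=) A) z \<in> shuffles (filter ((=) A) u) (filter ((=) A) v)"
    using assms filter_shuffles by blast
  then show ?thesis
    by (simp add: count_list_eq_length_filter length_shuffles)
qed

text \<open>Letters of the two words are disjoint as sets; as none of them is empty they are also
  distinct, so the multiplicities do not mix.\<close>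

lemma block_word_shuffles:
  assumes "z \<in> shuffles u v" "block_word u" "block_word v" "\<Union>(set u) \<inter> \<Union>(set v) = {}"
  shows "block_word z"
proof -
  have disj: "A \<notin> set v" if A: "A \<in> set u" for A
  proof
    assume "A \<in> set v"
    then have "A \<subseteq> \<Union>(set u) \<inter> \<Union>(set v)"
      using A by auto
    then show False
      using A assms(4) block_word_nonempty[OF assms(2)] by auto
  qed
  have "disjoint (set z)"
    using assms(2-4) unfolding set_shuffles[OF assms(1)] block_word_def by (intro disjoint_union) auto
  moreover have "finite A \<and> count_list z A = card A" if "A \<in> set z" for A
    using that assms(2,3) disj[of A] unfolding set_shuffles[OF assms(1)] count_list_shuffles[OF assms(1)] block_word_def
    by (auto simp: count_list_0_iff)
  ultimately show ?thesis
    by (simp add: block_word_def)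
qed

text \<open>Both sides run over the words \<open>y\<close> whose restrictions to the three sets of
  letters are \<open>a\<close>, \<open>b\<close> and \<open>c\<close>. The intermediate shuffle is
  recovered from \<open>y\<close> by deleting the letters of \<open>c\<close> or of
  \<open>a\<close>.\<close>

lemma sum_shuffles_assoc:
  fixes F :: "'a list \<Rightarrow> 'm::comm_monoid_add"
  assumes "set a \<inter> set b = {}" "set a \<inter> set c = {}" "set b \<inter> set c = {}"
  shows "(\<Sum>z\<in>shuffles a b. \<Sum>y\<in>shuffles z c. F y) = (\<Sum>x\<in>shuffles b c. \<Sum>y\<in>shuffles a x. F y)"
  unfolding sum.Sigma[OF finite_shuffles ballI[OF finite_shuffles]]
proof (rule sum.reindex_bij_witness[where
        i="\<lambda>(x, y). (filter (\<lambda>l. l \<notin> set c) y, y)" and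
        j="\<lambda>(z, y). (filter (\<lambda>l. l \<notin> set a) y, y)"])
  have ff: "filter P (filter Q y) = filter (\<lambda>l. P l \<and> Q l) y" for P Q and y :: "'a list"
    by (simp add: conj_commute)
  fix p assume "p \<in> Sigma (shuffles a b) (\<lambda>z. shuffles z c)"
  then obtain z y where p: "p = (z, y)" and z: "z \<in> shuffles a b" and y: "y \<in> shuffles z c"
    by auto
  have sz: "set z = set a \<union> set b"
    using set_shuffles[OF z] .
  have sy: "set y = set a \<union> set b \<union> set c"
    using set_shuffles[OF y] sz by simp
  have disj: "set z \<inter> set c = {}"
    using assms sz by auto
  have yz: "filter (\<lambda>l. l \<notin> set c) y = z" "filter (\<lambda>l. l \<in> set c) y = c"
    using filter_shuffles_disjoint2[OF disj y] by auto
  have za: "filter (\<lambda>l. l \<in> set a) z = a" "filter (\<lambda>l. l \<notin> set a) z = b"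
    using filter_shuffles_disjoint1[OF assms(1) z] by auto
  let ?x = "filter (\<lambda>l. l \<notin> set a) y"
  have "filter (\<lambda>l. l \<in> set c) ?x = filter (\<lambda>l. l \<in> set c) y"
    unfolding ff using assms by (intro filter_cong) auto
  then have "filter (\<lambda>l. l \<in> set c) ?x = c"
    by (simp only: yz)
  moreover have "filter (\<lambda>l. l \<notin> set c) ?x = b"
    using za(2) yz(1) by (auto simp: conj_commute)
  ultimately have "?x \<in> shuffles c b"
    using assms shuffles_iff_filter[of c b ?x] by (auto simp: Int_commute)
  then have x: "?x \<in> shuffles b c"
    by (simp add: shuffles_commutes)
  have "filter (\<lambda>l. l \<in> set a) y = filter (\<lambda>l. l \<in> set a) (filter (\<lambda>l. l \<notin> set c) y)"
    unfolding ff using assms(2) by (intro filter_cong) auto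
  then have "filter (\<lambda>l. l \<in> set a) y = a"
    by (simp only: yz za)
  then have y': "y \<in> shuffles a ?x"
    using partition_in_shuffles[of y "\<lambda>l. l \<in> set a"] by simp
  show "(\<lambda>(x, y). (filter (\<lambda>l. l \<notin> set c) y, y)) ((\<lambda>(z, y). (filter (\<lambda>l. l \<notin> set a) y, y)) p) = p"
    by (simp only: p prod.case yz)
  show "(\<lambda>(z, y). (filter (\<lambda>l. l \<notin> set a) y, y)) p \<in> Sigma (shuffles b c) (shuffles a)"
    using x y' by (simp add: p)
  show "(case (case p of (z, y) \<Rightarrow> (filter (\<lambda>l. l \<notin> set a) y, y)) of (x, xa) \<Rightarrow> F xa) = (case p of (x, xa) \<Rightarrow> F xa)"
    by (simp add: p)
next
  have ff: "filter P (filter Q y) = filter (\<lambda>l. P l \<and> Q l) y" for P Q and y :: "'a list"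
    by (simp add: conj_commute)
  fix p assume "p \<in> Sigma (shuffles b c) (shuffles a)"
  then obtain x y where p: "p = (x, y)" and x: "x \<in> shuffles b c" and y: "y \<in> shuffles a x"
    by auto
  have disj: "set a \<inter> set x = {}"
    using assms set_shuffles[OF x] by auto
  have yx: "filter (\<lambda>l. l \<in> set a) y = a" "filter (\<lambda>l. l \<notin> set a) y = x"
    using filter_shuffles_disjoint1[OF disj y] by auto
  have xc: "filter (\<lambda>l. l \<in> set c) x = c" "filter (\<lambda>l. l \<notin> set c) x = b"
    using filter_shuffles_disjoint2[OF assms(3) x] by auto
  let ?z = "filter (\<lambda>l. l \<notin> set c) y"
  have "filter (\<lambda>l. l \<in> set a) ?z = filter (\<lambda>l. l \<in> set a) y"
    unfolding ff using assms by (intro filter_cong) auto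
  then have "filter (\<lambda>l. l \<in> set a) ?z = a"
    by (simp only: yx)
  moreover have "filter (\<lambda>l. l \<notin> set a) ?z = b"
    using xc(2) yx(2) by (auto simp: conj_commute)
  ultimately have z: "?z \<in> shuffles a b"
    using assms shuffles_iff_filter[of a b ?z] by auto
  have "filter (\<lambda>l. l \<in> set c) y = filter (\<lambda>l. l \<in> set c) (filter (\<lambda>l. l \<notin> set a) y)"
    unfolding ff using assms(2) by (intro filter_cong) auto
  then have "filter (\<lambda>l. l \<in> set c) y = c"
    by (simp only: yx xc)
  then have "y \<in> shuffles c ?z"
    using partition_in_shuffles[of y "\<lambda>l. l \<in> set c"] by simp
  then have y': "y \<in> shuffles ?z c"
    by (simp add: shuffles_commutes)
  show "(\<lambda>(z, y). (filter (\<lambda>l. l \<notin> set a) y, y)) ((\<lambda>(x, y). (filter (\<lambda>l. l \<notin> set c) y, y)) p) = p"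
    by (simp only: p prod.case yx)
  show "(\<lambda>(x, y). (filter (\<lambda>l. l \<notin> set c) y, y)) p \<in> Sigma (shuffles a b) (\<lambda>z. shuffles z c)"
    using z y' by (simp add: p)
qed

text \<open>The combinatorial core of multiplicativity of the coproduct. Restricting the two halves
  of a cut shuffle to the letters of \<open>u\<close> and of \<open>v\<close> cuts these words;
  conversely, shuffling the halves separately and concatenating yields a shuffle of \<open>u\<close>
  and \<open>v\<close> with an admissible cut.\<close>

lemma sum_cuts_shuffles:
  fixes G :: "'a list \<Rightarrow> 'a list \<Rightarrow> 'm::comm_monoid_add"
  assumes "set u \<inter> set v = {}"
  shows "(\<Sum>z\<in>shuffles u v. \<Sum>p\<in>cuts z. G (fst p) (snd p))
    = (\<Sum>p\<in>cuts u. \<Sum>q\<in>cuts v. \<Sum>x\<in>shuffles (fst p) (fst q). \<Sum>y\<in>shuffles (snd p) (snd q). G x y)"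
proof -
  let ?P = "\<lambda>l. l \<in> set u" and ?Q = "\<lambda>l. l \<notin> set u"
  let ?R = "{(p, q, x, y). p \<in> cuts u \<and> q \<in> cuts v \<and> x \<in> shuffles (fst p) (fst q) \<and> y \<in> shuffles (snd p) (snd q)}"
  have R: "?R = (SIGMA p:cuts u. SIGMA q:cuts v. shuffles (fst p) (fst q) \<times> shuffles (snd p) (snd q))"
    by auto
  have "(\<Sum>p\<in>cuts u. \<Sum>q\<in>cuts v. \<Sum>x\<in>shuffles (fst p) (fst q). \<Sum>y\<in>shuffles (snd p) (snd q). G x y)
    = (\<Sum>(p, q, x, y)\<in>?R. G x y)"
    unfolding R by (simp add: sum.Sigma sum.cartesian_product)
  also have "\<dots> = (\<Sum>(z, p)\<in>Sigma (shuffles u v) cuts. G (fst p) (snd p))"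
  proof (rule sum.reindex_bij_witness[where
        j="\<lambda>(p, q, x, y). (x @ y, (x, y))" and
        i="\<lambda>(z, (x, y)). ((filter ?P x, filter ?P y), (filter ?Q x, filter ?Q y), x, y)"])
    fix r assume "r \<in> ?R"
    then obtain u1 u2 v1 v2 x y where r: "r = ((u1, u2), (v1, v2), x, y)"
      and uv: "u1 @ u2 = u" "set u1 \<inter> set u2 = {}" "v1 @ v2 = v" "set v1 \<inter> set v2 = {}"
      and x: "x \<in> shuffles u1 v1" and y: "y \<in> shuffles u2 v2"
      by (auto simp: cuts_def)
    have s: "set u = set u1 \<union> set u2" "set v = set v1 \<union> set v2" "set x = set u1 \<union> set v1" "set y = set u2 \<union> set v2"
      using uv set_shuffles[OF x] set_shuffles[OF y] by auto
    \<comment> \<open>The letters of \<open>x\<close> come from \<open>u1\<close> and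
      \<open>v1\<close>, so among them being a letter of \<open>u\<close> is the same as being a
      letter of \<open>u1\<close>; similarly for \<open>y\<close>.\<close>
    have "filter ?P x = filter (\<lambda>l. l \<in> set u1) x" "filter ?Q x = filter (\<lambda>l. l \<notin> set u1) x"
      "filter ?P y = filter (\<lambda>l. l \<in> set u2) y" "filter ?Q y = filter (\<lambda>l. l \<notin> set u2) y"
      using assms s by (auto intro!: filter_cong)
    moreover have "set u1 \<inter> set v1 = {}" "set u2 \<inter> set v2 = {}"
      using assms s by auto
    ultimately have f: "filter ?P x = u1" "filter ?Q x = v1" "filter ?P y = u2" "filter ?Q y = v2"
      using filter_shuffles_disjoint1[OF _ x] filter_shuffles_disjoint1[OF _ y] by auto
    then have "x @ y \<in> shuffles u v"
      using shuffles_iff_filter[OF assms, of "x @ y"] uv by simp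
    moreover have "set x \<inter> set y = {}"
      using s assms uv by auto
    ultimately show "(case r of (p, q, x, y) \<Rightarrow> (x @ y, (x, y))) \<in> Sigma (shuffles u v) cuts"
      by (simp add: r cuts_def)
    show "(case case r of (p, q, x, y) \<Rightarrow> (x @ y, x, y) of
            (z, x, y) \<Rightarrow> ((filter ?P x, filter ?P y), (filter ?Q x, filter ?Q y), x, y)) = r"
      by (simp add: r f)
    show "(case case r of (p, q, x, y) \<Rightarrow> (x @ y, x, y) of (z, p) \<Rightarrow> G (fst p) (snd p)) =
         (case r of (p, q, x, y) \<Rightarrow> G x y)"
      by (simp add: r)
  next
    fix r assume "r \<in> Sigma (shuffles u v) cuts"
    then obtain x y where r: "r = (x @ y, (x, y))" and z: "x @ y \<in> shuffles u v" and d: "set x \<inter> set y = {}"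
      by (auto simp: cuts_def)
    show "(case case r of (z, x, y) \<Rightarrow> ((filter ?P x, filter ?P y), (filter ?Q x, filter ?Q y), x, y) of
            (p, q, x, y) \<Rightarrow> (x @ y, x, y)) = r"
      by (simp add: r)
    have "filter ?P x @ filter ?P y = u" "filter ?Q x @ filter ?Q y = v"
      using z shuffles_iff_filter[OF assms, of "x @ y"] by auto
    then show "(case r of (z, x, y) \<Rightarrow> ((filter ?P x, filter ?P y), (filter ?Q x, filter ?Q y), x, y)) \<in> ?R"
      using d partition_in_shuffles by (auto simp: r cuts_def)
  qed
  also have "\<dots> = (\<Sum>z\<in>shuffles u v. \<Sum>p\<in>cuts z. G (fst p) (snd p))"
    by (simp add: sum.Sigma)
  finally show ?thesis by simp
qed

lemma shift_eq_image: "shift n = (`) (\<lambda>a. a + n)"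
  by (auto simp: shift_def)

lemma strict_mono_on_add: "strict_mono_on A (\<lambda>a::nat. a + n)"
  by (rule strict_mono_onI) auto

lemma block_word_map_shift: "block_word v \<Longrightarrow> block_word (map (shift n) v)"
  unfolding shift_eq_image by (intro block_word_map) auto

text \<open>Since the elements occurring in \<open>u\<close> lie below those occurring in
  \<open>v\<close>, ranks in the union are ranks in the first set, or ranks in the second raised by
  the length of \<open>u\<close>. The standardized shuffles are therefore those that form the
  product of the standardized words.\<close>

lemma sum_shuffles_std:
  fixes G :: "nat set list \<Rightarrow> 'm::comm_monoid_add"
  assumes u: "block_word u" and v: "block_word v"
    and less: "\<And>a b. a \<in> \<Union>(set u) \<Longrightarrow> b \<in> \<Union>(set v) \<Longrightarrow> a < b"
  shows "(\<Sum>z\<in>shuffles u v. G (std z)) = (\<Sum>z\<in>shuffles (std u) (map (shift (length u)) (std v)). G z)"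
proof -
  let ?U = "\<Union>(set u)" and ?V = "\<Union>(set v)"
  let ?r = "(`) (rk (?U \<union> ?V))"
  have std_z: "std z = map ?r z" if "z \<in> shuffles u v" for z
    using set_shuffles[OF that] by (simp add: std_def)
  have r: "inj_on ?r (set u \<union> set v)"
    using u v by (intro inj_on_image) (auto intro!: rk_inj)
  have "set u \<inter> set v = {}"
  proof (rule ccontr)
    assume "set u \<inter> set v \<noteq> {}"
    then obtain A where A: "A \<in> set u" "A \<in> set v" "A \<noteq> {}"
      using block_word_nonempty[OF u] by auto
    then show False
      using less by blast
  qed
  then have disj: "?r ` set u \<inter> ?r ` set v = {}"
    using r by (auto simp: inj_on_def)
  have "(\<Sum>z\<in>shuffles u v. G (std z)) = (\<Sum>z\<in>shuffles u v. G (map ?r z))"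
    by (intro sum.cong) (auto simp: std_z)
  also have "\<dots> = (\<Sum>z\<in>map ?r ` shuffles u v. G z)"
    by (subst sum.reindex) (auto intro!: inj_onI inj_on_map_shuffles[OF disj])
  also have "map ?r u = std u"
    unfolding std_def using less by (intro map_cong refl image_cong rk_Un_left) auto
  moreover have "map ?r v = map (shift (length u)) (std v)"
    unfolding std_def shift_def map_map o_def image_image block_word_length[OF u]
    using less u v by (intro map_cong refl image_cong rk_Un_right) auto
  ultimately show ?thesis
    by (simp add: map_shuffles)
qed

section \<open>Sums over all words with a given set of letters\<close>

definition words_on :: "nat set set \<Rightarrow> nat set list set" where
  "words_on S = {w. block_word w \<and> set w = S}"

lemma finite_words_on [simp]: "finite (words_on S)"
proof (cases "finite S")
  case True
  have "words_on S \<subseteq> {w. set w \<subseteq> S \<and> length w = card (\<Union>S)}"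
    by (auto simp: words_on_def block_word_length)
  then show ?thesis
    using finite_lists_length_eq[OF True] by (rule finite_subset)
next
  case False
  then have "words_on S = {}"
    by (auto simp: words_on_def)
  then show ?thesis by simp
qed

text \<open>Such a word is a shuffle of its restrictions to \<open>S\<close> and to
  \<open>T\<close>, and of no other pair of words with these letters. This turns a product of two
  full sums into one full sum.\<close>

lemma sum_words_on_shuffles:
  fixes F :: "nat set list \<Rightarrow> 'm::comm_monoid_add"
  assumes "\<Union>S \<inter> \<Union>T = {}"
  shows "(\<Sum>u\<in>words_on S. \<Sum>v\<in>words_on T. \<Sum>z\<in>shuffles u v. F z) = (\<Sum>z\<in>words_on (S \<union> T). F z)"
proof -
  let ?R = "SIGMA u:words_on S. SIGMA v:words_on T. shuffles u v"
  have "(\<Sum>u\<in>words_on S. \<Sum>v\<in>words_on T. \<Sum>z\<in>shuffles u v. F z) = (\<Sum>(u, v, z)\<in>?R. F z)"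
    by (simp add: sum.Sigma)
  also have "\<dots> = (\<Sum>z\<in>words_on (S \<union> T). F z)"
  proof (rule sum.reindex_bij_witness[where j="\<lambda>(u, v, z). z" and
        i="\<lambda>z. (filter (\<lambda>l. l \<in> S) z, filter (\<lambda>l. l \<notin> S) z, z)"])
    fix r assume "r \<in> ?R"
    then obtain u v z where r: "r = (u, v, z)" and u: "block_word u" "set u = S" and v: "block_word v" "set v = T"
      and z: "z \<in> shuffles u v"
      by (auto simp: words_on_def)
    have disj: "set u \<inter> set v = {}"
    proof (rule ccontr)
      assume "set u \<inter> set v \<noteq> {}"
      then obtain A where "A \<in> S" "A \<in> T" "A \<noteq> {}"
        using u v block_word_nonempty[OF u(1)] by auto
      then show False
        using assms by blast
    qed
    then show "(case case r of (u, v, z) \<Rightarrow> z of z \<Rightarrow> (filter (\<lambda>l. l \<in> S) z, filter (\<lambda>l. l \<notin> S) z, z)) = r"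
      using filter_shuffles_disjoint1[OF disj z] u by (simp add: r)
    have "block_word z"
      using u v assms by (intro block_word_shuffles[OF z]) auto
    then show "(case r of (u, v, z) \<Rightarrow> z) \<in> words_on (S \<union> T)"
      using set_shuffles[OF z] u v by (simp add: r words_on_def)
    show "F (case r of (u, v, z) \<Rightarrow> z) = (case r of (u, v, z) \<Rightarrow> F z)"
      by (simp add: r)
  next
    fix z assume z: "z \<in> words_on (S \<union> T)"
    then have bw: "block_word z" and s: "set z = S \<union> T"
      by (auto simp: words_on_def)
    have disj: "A \<notin> S" if "A \<in> T" for A
    proof
      assume "A \<in> S"
      moreover have "A \<noteq> {}"
        using that s block_word_nonempty[OF bw] by auto
      ultimately show False
        using that assms by blast
    qed
    \<comment> \<open>Filtering by letters keeps all copies of a letter or none, so the multiplicity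
      condition survives.\<close>
    have fc: "count_list (filter P z) A = (if P A then count_list z A else 0)" for P A
      by (induction z) auto
    have sub: "block_word (filter P z)" for P
      using bw by (auto simp: block_word_def fc disjoint_def pairwise_def)
    show "(filter (\<lambda>l. l \<in> S) z, filter (\<lambda>l. l \<notin> S) z, z) \<in> ?R"
      using s disj by (auto simp: words_on_def sub partition_in_shuffles)
  qed auto
  finally show ?thesis .
qed

text \<open>The cuts are grouped by the set \<open>S\<close> of letters of the left piece: every
  arrangement of \<open>S\<close> followed by every arrangement of \<open>A - S\<close> occurs,
  exactly once.\<close>

lemma sum_words_on_cuts:
  fixes F :: "nat set list \<Rightarrow> nat set list \<Rightarrow> 'm::comm_monoid_add"
  assumes "disjoint A" "finite A"
  shows "(\<Sum>w\<in>words_on A. \<Sum>p\<in>cuts w. F (fst p) (snd p)) = (\<Sum>S\<in>Pow A. \<Sum>u\<in>words_on S. \<Sum>v\<in>words_on (A - S). F u v)"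
proof -
  let ?R = "SIGMA S:Pow A. words_on S \<times> words_on (A - S)"
  have "(\<Sum>S\<in>Pow A. \<Sum>u\<in>words_on S. \<Sum>v\<in>words_on (A - S). F u v) = (\<Sum>(S, u, v)\<in>?R. F u v)"
    using assms(2) by (simp add: sum.Sigma sum.cartesian_product)
  also have "\<dots> = (\<Sum>(w, p)\<in>Sigma (words_on A) cuts. F (fst p) (snd p))"
  proof (rule sum.reindex_bij_witness[where j="\<lambda>(S, u, v). (u @ v, u, v)" and i="\<lambda>(w, u, v). (set u, u, v)"])
    fix r assume "r \<in> ?R"
    then obtain u v where r: "r = (set u, u, v)" and uv: "block_word u" "set u \<subseteq> A" "block_word v" "set v = A - set u"
      by (auto simp: words_on_def)
    have "count_list v B = 0" if "B \<in> set u" for B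
      using that uv by (auto simp: count_list_0_iff)
    moreover have "count_list u B = 0" if "B \<in> set v" for B
      using that uv by (auto simp: count_list_0_iff)
    moreover have "set u \<union> set v = A"
      using uv by auto
    ultimately have "block_word (u @ v)"
      using assms uv(1,3) by (auto simp: block_word_def)
    then show "(case r of (S, u, v) \<Rightarrow> (u @ v, u, v)) \<in> Sigma (words_on A) cuts"
      using uv by (auto simp: r words_on_def cuts_def)
    show "(case case r of (S, u, v) \<Rightarrow> (u @ v, u, v) of (w, u, v) \<Rightarrow> (set u, u, v)) = r"
      by (simp add: r)
    show "(case case r of (S, u, v) \<Rightarrow> (u @ v, u, v) of (w, p) \<Rightarrow> F (fst p) (snd p)) = (case r of (S, u, v) \<Rightarrow> F u v)"
      by (simp add: r)
  next
    fix r assume "r \<in> Sigma (words_on A) cuts"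
    then obtain w u v where r: "r = (w, u, v)" and w: "block_word w" "set w = A" and uv: "(u, v) \<in> cuts w"
      by (auto simp: words_on_def)
    show "(case case r of (w, u, v) \<Rightarrow> (set u, u, v) of (S, u, v) \<Rightarrow> (u @ v, u, v)) = r"
      using uv by (simp add: r cuts_def)
    show "(case r of (w, u, v) \<Rightarrow> (set u, u, v)) \<in> ?R"
      using cuts_block_word[OF uv w(1)] uv w(2) by (auto simp: r words_on_def cuts_def)
  qed
  also have "\<dots> = (\<Sum>w\<in>words_on A. \<Sum>p\<in>cuts w. F (fst p) (snd p))"
    by (simp add: sum.Sigma)
  finally show ?thesis by simp
qed

lemma words_on_map:
  assumes "inj_on \<phi> (\<Union>S)"
  shows "words_on ((`) \<phi> ` S) = map ((`) \<phi>) ` words_on S"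
proof (intro set_eqI iffI)
  fix w assume w: "w \<in> words_on ((`) \<phi> ` S)"
  let ?\<psi> = "inv_into (\<Union>S) \<phi>"
  have U: "\<Union>(set w) = \<phi> ` \<Union>S"
    using w by (auto simp: words_on_def)
  have "?\<psi> ` \<phi> ` A = A" if "A \<in> S" for A
    using that by (intro inv_into_image_cancel[OF assms]) auto
  then have "set (map ((`) ?\<psi>) w) = S"
    using w by (auto simp: words_on_def image_image)
  moreover have "block_word (map ((`) ?\<psi>) w)"
    using w by (intro block_word_map) (auto simp: words_on_def U intro!: inj_on_inv_into)
  moreover have "map ((`) \<phi>) (map ((`) ?\<psi>) w) = w"
  proof -
    have "\<phi> ` ?\<psi> ` B = B" if "B \<in> set w" for B
      using that U by (intro image_inv_into_cancel) auto
    then show ?thesis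
      by (simp add: map_idI)
  qed
  ultimately show "w \<in> map ((`) \<phi>) ` words_on S"
    by (intro image_eqI[where x="map ((`) ?\<psi>) w"]) (auto simp: words_on_def)
next
  fix w assume "w \<in> map ((`) \<phi>) ` words_on S"
  then show "w \<in> words_on ((`) \<phi> ` S)"
    using assms by (auto simp: words_on_def intro!: block_word_map)
qed

lemma sum_words_on_map:
  fixes F :: "nat set list \<Rightarrow> 'm::comm_monoid_add"
  assumes "inj_on \<phi> (\<Union>S)"
  shows "(\<Sum>w\<in>words_on ((`) \<phi> ` S). F w) = (\<Sum>w\<in>words_on S. F (map ((`) \<phi>) w))"
proof -
  have "inj_on (map ((`) \<phi>)) (words_on S)"
    using inj_on_image[OF assms] by (intro inj_onI) (auto simp: words_on_def intro: map_inj_on)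
  then show ?thesis
    by (simp add: words_on_map assms sum.reindex)
qed

lemma sum_words_on_part_std:
  fixes F :: "nat set list \<Rightarrow> 'm::comm_monoid_add"
  assumes "finite (\<Union>S)"
  shows "(\<Sum>w\<in>words_on (part_std S). F w) = (\<Sum>w\<in>words_on S. F (std w))"
proof -
  have "part_std S = (`) (rk (\<Union>S)) ` S"
    by (simp add: part_std_def rk_def[abs_def])
  then have "(\<Sum>w\<in>words_on (part_std S). F w) = (\<Sum>w\<in>words_on S. F (map ((`) (rk (\<Union>S))) w))"
    by (simp add: sum_words_on_map rk_inj assms)
  also have "\<dots> = (\<Sum>w\<in>words_on S. F (std w))"
    by (intro sum.cong) (auto simp: words_on_def std_def)
  finally show ?thesis .
qed

section \<open>Uniform block permutations as words\<close>

text \<open>Positions are counted from 1, as in \<open>{1..n}\<close>, hence the list index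
  \<open>j - 1\<close>.\<close>

definition fib :: "'a list \<Rightarrow> 'a \<Rightarrow> nat set" where
  "fib w A = {j \<in> {1..length w}. w ! (j - 1) = A}"

definition bmap :: "nat set list \<Rightarrow> blockmap" where
  "bmap w = (\<lambda>A. (A, fib w A)) ` set w"

lemma card_fib: "card (fib w A) = count_list w A"
proof -
  have "fib w A = Suc ` {i. i < length w \<and> A = w ! i}"
  proof (intro set_eqI iffI)
    fix j assume "j \<in> fib w A"
    then show "j \<in> Suc ` {i. i < length w \<and> A = w ! i}"
      by (intro image_eqI[where x="j - 1"]) (auto simp: fib_def)
  qed (auto simp: fib_def)
  then show ?thesis
    by (simp add: count_list_eq_length_filter length_filter_conv_card card_image)
qed

lemma fib_nonempty: "A \<in> set w \<Longrightarrow> fib w A \<noteq> {}"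
proof -
  assume "A \<in> set w"
  then obtain i where "i < length w" "w ! i = A"
    by (auto simp: in_set_conv_nth)
  then have "Suc i \<in> fib w A"
    by (simp add: fib_def)
  then show ?thesis by blast
qed

lemma fib_disjoint: "j \<in> fib w A \<Longrightarrow> j \<in> fib w B \<Longrightarrow> A = B"
  by (simp add: fib_def)

lemma in_fib: "j \<in> {1..length w} \<Longrightarrow> j \<in> fib w (w ! (j - 1)) \<and> w ! (j - 1) \<in> set w"
  by (auto simp: fib_def)

lemma Domain_bmap [simp]: "Domain (bmap w) = set w"
  by (force simp: bmap_def)

lemma Range_bmap: "Range (bmap w) = fib w ` set w"
  by (force simp: bmap_def)

lemma ubp_size_bmap: "block_word w \<Longrightarrow> ubp_size (bmap w) = length w"
  by (simp add: ubp_size_def block_word_length)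

lemma partition_on_std_word: "w \<in> std_words n \<Longrightarrow> partition_on {1..n} (set w)"
  using block_word_nonempty by (auto simp: partition_on_def std_words_def block_word_def)

lemma partition_on_fib: "partition_on {1..length w} (fib w ` set w)"
proof (rule partition_onI)
  show "\<Union>(fib w ` set w) = {1..length w}"
  proof (intro set_eqI iffI)
    fix j assume "j \<in> {1..length w}"
    then show "j \<in> \<Union>(fib w ` set w)"
      using in_fib[of j w] by blast
  qed (auto simp: fib_def)
  show "disjnt p q" if "p \<in> fib w ` set w" "q \<in> fib w ` set w" "p \<noteq> q" for p q
    using that fib_disjoint[of _ w] unfolding disjnt_iff by blast
  show "{} \<notin> fib w ` set w"
    using fib_nonempty by fastforce
qed

lemma bmap_in_ubp: assumes "w \<in> std_words n" shows "bmap w \<in> ubp n"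
proof -
  have "single_valued (bmap w)"
    by (auto simp: single_valued_def bmap_def)
  moreover have "A = B" if AB: "A \<in> set w" "B \<in> set w" "fib w A = fib w B" for A B
  proof -
    obtain j where "j \<in> fib w A"
      using fib_nonempty[OF AB(1)] by blast
    then show ?thesis
      using fib_disjoint[of j w A B] AB(3) by simp
  qed
  then have "single_valued ((bmap w)\<inverse>)"
    by (auto simp: single_valued_def bmap_def)
  moreover have "card A = card (fib w A)" if "A \<in> set w" for A
    using assms that by (simp add: card_fib std_words_def block_word_def)
  ultimately show ?thesis
    using partition_on_std_word[OF assms] partition_on_fib[of w] std_words_length[OF assms]
    unfolding ubp_def mem_Collect_eq Range_bmap Domain_bmap by (auto simp: bmap_def)
qed

lemma bmap_eq_imp_eq:
  assumes "bmap w = bmap w'" "length w = length w'" shows "w = w'"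
proof (rule nth_equalityI)
  show "length w = length w'" by fact
  fix i assume i: "i < length w"
  have "(w ! i, fib w (w ! i)) \<in> bmap w'"
    unfolding assms(1)[symmetric] using i by (auto simp: bmap_def)
  then have "fib w (w ! i) = fib w' (w ! i)"
    by (auto simp: bmap_def)
  moreover have "Suc i \<in> fib w (w ! i)"
    using i by (simp add: fib_def)
  ultimately have "Suc i \<in> fib w' (w ! i)"
    by simp
  then show "w ! i = w' ! i"
    by (simp add: fib_def)
qed

text \<open>The word is read off by labelling each position with the domain block whose image
  contains it. Equality of block sizes becomes the multiplicity condition of
  \<open>block_word\<close>.\<close>

lemma ubp_imp_bmap:
  assumes f: "f \<in> ubp n" shows "\<exists>w\<in>std_words n. f = bmap w"
proof -
  have part: "partition_on {1..n} (Domain f)" "partition_on {1..n} (Range f)"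
    and sv: "single_valued f" "single_valued (f\<inverse>)" and card: "\<And>A B. (A, B) \<in> f \<Longrightarrow> card A = card B"
    using f by (auto simp: ubp_def)
  have ex: "\<exists>A B. (A, B) \<in> f \<and> j \<in> B" if "j \<in> {1..n}" for j
    using partition_onD1[OF part(2)] that by auto
  \<comment> \<open>Distinct codomain blocks are disjoint and the block map is injective, so a
    position determines its codomain block and its label.\<close>
  have unique: "A = A' \<and> B = B'" if "(A, B) \<in> f" "(A', B') \<in> f" "j \<in> B" "j \<in> B'" for A A' B B' j
  proof -
    have "B = B'"
      using partition_onD2[OF part(2)] that by (metis IntI RangeI disjointD empty_iff)
    then show ?thesis
      using that sv(2) by (auto simp: single_valued_def)
  qed
  define lab where "lab j = (THE A. \<exists>B. (A, B) \<in> f \<and> j \<in> B)" for j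
  have lab: "lab j = A" if "(A, B) \<in> f" "j \<in> B" for j A B
    unfolding lab_def by (rule the_equality) (use that unique in blast)+
  define w where "w = map lab [1..<Suc n]"
  have nth: "w ! (j - 1) = lab j" if "j \<in> {1..n}" for j
    using that unfolding w_def by (subst nth_map) (auto simp del: upt_Suc)
  have len: "length w = n"
    by (simp add: w_def)
  have sub: "B \<subseteq> {1..n}" "B \<noteq> {}" "finite A" if "(A, B) \<in> f" for A B
  proof -
    have A: "A \<in> Domain f" and B: "B \<in> Range f"
      using that by auto
    show "B \<subseteq> {1..n}"
      using B partition_onD1[OF part(2)] by blast
    show "B \<noteq> {}"
      using B partition_onD3[OF part(2)] by blast
    have "A \<subseteq> {1..n}"
      using A partition_onD1[OF part(1)] by blast
    then show "finite A"
      by (rule finite_subset) simp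
  qed
  have fib: "fib w A = B" if AB: "(A, B) \<in> f" for A B
  proof (intro set_eqI iffI)
    fix j assume "j \<in> fib w A"
    then have j: "j \<in> {1..n}" "lab j = A"
      using nth by (auto simp: fib_def len)
    then obtain A' B' where "(A', B') \<in> f" "j \<in> B'"
      using ex by blast
    moreover from this have "A' = A"
      using lab[of A' B' j] j(2) by simp
    ultimately show "j \<in> B"
      using sv(1) AB unfolding single_valued_def by metis
  next
    fix j assume "j \<in> B"
    then show "j \<in> fib w A"
      using sub[OF AB] lab[OF AB] nth by (auto simp: fib_def len)
  qed
  have set_w: "set w = Domain f"
  proof (intro set_eqI iffI)
    fix A assume "A \<in> set w"
    then obtain j where "j \<in> {1..n}" "A = lab j"
      unfolding w_def set_map set_upt atLeastLessThanSuc_atLeastAtMost by blast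
    then show "A \<in> Domain f"
      using ex[of j] lab by auto
  next
    fix A assume "A \<in> Domain f"
    then obtain B where AB: "(A, B) \<in> f" by auto
    then obtain j where "j \<in> B"
      using sub by blast
    then have "j \<in> fib w A"
      using fib[OF AB] by simp
    then show "A \<in> set w"
      using in_fib[of j w] by (auto simp: fib_def)
  qed
  have "bmap w = f"
  proof (intro set_eqI iffI)
    fix p assume "p \<in> bmap w"
    then obtain A B where "(A, B) \<in> f" "p = (A, fib w A)"
      by (auto simp: bmap_def set_w)
    then show "p \<in> f"
      using fib by simp
  next
    fix p assume p: "p \<in> f"
    obtain A B where AB: "p = (A, B)" "(A, B) \<in> f"
      using p by (cases p) auto
    then have "A \<in> set w" "B = fib w A"
      using fib[of A B] by (auto simp: set_w)
    then show "p \<in> bmap w"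
      by (simp add: bmap_def AB)
  qed
  moreover have "count_list w A = card A \<and> finite A" if "A \<in> set w" for A
    using that card fib sub(3) by (auto simp: set_w card_fib[symmetric])
  then have "w \<in> std_words n"
    using part(1) by (auto simp: std_words_def block_word_def set_w partition_on_def)
  ultimately show ?thesis by blast
qed

lemma ubp_eq_bmap: "ubp n = bmap ` std_words n"
  using ubp_imp_bmap bmap_in_ubp by auto

section \<open>Concatenation and products with permutations\<close>

lemma concat_in_std_words:
  assumes "u \<in> std_words n" "v \<in> std_words m"
  shows "u @ map (shift n) v \<in> std_words (n + m)" "set u \<inter> shift n ` set v = {}"
proof -
  have u: "block_word u" "\<Union>(set u) = {1..n}" and v: "block_word v" "\<Union>(set v) = {1..m}"
    using assms by (auto simp: std_words_def)
  have U: "\<Union>(set (map (shift n) v)) = {n + 1..n + m}"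
    unfolding shift_eq_image Union_map_image v(2) image_add_atLeastAtMost'[of n 1 m] by (auto simp: add.commute)
  then have UV: "\<Union>(set u) \<inter> \<Union>(set (map (shift n) v)) = {}"
    using u by auto
  have disj: "A \<notin> shift n ` set v" if A: "A \<in> set u" for A
  proof
    assume "A \<in> shift n ` set v"
    then have "A \<subseteq> \<Union>(set u) \<inter> \<Union>(set (map (shift n) v))"
      using A by auto
    then have "A = {}"
      unfolding UV by simp
    then show False
      using A block_word_nonempty[OF u(1)] by simp
  qed
  then show "set u \<inter> shift n ` set v = {}"
    by auto
  \<comment> \<open>Plain concatenation is one of the shuffles, so
    \<open>block_word_shuffles\<close> covers it.\<close>
  have "u @ map (shift n) v \<in> shuffles u (map (shift n) v)"
  proof (subst shuffles_iff_filter)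
    show "set u \<inter> set (map (shift n) v) = {}"
      using disj by auto
    show "filter (\<lambda>x. x \<in> set u) (u @ map (shift n) v) = u \<and> filter (\<lambda>x. x \<notin> set u) (u @ map (shift n) v) = map (shift n) v"
      using disj by (auto simp: filter_empty_conv filter_id_conv)
  qed
  then have "block_word (u @ map (shift n) v)"
    by (rule block_word_shuffles) (use u v UV in \<open>auto intro: block_word_map_shift\<close>)
  moreover have "\<Union>(set (u @ map (shift n) v)) = {1..n + m}"
    using U u(2) by (auto simp del: set_map)
  ultimately show "u @ map (shift n) v \<in> std_words (n + m)"
    by (simp add: std_words_def)
qed

lemma inj_shift: "inj (shift n)"
  by (auto simp: inj_def shift_eq_image inj_image_eq_iff)

lemma ubp_concat_bmap:
  assumes "u \<in> std_words n" "v \<in> std_words m"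
  shows "ubp_concat (bmap u) (bmap v) = bmap (u @ map (shift n) v)"
proof -
  have len: "length u = n" "length v = m"
    using assms by (auto simp: std_words_length)
  have disj: "set u \<inter> shift n ` set v = {}"
    using concat_in_std_words[OF assms] by simp
  have size: "ubp_size (bmap u) = n"
    using assms ubp_size_bmap len by (simp add: std_words_def)
  have nth: "(u @ map (shift n) v) ! (j - 1) = (if j \<le> n then u ! (j - 1) else shift n (v ! (j - n - 1)))"
    if "j \<in> {1..n + m}" for j
  proof (cases "j \<le> n")
    case False
    then have "j - Suc 0 - n = j - n - 1" "j - 1 \<ge> n" "j - n - 1 < m" using that by auto
    then show ?thesis
      using False by (simp add: nth_append len)
  qed (use that in \<open>auto simp: nth_append len\<close>)
  have 1: "fib (u @ map (shift n) v) A = fib u A" if A: "A \<in> set u" for A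
  proof (intro set_eqI)
    fix j
    have *: "shift n (v ! (j - n - 1)) \<noteq> A" if "n < j" "j \<le> n + m"
    proof -
      have "v ! (j - n - 1) \<in> set v" using that len by auto
      then show ?thesis using disj A by auto
    qed
    then show "j \<in> fib (u @ map (shift n) v) A \<longleftrightarrow> j \<in> fib u A"
    proof (cases "j \<in> {1..n + m}")
      case True
      then have "j \<in> fib (u @ map (shift n) v) A \<longleftrightarrow> (if j \<le> n then u ! (j - 1) else shift n (v ! (j - n - 1))) = A"
        by (simp only: nth[OF True, symmetric] fib_def mem_Collect_eq length_append length_map len simp_thms)
      with True show ?thesis
        using * by (simp add: fib_def len)
    qed (auto simp: fib_def len)
  qed
  have 2: "fib (u @ map (shift n) v) (shift n A) = shift n (fib v A)" if A: "A \<in> set v" for A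
  proof (intro set_eqI)
    fix j
    have *: "u ! (j - 1) \<noteq> shift n A" if "1 \<le> j" "j \<le> n"
    proof -
      have "u ! (j - 1) \<in> set u" using that len by auto
      then show ?thesis using disj A by auto
    qed
    have "j \<in> fib (u @ map (shift n) v) (shift n A) \<longleftrightarrow> n < j \<and> j \<le> n + m \<and> v ! (j - n - 1) = A"
    proof (cases "j \<in> {1..n + m}")
      case True
      then have "j \<in> fib (u @ map (shift n) v) (shift n A) \<longleftrightarrow> (if j \<le> n then u ! (j - 1) else shift n (v ! (j - n - 1))) = shift n A"
        by (simp only: nth[OF True, symmetric] fib_def mem_Collect_eq length_append length_map len simp_thms)
      with True show ?thesis
        using * by (auto simp: inj_eq[OF inj_shift])
    qed (auto simp: fib_def len)
    also have "\<dots> \<longleftrightarrow> j \<in> shift n (fib v A)"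
      unfolding shift_def fib_def len
      by (auto intro!: image_eqI[where x="j - n"])
    finally show "j \<in> fib (u @ map (shift n) v) (shift n A) \<longleftrightarrow> j \<in> shift n (fib v A)" .
  qed
  show ?thesis
    unfolding ubp_concat_def size unfolding bmap_def
    by (auto simp: 1 2 image_Un image_image intro!: arg_cong2[where f="(\<union>)"] image_cong)
qed

text \<open>In a product with a permutation one of the two middle partitions consists of singletons
  and refines the other. All products that occur are of this kind, so joins in general position are
  never computed.\<close>

lemma part_join_coarse:
  assumes "partition_on A P" "refines A Q P"
  shows "part_join Q P = P" "part_join P Q = P"
proof -
  have Q: "partition_on A Q"
    using assms by (simp add: refines_def)
  have U: "\<Union>P = A" "\<Union>Q = A"
    using assms(1) Q by (auto simp: partition_on_def)
  have P: "refines A P P"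
    using assms(1) by (rule refines_refl)
  have *: "(THE E. refines A Q E \<and> refines A P E \<and> (\<forall>E'. refines A Q E' \<and> refines A P E' \<longrightarrow> refines A E E')) = P"
  proof (rule the_equality)
    show "refines A Q P \<and> refines A P P \<and> (\<forall>E'. refines A Q E' \<and> refines A P E' \<longrightarrow> refines A P E')"
      using assms P by auto
    show "E = P" if "refines A Q E \<and> refines A P E \<and> (\<forall>E'. refines A Q E' \<and> refines A P E' \<longrightarrow> refines A E E')" for E
      using that assms P refines_asym[of A E P] by auto
  qed
  show "part_join Q P = P" "part_join P Q = P"
    unfolding part_join_def U using * by (simp_all add: conj_ac)
qed

lemma refines_singletons:
  assumes "partition_on A P" shows "refines A ((\<lambda>i. {i}) ` A) P"
  unfolding refines_def using assms partition_on_singletons[of A] partition_onD1[OF assms] by auto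

text \<open>No block of a partition contains another one, so each block is united with itself only,
  and the permutation acts on the codomain side alone.\<close>

lemma ubp_comp_perm_left:
  assumes f: "f \<in> ubp n"
  shows "ubp_comp (perm_ubp n \<xi>) f = map_prod id ((`) \<xi>) ` f"
proof -
  have part: "partition_on {1..n} (Range f)" and sv: "single_valued (f\<inverse>)"
    using f by (auto simp: ubp_def)
  have D: "Domain (perm_ubp n \<xi>) = (\<lambda>i. {i}) ` {1..n}"
    by (force simp: perm_ubp_def)
  have R: "Range f = snd ` f"
    by force
  have "ubp_comp (perm_ubp n \<xi>) f = (\<lambda>E. (\<Union>{A. \<exists>B. (A, B) \<in> f \<and> B \<subseteq> E}, \<Union>{D. \<exists>C. (C, D) \<in> perm_ubp n \<xi> \<and> C \<subseteq> E})) ` Range f"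
    unfolding ubp_comp_def D part_join_coarse(2)[OF part refines_singletons[OF part]] ..
  also have "\<dots> = map_prod id ((`) \<xi>) ` f"
    unfolding R image_image
  proof (intro image_cong refl)
    fix p assume "p \<in> f"
    then obtain A B where p: "p = (A, B)" and AB: "(A, B) \<in> f" by (cases p) auto
    have B: "B \<in> Range f" "B \<subseteq> {1..n}"
      using AB partition_onD1[OF part] by auto
    have "A' = A" if "(A', B') \<in> f" "B' \<subseteq> B" for A' B'
    proof -
      have "B' \<noteq> {}" "B' \<in> Range f"
        using that partition_onD3[OF part] by auto
      then have "B' = B"
        using B that disjointD[OF partition_onD2[OF part], of B' B] by auto
      then show ?thesis
        using that AB sv by (auto simp: single_valued_def)
    qed
    then have 1: "{A'. \<exists>B'. (A', B') \<in> f \<and> B' \<subseteq> B} = {A}"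
      using AB by blast
    have 2: "{D. \<exists>C. (C, D) \<in> perm_ubp n \<xi> \<and> C \<subseteq> B} = (\<lambda>i. {\<xi> i}) ` B"
      using B(2) by (auto simp: perm_ubp_def)
    show "(\<Union>{A. \<exists>B. (A, B) \<in> f \<and> B \<subseteq> snd p}, \<Union>{D. \<exists>C. (C, D) \<in> perm_ubp n \<xi> \<and> C \<subseteq> snd p}) = map_prod id ((`) \<xi>) p"
      unfolding p snd_conv 1 2 by auto
  qed
  finally show ?thesis .
qed

lemma ubp_comp_perm_right:
  assumes f: "f \<in> ubp n" and \<sigma>: "\<sigma> permutes {1..n}"
  shows "ubp_comp f (perm_ubp n \<sigma>) = map_prod ((`) (inv \<sigma>)) id ` f"
proof -
  have part: "partition_on {1..n} (Domain f)" and sv: "single_valued f"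
    using f by (auto simp: ubp_def)
  have "Range (perm_ubp n \<sigma>) = (\<lambda>i. {i}) ` \<sigma> ` {1..n}"
    by (force simp: perm_ubp_def)
  then have D: "Range (perm_ubp n \<sigma>) = (\<lambda>i. {i}) ` {1..n}"
    unfolding permutes_image[OF \<sigma>] .
  have R: "Domain f = fst ` f"
    by force
  have "ubp_comp f (perm_ubp n \<sigma>) = (\<lambda>E. (\<Union>{A. \<exists>B. (A, B) \<in> perm_ubp n \<sigma> \<and> B \<subseteq> E}, \<Union>{D. \<exists>C. (C, D) \<in> f \<and> C \<subseteq> E})) ` Domain f"
    unfolding ubp_comp_def D part_join_coarse(1)[OF part refines_singletons[OF part]] ..
  also have "\<dots> = map_prod ((`) (inv \<sigma>)) id ` f"
    unfolding R image_image
  proof (intro image_cong refl)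
    fix p assume "p \<in> f"
    then obtain A B where p: "p = (A, B)" and AB: "(A, B) \<in> f" by (cases p) auto
    have A: "A \<in> Domain f" "A \<subseteq> {1..n}"
      using AB partition_onD1[OF part] by auto
    have "B' = B" if "(A', B') \<in> f" "A' \<subseteq> A" for A' B'
    proof -
      have "A' \<noteq> {}" "A' \<in> Domain f"
        using that partition_onD3[OF part] by auto
      then have "A' = A"
        using A that disjointD[OF partition_onD2[OF part], of A' A] by auto
      then show ?thesis
        using that AB sv by (auto simp: single_valued_def)
    qed
    then have 1: "{B'. \<exists>A'. (A', B') \<in> f \<and> A' \<subseteq> A} = {B}"
      using AB by blast
    have 2: "{A'. \<exists>B'. (A', B') \<in> perm_ubp n \<sigma> \<and> B' \<subseteq> A} = (\<lambda>i. {inv \<sigma> i}) ` A"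
    proof (intro set_eqI iffI)
      fix x assume "x \<in> {A'. \<exists>B'. (A', B') \<in> perm_ubp n \<sigma> \<and> B' \<subseteq> A}"
      then obtain i where "x = {i}" "\<sigma> i \<in> A"
        by (auto simp: perm_ubp_def)
      then show "x \<in> (\<lambda>i. {inv \<sigma> i}) ` A"
        by (intro image_eqI[where x="\<sigma> i"]) (auto simp: permutes_inverses[OF \<sigma>])
    next
      fix x assume "x \<in> (\<lambda>i. {inv \<sigma> i}) ` A"
      then obtain i where i: "i \<in> A" "x = {inv \<sigma> i}" by auto
      then have "inv \<sigma> i \<in> {1..n}"
        using A(2) permutes_in_image[OF permutes_inv[OF \<sigma>]] by blast
      then have "(x, {i}) \<in> perm_ubp n \<sigma>"
        unfolding perm_ubp_def i by (intro image_eqI[where x="inv \<sigma> i"]) (auto simp: permutes_inverses[OF \<sigma>])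
      then show "x \<in> {A'. \<exists>B'. (A', B') \<in> perm_ubp n \<sigma> \<and> B' \<subseteq> A}"
        using i by auto
    qed
    show "(\<Union>{A. \<exists>B. (A, B) \<in> perm_ubp n \<sigma> \<and> B \<subseteq> fst p}, \<Union>{D. \<exists>C. (C, D) \<in> f \<and> C \<subseteq> fst p}) = map_prod ((`) (inv \<sigma>)) id p"
      unfolding p fst_conv 1 2 by auto
  qed
  finally show ?thesis .
qed

text \<open>Moving the elements of codomain blocks by \<open>\<xi>\<close> moves positions, so the
  letter now at \<open>j\<close> is the one formerly at \<open>inv \<xi> j\<close>.\<close>

lemma map_prod_range_bmap:
  assumes w: "length w = n" and \<xi>: "\<xi> permutes {1..n}"
  shows "map_prod id ((`) \<xi>) ` bmap w = bmap (map (\<lambda>j. w ! (j - 1)) (map (inv \<xi>) [1..<Suc n]))"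
proof -
  let ?w = "map (\<lambda>j. w ! (j - 1)) (map (inv \<xi>) [1..<Suc n])"
  have nth: "?w ! (j - 1) = w ! (inv \<xi> j - 1)" if "j \<in> {1..n}" for j
  proof -
    have "j - 1 < length [1..<Suc n]" "[1..<Suc n] ! (j - 1) = j"
      using that by (auto simp: nth_upt simp del: upt_Suc)
    then show ?thesis
      by (simp del: upt_Suc)
  qed
  have len: "length ?w = n" by simp
  have "set ?w = (\<lambda>j. w ! (j - 1)) ` inv \<xi> ` {1..n}"
    by (auto simp: image_image simp del: upt_Suc)
  also have "\<dots> = (\<lambda>j. w ! (j - 1)) ` {1..n}"
    by (simp only: permutes_image[OF permutes_inv[OF \<xi>]])
  also have "\<dots> = set w"
    unfolding set_conv_nth w by (force intro: image_eqI[where x="Suc _"])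
  finally have set: "set ?w = set w" .
  have "fib ?w A = \<xi> ` fib w A" for A
  proof (intro set_eqI iffI)
    fix j assume j: "j \<in> fib ?w A"
    then have j': "j \<in> {1..n}"
      unfolding fib_def len by simp
    then have "w ! (inv \<xi> j - 1) = A"
      using nth[of j] j unfolding fib_def by simp
    moreover have "inv \<xi> j \<in> {1..n}"
      using j' permutes_in_image[OF permutes_inv[OF \<xi>]] by blast
    ultimately show "j \<in> \<xi> ` fib w A"
      by (intro image_eqI[where x="inv \<xi> j"]) (auto simp: fib_def w permutes_inverses[OF \<xi>])
  next
    fix j assume "j \<in> \<xi> ` fib w A"
    then obtain i where i: "j = \<xi> i" "i \<in> {1..n}" "w ! (i - 1) = A"
      by (auto simp: fib_def w)
    then have "j \<in> {1..n}"
      using permutes_in_image[OF \<xi>] by blast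
    then have "?w ! (j - 1) = A"
      unfolding nth[OF \<open>j \<in> {1..n}\<close>] using i by (simp add: permutes_inverses[OF \<xi>])
    then show "j \<in> fib ?w A"
      using \<open>j \<in> {1..n}\<close> unfolding fib_def len by blast
  qed
  then show ?thesis
    unfolding bmap_def set by (simp add: image_image del: upt_Suc)
qed

text \<open>Relabelling inside the domain blocks changes letters and keeps positions; by injectivity
  distinct letters stay distinct, so no two fibers merge.\<close>

lemma map_prod_dom_bmap:
  assumes "inj_on \<phi> (\<Union>(set w))"
  shows "map_prod ((`) \<phi>) id ` bmap w = bmap (map ((`) \<phi>) w)"
proof -
  have inj: "inj_on ((`) \<phi>) (set w)"
    using assms by (rule inj_on_image)
  have "fib (map ((`) \<phi>) w) (\<phi> ` A) = fib w A" if A: "A \<in> set w" for A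
  proof (intro set_eqI)
    fix j
    have "(\<phi> ` (w ! (j - 1)) = \<phi> ` A) = (w ! (j - 1) = A)" if "j \<in> {1..length w}"
      using inj_on_eq_iff[OF inj, of "w ! (j - 1)" A] that A by auto
    then show "j \<in> fib (map ((`) \<phi>) w) (\<phi> ` A) \<longleftrightarrow> j \<in> fib w A"
      by (auto simp: fib_def)
  qed
  then show ?thesis
    by (auto simp: bmap_def image_image intro!: image_cong)
qed

section \<open>Shuffle permutations and the product\<close>

lemma sorted_wrt_filter_nth:
  assumes "sorted_wrt R (filter P xs)" "a < b" "b < length xs" "P (xs ! a)" "P (xs ! b)"
  shows "R (xs ! a) (xs ! b)"
proof -
  have "filter P xs = filter P (take b xs) @ filter P (drop b xs)"
    by (simp flip: filter_append)
  moreover have "xs ! a \<in> set (take b xs)"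
    using assms by (auto simp: in_set_conv_nth intro!: exI[of _ a])
  moreover have "xs ! b \<in> set (drop b xs)"
    using assms by (auto simp: in_set_conv_nth intro!: exI[of _ 0])
  ultimately show ?thesis
    using assms by (auto simp: sorted_wrt_append)
qed

text \<open>A permutation \<open>\<xi>\<close> increases on each of the two intervals precisely when
  the numbers of each interval occur in increasing order in the list of values of
  \<open>inv \<xi>\<close>. This links shuffles as permutations with shuffles of lists.\<close>

lemma bij_betw_shuffles_perm:
  "bij_betw (\<lambda>\<xi>. map (inv \<xi>) [1..<Suc (n + m)]) (shuffles_perm n m) (shuffles [1..<Suc n] [Suc n..<Suc (n + m)])"
proof (rule bij_betw_imageI)
  let ?N = "n + m"
  show "inj_on (\<lambda>\<xi>. map (inv \<xi>) [1..<Suc ?N]) (shuffles_perm n m)"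
  proof (rule inj_onI)
    fix \<xi> \<xi>' assume \<xi>: "\<xi> \<in> shuffles_perm n m" "\<xi>' \<in> shuffles_perm n m"
      and eq: "map (inv \<xi>) [1..<Suc ?N] = map (inv \<xi>') [1..<Suc ?N]"
    have p: "\<xi> permutes {1..?N}" "\<xi>' permutes {1..?N}"
      using \<xi> by (auto simp: shuffles_perm_def)
    have "inv \<xi> j = inv \<xi>' j" for j
    proof (cases "j \<in> {1..?N}")
      case True
      then show ?thesis using eq by (simp del: upt_Suc)
    next
      case False
      then show ?thesis
        using permutes_not_in[OF permutes_inv[OF p(1)]] permutes_not_in[OF permutes_inv[OF p(2)]] by simp
    qed
    then have "inv \<xi> = inv \<xi>'" by auto
    then have "inv (inv \<xi>) = inv (inv \<xi>')" by simp
    then show "\<xi> = \<xi>'"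
      by (simp add: inv_inv_eq permutes_bij[OF p(1)] permutes_bij[OF p(2)])
  qed
  show "(\<lambda>\<xi>. map (inv \<xi>) [1..<Suc ?N]) ` shuffles_perm n m = shuffles [1..<Suc n] [Suc n..<Suc ?N]"
  proof (intro set_eqI iffI)
    fix z assume "z \<in> (\<lambda>\<xi>. map (inv \<xi>) [1..<Suc ?N]) ` shuffles_perm n m"
    then obtain \<xi> where z: "z = map (inv \<xi>) [1..<Suc ?N]" and p: "\<xi> permutes {1..?N}"
      and mono: "strict_mono_on {1..n} \<xi>" "strict_mono_on {n + 1..n + m} \<xi>"
      by (auto simp: shuffles_perm_def)
    have in_N: "inv \<xi> x \<in> {1..?N}" if "x \<in> {1..?N}" for x
      using that permutes_in_image[OF permutes_inv[OF p]] by blast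
    \<comment> \<open>The value \<open>x\<close> stands in \<open>z\<close> at position
      \<open>\<xi> x\<close>, so monotonicity of \<open>\<xi>\<close> on a set means that the values
      from this set appear sorted.\<close>
    have "sorted_wrt (<) (filter P z)" if P: "strict_mono_on {x \<in> {1..?N}. P x} \<xi>" for P
    proof -
      have "sorted_wrt (\<lambda>x y. inv \<xi> x < inv \<xi> y) (filter (P \<circ> inv \<xi>) [1..<Suc ?N])"
      proof (rule sorted_wrt_mono_rel[of _ "(<)"])
        fix x y assume xy: "x \<in> set (filter (P \<circ> inv \<xi>) [1..<Suc ?N])" "y \<in> set (filter (P \<circ> inv \<xi>) [1..<Suc ?N])" "x < y"
        then have in_P: "inv \<xi> x \<in> {x \<in> {1..?N}. P x}" "inv \<xi> y \<in> {x \<in> {1..?N}. P x}"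
          using in_N[of x] in_N[of y] by (auto simp del: upt_Suc)
        have "\<xi> (inv \<xi> x) < \<xi> (inv \<xi> y)"
          using xy(3) by (simp add: permutes_inverses[OF p])
        then show "inv \<xi> x < inv \<xi> y"
          using strict_mono_on_less[OF P in_P] by simp
      next
        show "sorted_wrt (<) (filter (P \<circ> inv \<xi>) [1..<Suc ?N])"
          by (intro sorted_wrt_filter sorted_wrt_upt)
      qed
      then show ?thesis
        unfolding z filter_map sorted_wrt_map .
    qed note sorted = this
    have set_z: "set z = {1..?N}"
      unfolding z set_map set_upt atLeastLessThanSuc_atLeastAtMost by (rule permutes_image[OF permutes_inv[OF p]])
    have "{x \<in> {1..?N}. x \<le> n} = {1..n}" "{x \<in> {1..?N}. \<not> x \<le> n} = {n + 1..n + m}"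
      by auto
    then have "sorted_wrt (<) (filter (\<lambda>x. x \<le> n) z)" "sorted_wrt (<) (filter (\<lambda>x. \<not> x \<le> n) z)"
      using sorted[of "\<lambda>x. x \<le> n"] sorted[of "\<lambda>x. \<not> x \<le> n"] mono by simp_all
    moreover have "set (filter (\<lambda>x. x \<le> n) z) = set [1..<Suc n]" "set (filter (\<lambda>x. \<not> x \<le> n) z) = set [Suc n..<Suc ?N]"
      by (auto simp: set_z simp del: upt_Suc)
    ultimately have "filter (\<lambda>x. x \<le> n) z = [1..<Suc n]" "filter (\<lambda>x. \<not> x \<le> n) z = [Suc n..<Suc ?N]"
      by (metis strict_sorted_equal sorted_wrt_upt)+
    then show "z \<in> shuffles [1..<Suc n] [Suc n..<Suc ?N]"
      using partition_in_shuffles[of z "\<lambda>x. x \<le> n"] by simp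
  next
    fix z assume z: "z \<in> shuffles [1..<Suc n] [Suc n..<Suc ?N]"
    have disj: "set [1..<Suc n] \<inter> set [Suc n..<Suc ?N] = {}"
      by (auto simp del: upt_Suc)
    have dist: "distinct z"
      by (rule distinct_disjoint_shuffles[OF _ _ disj z]) auto
    have set_z: "set z = {1..?N}"
      unfolding set_shuffles[OF z] set_upt by auto
    have len: "length z = ?N"
      using length_shuffles[OF z] by (simp del: upt_Suc)
    have "filter (\<lambda>x. x \<le> n) z = filter (\<lambda>x. x \<in> set [1..<Suc n]) z"
      by (rule filter_cong) (auto simp: set_z simp del: upt_Suc)
    then have f1: "filter (\<lambda>x. x \<le> n) z = [1..<Suc n]"
      unfolding filter_shuffles_disjoint1(1)[OF disj z] .
    have "filter (\<lambda>x. \<not> x \<le> n) z = filter (\<lambda>x. x \<notin> set [1..<Suc n]) z"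
      by (rule filter_cong) (auto simp: set_z simp del: upt_Suc)
    then have f2: "filter (\<lambda>x. \<not> x \<le> n) z = [Suc n..<Suc ?N]"
      unfolding filter_shuffles_disjoint1(2)[OF disj z] .
    \<comment> \<open>\<open>\<rho>\<close> reads the list \<open>z\<close> as a function, extended
      by the identity; the shuffle permutation sought is its inverse.\<close>
    define \<rho> where "\<rho> k = (if k \<in> {1..?N} then z ! (k - 1) else k)" for k
    have "inj_on \<rho> {1..?N}"
      using dist len by (auto simp: inj_on_def \<rho>_def nth_eq_iff_index_eq)
    moreover have "\<rho> ` {1..?N} \<subseteq> {1..?N}"
    proof clarify
      fix k assume k: "k \<in> {1..?N}"
      then have "z ! (k - 1) \<in> set z"
        using len by auto
      then show "\<rho> k \<in> {1..?N}"
        using k unfolding set_z by (simp add: \<rho>_def)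
    qed
    ultimately have "bij_betw \<rho> {1..?N} {1..?N}"
      by (simp add: bij_betw_def endo_inj_surj)
    then have \<rho>: "\<rho> permutes {1..?N}"
      by (rule bij_imp_permutes) (simp only: \<rho>_def if_False)
    have inv: "inv (inv \<rho>) = \<rho>"
      by (simp add: inv_inv_eq permutes_bij[OF \<rho>])
    have "map (inv (inv \<rho>)) [1..<Suc ?N] = z"
    proof (rule nth_equalityI)
      fix i assume "i < length (map (inv (inv \<rho>)) [1..<Suc ?N])"
      then show "map (inv (inv \<rho>)) [1..<Suc ?N] ! i = z ! i"
        unfolding inv by (simp add: \<rho>_def del: upt_Suc)
    qed (simp add: len del: upt_Suc)
    moreover have mono: "strict_mono_on {x \<in> {1..?N}. P x} (inv \<rho>)" if "sorted_wrt (<) (filter P z)" for P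
    proof (rule strict_mono_onI)
      fix i j assume ij: "i \<in> {x \<in> {1..?N}. P x}" "j \<in> {x \<in> {1..?N}. P x}" "i < j"
      let ?p = "inv \<rho> i" and ?q = "inv \<rho> j"
      have pq: "?p \<in> {1..?N}" "?q \<in> {1..?N}"
        using ij permutes_in_image[OF permutes_inv[OF \<rho>]] by blast+
      have "\<rho> ?p = i" "\<rho> ?q = j"
        by (simp_all add: permutes_inverses[OF \<rho>])
      then have z_pq: "z ! (?p - 1) = i" "z ! (?q - 1) = j"
        using pq by (auto simp: \<rho>_def)
      show "?p < ?q"
      proof (rule ccontr)
        assume "\<not> ?p < ?q"
        moreover have "?p \<noteq> ?q"
          using z_pq ij by auto
        ultimately have "?q - 1 < ?p - 1" "?p - 1 < length z"
          using pq len by auto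
        then have "j < i"
          using sorted_wrt_filter_nth[OF that, of "?q - 1" "?p - 1"] z_pq ij by auto
        then show False using ij by simp
      qed
    qed
    have "{x \<in> {1..?N}. x \<le> n} = {1..n}" "{x \<in> {1..?N}. \<not> x \<le> n} = {n + 1..n + m}"
      by auto
    then have "inv \<rho> \<in> shuffles_perm n m"
      using mono[of "\<lambda>x. x \<le> n"] mono[of "\<lambda>x. \<not> x \<le> n"] f1 f2 permutes_inv[OF \<rho>]
      by (simp add: shuffles_perm_def del: upt_Suc not_le)
    ultimately show "z \<in> (\<lambda>\<xi>. map (inv \<xi>) [1..<Suc ?N]) ` shuffles_perm n m"
      by (intro image_eqI[where x="inv \<rho>"]) auto
  qed
qed

text \<open>The sum over shuffle permutations becomes a sum over shuffles of two intervals of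
  positions; reading off the letters at these positions turns it into a sum over shuffles of
  words.\<close>

lemma ubp_star_bmap:
  assumes u: "u \<in> std_words n" and v: "v \<in> std_words m"
  shows "ubp_star (bmap u) (bmap v) = (\<Sum>z\<in>shuffles u (map (shift n) v). basis_vec (bmap z))"
proof -
  let ?w = "u @ map (shift n) v" and ?N = "n + m"
  let ?g = "\<lambda>j. ?w ! (j - 1)"
  have w: "?w \<in> std_words ?N" and disj: "set u \<inter> shift n ` set v = {}"
    using concat_in_std_words[OF u v] by auto
  have len: "length u = n" "length v = m"
    using u v by (auto simp: std_words_length)
  have size: "ubp_size (bmap u) = n" "ubp_size (bmap v) = m"
    using u v ubp_size_bmap len by (auto simp: std_words_def)
  have "ubp_star (bmap u) (bmap v) = (\<Sum>\<xi>\<in>shuffles_perm n m. basis_vec (ubp_comp (perm_ubp ?N \<xi>) (bmap ?w)))"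
    by (simp add: ubp_star_def size ubp_concat_bmap[OF u v] monoid_alg_mul_def shuffle_sum_def)
  also have "\<dots> = (\<Sum>\<xi>\<in>shuffles_perm n m. basis_vec (bmap (map ?g (map (inv \<xi>) [1..<Suc ?N]))))"
    by (intro sum.cong refl)
      (simp add: ubp_comp_perm_left[OF bmap_in_ubp[OF w]] map_prod_range_bmap[OF std_words_length[OF w]] shuffles_perm_def del: upt_Suc map_map)
  also have "\<dots> = (\<Sum>z\<in>shuffles [1..<Suc n] [Suc n..<Suc ?N]. basis_vec (bmap (map ?g z)))"
    by (rule sum.reindex_bij_betw[OF bij_betw_shuffles_perm])
  also have g: "map ?g [1..<Suc n] = u" "map ?g [Suc n..<Suc ?N] = map (shift n) v"
    by (auto intro!: nth_equalityI simp: len nth_append simp del: upt_Suc)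
  have "(\<Sum>z\<in>shuffles [1..<Suc n] [Suc n..<Suc ?N]. basis_vec (bmap (map ?g z)))
    = (\<Sum>z\<in>map ?g ` shuffles [1..<Suc n] [Suc n..<Suc ?N]. basis_vec (bmap z))"
  proof (subst sum.reindex)
    \<comment> \<open>Letters may repeat within one factor, but positions of different factors carry
      different letters. This suffices for reading off letters to be injective on shuffles.\<close>
    have "set (map ?g [1..<Suc n]) \<inter> set (map ?g [Suc n..<Suc ?N]) = {}"
      unfolding g using disj by simp
    then have *: "?g ` set [1..<Suc n] \<inter> ?g ` set [Suc n..<Suc ?N] = {}"
      by (simp only: set_map)
    show "inj_on (map ?g) (shuffles [1..<Suc n] [Suc n..<Suc ?N])"
      by (rule inj_onI) (rule inj_on_map_shuffles[OF *])
  qed (simp add: o_def del: upt_Suc)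
  also have "map ?g ` shuffles [1..<Suc n] [Suc n..<Suc ?N] = shuffles u (map (shift n) v)"
    unfolding map_shuffles g ..
  finally show ?thesis .
qed

section \<open>Breaking points and the coproduct\<close>

lemma breaking_points_bmap:
  assumes w: "w \<in> std_words n"
  shows "breaking_points (bmap w) = {i. i \<le> n \<and> (take i w, drop i w) \<in> cuts w}"
proof -
  have len: "length w = n"
    using w by (rule std_words_length)
  have size: "ubp_size (bmap w) = n"
    using w ubp_size_bmap len by (simp add: std_words_def)
  have "(\<exists>S\<subseteq>fib w ` set w. {1..i} = \<Union>S) \<longleftrightarrow> set (take i w) \<inter> set (drop i w) = {}" if i: "i \<le> n" for i
  proof
    assume "\<exists>S\<subseteq>fib w ` set w. {1..i} = \<Union>S"
    then obtain S where S: "S \<subseteq> fib w ` set w" "{1..i} = \<Union>S" by blast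
    show "set (take i w) \<inter> set (drop i w) = {}"
    proof (rule ccontr)
      assume "set (take i w) \<inter> set (drop i w) \<noteq> {}"
      then obtain A where "A \<in> set (take i w)" "A \<in> set (drop i w)" by auto
      \<comment> \<open>A letter on both sides of the cut has a fiber with one position up to
        \<open>i\<close> and one beyond it, which no union of fibers equal to \<open>{1..i}\<close>
        can contain.\<close>
      then obtain p q where pq: "p < i" "p < n" "w ! p = A" "q < n - i" "w ! (i + q) = A"
        by (auto simp: in_set_conv_nth len)
      then have "Suc p \<in> \<Union>S"
        unfolding S(2)[symmetric] by auto
      then obtain B where B: "Suc p \<in> fib w B" "fib w B \<in> S"
        using S(1) by auto
      then have "B = A"
        using pq by (simp add: fib_def)
      then have "Suc (i + q) \<in> fib w B"
        using pq i by (simp add: fib_def len)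
      then have "Suc (i + q) \<in> {1..i}"
        unfolding S(2) using B by auto
      then show False by simp
    qed
  next
    assume disj: "set (take i w) \<inter> set (drop i w) = {}"
    have "\<Union>(fib w ` set (take i w)) = {1..i}"
    proof (intro set_eqI iffI)
      fix j assume "j \<in> \<Union>(fib w ` set (take i w))"
      then have j: "w ! (j - 1) \<in> set (take i w)" "1 \<le> j" "j \<le> n"
        by (auto simp: fib_def len)
      have "w ! (j - 1) \<in> set (drop i w)" if "\<not> j \<le> i"
        unfolding in_set_conv_nth using that j i len
        by (intro exI[of _ "j - 1 - i"]) auto
      then show "j \<in> {1..i}"
        using j disj by auto
    next
      fix j assume j: "j \<in> {1..i}"
      then have "w ! (j - 1) \<in> set (take i w)"
        unfolding in_set_conv_nth using i len by (intro exI[of _ "j - 1"]) auto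
      moreover have "j \<in> fib w (w ! (j - 1))"
        using j i len by (intro conjunct1[OF in_fib]) auto
      ultimately show "j \<in> \<Union>(fib w ` set (take i w))"
        by blast
    qed
    then show "\<exists>S\<subseteq>fib w ` set w. {1..i} = \<Union>S"
      using set_take_subset[of i w] by (intro exI[of _ "fib w ` set (take i w)"]) auto
  qed
  then show ?thesis
    unfolding breaking_points_def size Range_bmap cuts_def
    by (simp add: conj_commute cong: conj_cong)
qed

text \<open>The shuffle is the inverse of the permutation that ranks the elements of the letters of
  \<open>u\<close> first and those of the letters of \<open>v\<close> after them. Being inverse to
  the ranks, it undoes standardization.\<close>

lemma ubp_split_exists:
  assumes w: "w \<in> std_words n" and uv: "(u, v) \<in> cuts w"
  shows "\<exists>\<xi>\<in>shuffles_perm (length u) (length v). w = map ((`) \<xi>) (std u @ map (shift (length u)) (std v))"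
proof -
  have bw: "block_word u" "block_word v"
    using cuts_block_word[OF uv] w by (auto simp: std_words_def)
  let ?U = "\<Union>(set u)" and ?V = "\<Union>(set v)" and ?i = "length u" and ?j = "length v"
  have fin: "finite ?U" "finite ?V"
    using bw by auto
  have card: "card ?U = ?i" "card ?V = ?j"
    using bw by (auto simp: block_word_length)
  have "A \<inter> B = {}" if "A \<in> set u" "B \<in> set v" for A B
  proof -
    have "A \<in> set w" "B \<in> set w" "A \<noteq> B" "disjoint (set w)"
      using that uv w by (auto simp: cuts_def std_words_def block_word_def)
    then show ?thesis
      by (intro disjointD)
  qed
  then have disj: "?U \<inter> ?V = {}" by auto
  have n: "n = ?i + ?j"
    using uv std_words_length[OF w] by (auto simp: cuts_def)
  have "w = u @ v" "\<Union>(set w) = {1..n}"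
    using uv w by (auto simp: cuts_def std_words_def)
  then have Un: "?U \<union> ?V = {1..n}"
    by (metis Union_Un_distrib set_append)
  define \<rho> where "\<rho> k = (if k \<in> ?U then rk ?U k else if k \<in> ?V then rk ?V k + ?i else k)" for k
  have \<rho>_U: "\<rho> k = rk ?U k" if "k \<in> ?U" for k
    using that by (simp add: \<rho>_def)
  have \<rho>_V: "\<rho> k = rk ?V k + ?i" if "k \<in> ?V" for k
    using that disj by (auto simp: \<rho>_def)
  have im_U: "\<rho> ` ?U = {1..?i}"
    using rk_image[OF fin(1)] \<rho>_U by (simp add: card)
  have "\<rho> ` ?V = (\<lambda>k. k + ?i) ` rk ?V ` ?V"
    using \<rho>_V by (simp add: image_image)
  also have "\<dots> = {?i + 1..?i + ?j}"
    unfolding rk_image[OF fin(2)] card image_add_atLeastAtMost'[of ?i 1 ?j] by (simp add: add.commute)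
  finally have im_V: "\<rho> ` ?V = {?i + 1..?i + ?j}" .
  have mono_U: "strict_mono_on ?U \<rho>"
    using rk_strict_mono[OF fin(1)] \<rho>_U by (auto simp: strict_mono_on_def)
  have mono_V: "strict_mono_on ?V \<rho>"
    using rk_strict_mono[OF fin(2)] \<rho>_V by (auto simp: strict_mono_on_def)
  have "inj_on \<rho> (?U \<union> ?V)"
  proof -
    have "\<rho> ` ?U \<inter> \<rho> ` ?V = {}"
      unfolding im_U im_V by auto
    then show ?thesis
      unfolding inj_on_Un using strict_mono_on_imp_inj_on[OF mono_U] strict_mono_on_imp_inj_on[OF mono_V]
      by blast
  qed
  moreover have "\<rho> ` {1..n} = {1..n}"
    unfolding Un[symmetric] image_Un im_U im_V unfolding Un n by auto
  ultimately have \<rho>: "\<rho> permutes {1..n}"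
    unfolding Un using Un by (intro bij_imp_permutes) (auto simp: bij_betw_def \<rho>_def)
  have mono_inv: "strict_mono_on (\<rho> ` T) (inv \<rho>)" if T: "strict_mono_on T \<rho>" for T
  proof (rule strict_mono_onI)
    fix a b assume "a \<in> \<rho> ` T" "b \<in> \<rho> ` T" "a < b"
    then show "inv \<rho> a < inv \<rho> b"
      using strict_mono_on_less[OF T] by (auto simp: permutes_inverses[OF \<rho>])
  qed
  have "inv \<rho> \<in> shuffles_perm ?i ?j"
    using mono_inv[OF mono_U] mono_inv[OF mono_V] permutes_inv[OF \<rho>]
    by (simp add: shuffles_perm_def im_U im_V n)
  moreover have "inv \<rho> ` rk ?U ` A = A" if "A \<in> set u" for A
  proof -
    have "inv \<rho> ` rk ?U ` A = (\<lambda>k. k) ` A"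
      unfolding image_image
    proof (intro image_cong refl)
      fix k assume "k \<in> A"
      then have "k \<in> ?U" using that by auto
      then show "inv \<rho> (rk ?U k) = k"
        using permutes_inverses(2)[OF \<rho>, of k] by (simp add: \<rho>_U)
    qed
    then show ?thesis by simp
  qed
  moreover have "inv \<rho> ` (\<lambda>k. k + ?i) ` rk ?V ` A = A" if "A \<in> set v" for A
  proof -
    have "inv \<rho> ` (\<lambda>k. k + ?i) ` rk ?V ` A = (\<lambda>k. k) ` A"
      unfolding image_image
    proof (intro image_cong refl)
      fix k assume "k \<in> A"
      then have "k \<in> ?V" using that by auto
      then show "inv \<rho> (rk ?V k + ?i) = k"
        using permutes_inverses(2)[OF \<rho>, of k] by (simp add: \<rho>_V)
    qed
    then show ?thesis by simp
  qed
  moreover have "w = u @ v"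
    using uv by (simp add: cuts_def)
  ultimately show ?thesis
    by (intro bexI[of _ "inv \<rho>"]) (auto simp: std_def shift_eq_image intro!: map_idI[symmetric])
qed

text \<open>Since \<open>ubp_split\<close> is defined by a unique description, uniqueness is part of
  the claim: any factorization relabels both factors increasingly, and standardization forgets such
  relabellings.\<close>

lemma ubp_split_bmap:
  assumes w: "w \<in> std_words n" and uv: "(u, v) \<in> cuts w"
  shows "ubp_split (bmap w) (length u) = (bmap (std u), bmap (std v))"
proof -
  have bw: "block_word u" "block_word v"
    using cuts_block_word[OF uv] w by (auto simp: std_words_def)
  let ?i = "length u" and ?j = "length v"
  have n: "n = ?i + ?j"
    using uv std_words_length[OF w] by (auto simp: cuts_def)
  have size: "ubp_size (bmap w) = n"
    using w ubp_size_bmap std_words_length[OF w] by (simp add: std_words_def)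
  have comp: "ubp_comp (ubp_concat (bmap a) (bmap b)) (perm_ubp n (inv \<xi>)) = bmap (map ((`) \<xi>) (a @ map (shift ?i) b))"
    if "a \<in> std_words ?i" "b \<in> std_words ?j" "\<xi> \<in> shuffles_perm ?i ?j" for a b \<xi>
  proof -
    have \<xi>: "\<xi> permutes {1..n}"
      using that by (simp add: shuffles_perm_def n)
    have c: "a @ map (shift ?i) b \<in> std_words n"
      using concat_in_std_words(1)[OF that(1,2)] by (simp add: n)
    show ?thesis
      unfolding ubp_concat_bmap[OF that(1,2)] ubp_comp_perm_right[OF bmap_in_ubp[OF c] permutes_inv[OF \<xi>]]
        inv_inv_eq[OF permutes_bij[OF \<xi>]]
      by (intro map_prod_dom_bmap inj_on_subset[OF permutes_inj[OF \<xi>]]) auto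
  qed
  show ?thesis
    unfolding ubp_split_def size
  proof (rule the_equality)
    obtain \<xi> where \<xi>: "\<xi> \<in> shuffles_perm ?i ?j" "w = map ((`) \<xi>) (std u @ map (shift ?i) (std v))"
      using ubp_split_exists[OF w uv] by blast
    then show "case (bmap (std u), bmap (std v)) of (g, h) \<Rightarrow> g \<in> ubp ?i \<and> h \<in> ubp (n - ?i) \<and>
      (\<exists>\<xi>\<in>shuffles_perm ?i (n - ?i). bmap w = ubp_comp (ubp_concat g h) (perm_ubp n (inv \<xi>)))"
      using comp[OF std_in_std_words[OF bw(1)] std_in_std_words[OF bw(2)] \<xi>(1)] bw
      by (auto simp: n bmap_in_ubp std_in_std_words)
  next
    fix p assume "case p of (g, h) \<Rightarrow> g \<in> ubp ?i \<and> h \<in> ubp (n - ?i) \<and>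
      (\<exists>\<xi>\<in>shuffles_perm ?i (n - ?i). bmap w = ubp_comp (ubp_concat g h) (perm_ubp n (inv \<xi>)))"
    then obtain a b \<xi> where p: "p = (bmap a, bmap b)" and ab: "a \<in> std_words ?i" "b \<in> std_words ?j"
      and \<xi>: "\<xi> \<in> shuffles_perm ?i ?j" "bmap w = ubp_comp (ubp_concat (bmap a) (bmap b)) (perm_ubp n (inv \<xi>))"
      by (auto simp: n ubp_eq_bmap)
    have "w = map ((`) \<xi>) (a @ map (shift ?i) b)"
    proof (rule bmap_eq_imp_eq)
      show "bmap w = bmap (map ((`) \<xi>) (a @ map (shift ?i) b))"
        unfolding \<xi>(2) by (rule comp[OF ab \<xi>(1)])
      show "length w = length (map ((`) \<xi>) (a @ map (shift ?i) b))"
        by (simp add: std_words_length[OF w] std_words_length[OF ab(1)] std_words_length[OF ab(2)] n)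
    qed
    moreover have "w = u @ v"
      using uv by (simp add: cuts_def)
    ultimately have "u @ v = map ((`) \<xi>) a @ map ((`) (\<lambda>k. \<xi> (k + ?i))) b"
      by (simp add: shift_def image_image o_def)
    moreover have "length u = length (map ((`) \<xi>) a)"
      using std_words_length[OF ab(1)] by simp
    ultimately have *: "u = map ((`) \<xi>) a" "v = map ((`) (\<lambda>k. \<xi> (k + ?i))) b"
      using append_eq_append_conv by blast+
    have U: "\<Union>(set a) = {1..?i}" "\<Union>(set b) = {1..?j}" and bab: "block_word a" "block_word b"
      using ab by (auto simp: std_words_def)
    have mono: "strict_mono_on {1..?i} \<xi>" "strict_mono_on {?i + 1..?i + ?j} \<xi>"
      using \<xi> by (auto simp: shuffles_perm_def)
    have "std u = std a"
      unfolding *(1) using mono U by (intro std_map bab) auto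
    moreover have "std v = std b"
      unfolding *(2) using mono(2) unfolding strict_mono_on_def by (intro std_map bab) (auto simp: U strict_mono_on_def)
    ultimately show "p = (bmap (std u), bmap (std v))"
      using ab by (simp add: p std_std_words)
  qed
qed

lemma ubp_coproduct_bmap:
  assumes w: "w \<in> std_words n"
  shows "ubp_coproduct (bmap w) = (\<Sum>p\<in>cuts w. basis_vec (basis_vec (bmap (std (fst p))), basis_vec (bmap (std (snd p)))))"
  unfolding ubp_coproduct_def breaking_points_bmap[OF w]
proof (rule sum.reindex_bij_witness[where i="\<lambda>p. length (fst p)" and j="\<lambda>i. (take i w, drop i w)"])
  fix i assume i: "i \<in> {i. i \<le> n \<and> (take i w, drop i w) \<in> cuts w}"
  then have len: "length (take i w) = i"
    using std_words_length[OF w] by simp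
  then show "length (fst (take i w, drop i w)) = i" by simp
  show "(take i w, drop i w) \<in> cuts w" using i by simp
  show "basis_vec (basis_vec (bmap (std (fst (take i w, drop i w)))), basis_vec (bmap (std (snd (take i w, drop i w)))))
     = basis_vec (basis_vec (fst (ubp_split (bmap w) i)), basis_vec (snd (ubp_split (bmap w) i)))"
    using ubp_split_bmap[OF w, of "take i w" "drop i w"] i len by simp
next
  fix p assume "p \<in> cuts w"
  then obtain u v where p: "p = (u, v)" "w = u @ v" "(u, v) \<in> cuts w"
    by (auto simp: cuts_def)
  then show "(take (length (fst p)) w, drop (length (fst p)) w) = p"
    by simp
  show "length (fst p) \<in> {i. i \<le> n \<and> (take i w, drop i w) \<in> cuts w}"
    using p std_words_length[OF w] by auto
qed

section \<open>The Hopf algebra of uniform block permutations\<close>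

definition SW :: "nat set list set" where
  "SW = (\<Union>n. std_words n)"

definition ew :: "nat set list \<Rightarrow> (blockmap \<Rightarrow>\<^sub>0 'k::comm_ring_1)" where
  "ew w = basis_vec (bmap w)"

definition Dw :: "nat set list \<Rightarrow> (nat set list \<times> nat set list \<Rightarrow>\<^sub>0 'k::comm_ring_1)" where
  "Dw w = (\<Sum>p\<in>cuts w. basis_vec (std (fst p), std (snd p)))"

lemma SW_iff: "w \<in> SW \<longleftrightarrow> w \<in> std_words (length w)"
  using std_words_length by (auto simp: SW_def)

lemma SW_block_word: "w \<in> SW \<Longrightarrow> block_word w"
  by (auto simp: SW_def std_words_def)

lemma Nil_in_SW [simp]: "[] \<in> SW"
  by (simp add: SW_iff std_words_0)

lemma std_in_SW: "block_word w \<Longrightarrow> std w \<in> SW"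
  using std_in_std_words by (auto simp: SW_def)

text \<open>The domain of the block map is the set of letters, which determines the length of the
  word.\<close>

lemma inj_on_bmap_SW: "inj_on bmap SW"
proof (rule inj_onI)
  fix w w' assume *: "w \<in> SW" "w' \<in> SW" "bmap w = bmap w'"
  then have "set w = set w'"
    by (metis Domain_bmap)
  then have "length w = length w'"
    using * by (simp add: block_word_length SW_block_word)
  then show "w = w'"
    using * by (intro bmap_eq_imp_eq)
qed

lemma bmap_Nil [simp]: "bmap [] = {}"
  by (simp add: bmap_def)

lemma bmap_eq_empty_iff [simp]: "bmap w = {} \<longleftrightarrow> w = []"
  by (simp add: bmap_def)

lemma ubp_carr: "carr ubp_hopf = {x. Poly_Mapping.keys x \<subseteq> bmap ` SW}"
  by (auto simp: ubp_hopf_def ubp_eq_bmap SW_def image_UN)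

lemma shuffles_in_std_words:
  assumes "u \<in> std_words n" "v \<in> std_words m" "z \<in> shuffles u (map (shift n) v)"
  shows "z \<in> std_words (n + m)"
proof -
  have u: "block_word u" "\<Union>(set u) = {1..n}" and v: "block_word v"
    using assms by (auto simp: std_words_def)
  have c: "u @ map (shift n) v \<in> std_words (n + m)"
    using concat_in_std_words[OF assms(1,2)] by simp
  have set_z: "set z = set (u @ map (shift n) v)"
    using set_shuffles[OF assms(3)] by simp
  have "a > n" if "a \<in> \<Union>(set (map (shift n) v))" for a
    using that assms(2) by (force simp: shift_def std_words_def)
  then have "\<Union>(set u) \<inter> \<Union>(set (map (shift n) v)) = {}"
    unfolding u by force
  then have "block_word z"
    by (intro block_word_shuffles[OF assms(3)] u block_word_map_shift v)
  then show ?thesis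
    using c by (simp only: std_words_def mem_Collect_eq set_z)
qed

lemma ew_carr [simp]: "w \<in> SW \<Longrightarrow> ew w \<in> carr ubp_hopf"
  by (auto simp: ubp_carr ew_def)

lemma mul_ew:
  assumes "u \<in> SW" "v \<in> SW"
  shows "mul ubp_hopf (ew u) (ew v) = (\<Sum>z\<in>shuffles u (map (shift (length u)) v). ew z)"
  using ubp_star_bmap[of u "length u" v "length v"] assms
  by (simp add: ubp_hopf_def ew_def SW_iff)

lemma mul_ubp_linear:
  "linear_on A fm_scale fm_scale (\<lambda>x. mul ubp_hopf x y)" "linear_on A fm_scale fm_scale (mul ubp_hopf x)"
  by (simp_all add: linear_on_def ubp_hopf_def fm.lin_ext_add_fun fm.lin_ext_scale_fun)

lemma mul_ubp_sum:
  "mul ubp_hopf (\<Sum>j\<in>J. f j) y = (\<Sum>j\<in>J. mul ubp_hopf (f j) y)"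
  "mul ubp_hopf x (\<Sum>j\<in>J. f j) = (\<Sum>j\<in>J. mul ubp_hopf x (f j))"
proof -
  have 0: "mul ubp_hopf 0 y = 0" for y
    by (simp add: ubp_hopf_def)
  have zero: "mul ubp_hopf y 0 = 0" for y
    by (simp add: ubp_hopf_def)
  have add: "mul ubp_hopf (x + x') y = mul ubp_hopf x y + mul ubp_hopf x' y"
    "mul ubp_hopf x (y + y') = mul ubp_hopf x y + mul ubp_hopf x y'" for x x' y y'
    by (simp_all add: ubp_hopf_def fm.lin_ext_add_fun)
  show "mul ubp_hopf (\<Sum>j\<in>J. f j) y = (\<Sum>j\<in>J. mul ubp_hopf (f j) y)"
    by (induction J rule: infinite_finite_induct) (simp_all add: 0 add)
  show "mul ubp_hopf x (\<Sum>j\<in>J. f j) = (\<Sum>j\<in>J. mul ubp_hopf x (f j))"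
    by (induction J rule: infinite_finite_induct) (simp_all add: zero add)
qed

lemma comul_ew: "w \<in> SW \<Longrightarrow> comul ubp_hopf (ew w) = (\<Sum>p\<in>cuts w. basis_vec (ew (std (fst p)), ew (std (snd p))))"
  using ubp_coproduct_bmap[of w "length w"] by (simp add: ubp_hopf_def ew_def SW_iff)

lemma Dw_ew: "lin_ext fm_scale (\<lambda>(a, b). basis_vec (ew a, ew b)) (Dw w) = (\<Sum>p\<in>cuts w. basis_vec (ew (std (fst p)), ew (std (snd p))))"
  by (simp add: Dw_def)

lemma mul_ew_assoc:
  assumes u: "u \<in> SW" and v: "v \<in> SW" and w: "w \<in> SW"
  shows "mul ubp_hopf (mul ubp_hopf (ew u) (ew v)) (ew w) = mul ubp_hopf (ew u) (mul ubp_hopf (ew v) (ew w))"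
proof -
  let ?n = "length u" and ?m = "length v"
  let ?v = "map (shift ?n) v" and ?w = "map (shift (?n + ?m)) w"
  have sw: "u \<in> std_words ?n" "v \<in> std_words ?m" "w \<in> std_words (length w)"
    using assms by (auto simp: SW_iff)
  \<comment> \<open>Shifting \<open>w\<close> past the first two factors can be done at once or in
    two steps; so both bracketings involve the same three words with disjoint letters.\<close>
  have w_eq: "?w = map (shift ?n) (map (shift ?m) w)"
    by (auto simp: shift_def image_image ac_simps)
  have "mul ubp_hopf (mul ubp_hopf (ew u) (ew v)) (ew w) = (\<Sum>z\<in>shuffles u ?v. mul ubp_hopf (ew z) (ew w))"
    by (simp add: mul_ew u v mul_ubp_sum)
  also have "\<dots> = (\<Sum>z\<in>shuffles u ?v. \<Sum>y\<in>shuffles z ?w. ew y)"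
  proof (intro sum.cong refl)
    fix z assume z: "z \<in> shuffles u ?v"
    then have z: "z \<in> std_words (?n + ?m)"
      using sw by (intro shuffles_in_std_words)
    then have "z \<in> SW"
      by (auto simp: SW_def)
    then show "mul ubp_hopf (ew z) (ew w) = (\<Sum>y\<in>shuffles z ?w. ew y)"
      using mul_ew[of z w] w std_words_length[OF z] by simp
  qed
  also have "\<dots> = (\<Sum>x\<in>shuffles ?v ?w. \<Sum>y\<in>shuffles u x. ew y)"
  proof (rule sum_shuffles_assoc)
    have vw: "v @ map (shift ?m) w \<in> std_words (?m + length w)" "set v \<inter> set (map (shift ?m) w) = {}"
      using concat_in_std_words[OF sw(2,3)] by auto
    have "set u \<inter> shift ?n ` set (v @ map (shift ?m) w) = {}"
      using concat_in_std_words(2)[OF sw(1) vw(1)] .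
    then show "set u \<inter> set ?v = {}" "set u \<inter> set ?w = {}"
      unfolding w_eq by (auto simp: image_Un)
    have "shift ?n ` set v \<inter> shift ?n ` set (map (shift ?m) w) = {}"
      using vw(2) by (subst image_Int[symmetric]) (auto intro: inj_shift)
    then show "set ?v \<inter> set ?w = {}"
      unfolding w_eq by (simp add: image_image)
  qed
  also have "\<dots> = (\<Sum>x\<in>shuffles v (map (shift ?m) w). \<Sum>y\<in>shuffles u (map (shift ?n) x). ew y)"
    unfolding w_eq map_shuffles[symmetric] by (subst sum.reindex) (auto intro: inj_on_subset[OF inj_mapI[OF inj_shift]])
  also have "\<dots> = (\<Sum>x\<in>shuffles v (map (shift ?m) w). mul ubp_hopf (ew u) (ew x))"
  proof (intro sum.cong refl)
    fix x assume "x \<in> shuffles v (map (shift ?m) w)"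
    then have "x \<in> SW"
      using shuffles_in_std_words[OF sw(2,3)] by (auto simp: SW_def)
    then show "(\<Sum>y\<in>shuffles u (map (shift ?n) x). ew y) = mul ubp_hopf (ew u) (ew x)"
      by (simp add: mul_ew u)
  qed
  also have "\<dots> = mul ubp_hopf (ew u) (mul ubp_hopf (ew v) (ew w))"
    by (simp add: mul_ew v w mul_ubp_sum)
  finally show ?thesis .
qed

text \<open>All regroupings of cuts and shuffles are equalities of formal sums. The relations enter
  only when a pure tensor of two products is expanded into the double sum over its shuffles.\<close>

lemma comul_mul_ew:
  assumes u: "u \<in> SW" and v: "v \<in> SW"
  shows "tensor2_eq ubp_hopf (comul ubp_hopf (mul ubp_hopf (ew u) (ew v)))
    (tensor2_mul ubp_hopf (\<Sum>p\<in>cuts u. basis_vec (ew (std (fst p)), ew (std (snd p))))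
       (\<Sum>p\<in>cuts v. basis_vec (ew (std (fst p)), ew (std (snd p)))) :: _ \<Rightarrow>\<^sub>0 'k::comm_ring_1)"
proof -
  let ?H = "ubp_hopf :: ('k, blockmap \<Rightarrow>\<^sub>0 'k) hopf"
  let ?G = "\<lambda>a b. basis_vec (ew a, ew b) :: (blockmap \<Rightarrow>\<^sub>0 'k) \<times> (blockmap \<Rightarrow>\<^sub>0 'k) \<Rightarrow>\<^sub>0 'k"
  let ?n = "length u"
  let ?v = "map (shift ?n) v"
  let ?S = "\<lambda>p a b. \<Sum>x\<in>shuffles (std (fst p)) (map (shift (length (fst p))) a).
        \<Sum>y\<in>shuffles (std (snd p)) (map (shift (length (snd p))) b). ?G x y"
  have sw: "u \<in> std_words ?n" "v \<in> std_words (length v)"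
    using assms by (auto simp: SW_iff)
  have bw: "block_word u" "block_word v" "block_word ?v"
    using assms by (auto simp: SW_block_word block_word_map_shift)
  have U: "\<Union>(set u) = {1..?n}"
    using sw by (simp add: std_words_def)
  have V: "a > ?n" if "a \<in> \<Union>(set ?v)" for a
    using that sw(2) by (force simp: shift_def std_words_def)
  have p_bw: "block_word (fst p)" "block_word (snd p)" if "p \<in> cuts u" for p
    using cuts_block_word[of "fst p" "snd p" u] bw that by simp_all
  have q_bw: "block_word (fst q)" "block_word (snd q)" if "q \<in> cuts v" for q
    using cuts_block_word[of "fst q" "snd q" v] bw that by simp_all
  have q'_bw: "block_word (fst q)" "block_word (snd q)" if "q \<in> cuts ?v" for q
    using cuts_block_word[of "fst q" "snd q" ?v] bw that by simp_all
  have "comul ?H (mul ?H (ew u) (ew v)) = (\<Sum>z\<in>shuffles u ?v. \<Sum>p\<in>cuts z. ?G (std (fst p)) (std (snd p)))"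
  proof -
    have "comul ?H (mul ?H (ew u) (ew v)) = (\<Sum>z\<in>shuffles u ?v. comul ?H (ew z))"
      by (simp add: mul_ew u v) (simp add: ubp_hopf_def)
    also have "\<dots> = (\<Sum>z\<in>shuffles u ?v. \<Sum>p\<in>cuts z. ?G (std (fst p)) (std (snd p)))"
      using shuffles_in_std_words[OF sw] by (intro sum.cong refl comul_ew) (auto simp: SW_def)
    finally show ?thesis .
  qed
  also have "\<dots> = (\<Sum>p\<in>cuts u. \<Sum>q\<in>cuts ?v. \<Sum>x\<in>shuffles (fst p) (fst q). \<Sum>y\<in>shuffles (snd p) (snd q). ?G (std x) (std y))"
    using concat_in_std_words(2)[OF sw]
    by (intro sum_cuts_shuffles[of _ _ "\<lambda>x y. ?G (std x) (std y)"]) simp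
  also have "\<dots> = (\<Sum>p\<in>cuts u. \<Sum>q\<in>cuts ?v. ?S p (std (fst q)) (std (snd q)))"
  proof (rule sum.cong[OF refl], rule sum.cong[OF refl])
    fix p q assume p: "p \<in> cuts u" and q: "q \<in> cuts ?v"
    \<comment> \<open>Elements in the letters of \<open>u\<close> are at most \<open>?n\<close> and
      those of the shifted \<open>v\<close> exceed it; hence the pieces satisfy the hypothesis under
      which standardization passes through shuffles.\<close>
    have less: "a < b" if "a \<in> \<Union>(set u)" "b \<in> \<Union>(set ?v)" for a b
      using that V[of b] unfolding U by auto
    have sub: "\<Union>(set (fst p)) \<subseteq> \<Union>(set u)" "\<Union>(set (snd p)) \<subseteq> \<Union>(set u)"
       "\<Union>(set (fst q)) \<subseteq> \<Union>(set ?v)" "\<Union>(set (snd q)) \<subseteq> \<Union>(set ?v)"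
    proof -
      have "set (fst p) \<subseteq> set u" "set (snd p) \<subseteq> set u"
        using p by (auto simp: cuts_def)
      then show "\<Union>(set (fst p)) \<subseteq> \<Union>(set u)" "\<Union>(set (snd p)) \<subseteq> \<Union>(set u)"
        by blast+
      have "set (fst q) \<union> set (snd q) = set ?v"
        using q unfolding cuts_def by (metis (mono_tags, lifting) case_prodE fst_conv mem_Collect_eq set_append snd_conv)
      then show "\<Union>(set (fst q)) \<subseteq> \<Union>(set ?v)" "\<Union>(set (snd q)) \<subseteq> \<Union>(set ?v)"
        by blast+
    qed
    have "(\<Sum>x\<in>shuffles (fst p) (fst q). \<Sum>y\<in>shuffles (snd p) (snd q). ?G (std x) (std y))
      = (\<Sum>x\<in>shuffles (fst p) (fst q). \<Sum>y\<in>shuffles (std (snd p)) (map (shift (length (snd p))) (std (snd q))). ?G (std x) y)"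
      by (rule sum.cong[OF refl], rule sum_shuffles_std[OF p_bw(2)[OF p] q'_bw(2)[OF q]])
         (rule less; use sub in blast)
    also have "\<dots> = ?S p (std (fst q)) (std (snd q))"
      by (rule sum_shuffles_std[OF p_bw(1)[OF p] q'_bw(1)[OF q]]) (rule less; use sub in blast)
    finally show "(\<Sum>x\<in>shuffles (fst p) (fst q). \<Sum>y\<in>shuffles (snd p) (snd q). ?G (std x) (std y)) = ?S p (std (fst q)) (std (snd q))" .
  qed
  \<comment> \<open>The shift of \<open>v\<close> is increasing, so it disappears once the pieces
    are standardized.\<close>
  also have "\<dots> = (\<Sum>p\<in>cuts u. \<Sum>q\<in>cuts v. ?S p (std (fst q)) (std (snd q)))"
    unfolding shift_eq_image[of ?n] by (intro sum.cong refl sum_cuts_map[OF bw(2) strict_mono_on_add])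
  finally have 1: "comul ?H (mul ?H (ew u) (ew v)) = (\<Sum>p\<in>cuts u. \<Sum>q\<in>cuts v. ?S p (std (fst q)) (std (snd q)))" .
  have 2: "tensor2_mul ?H (\<Sum>p\<in>cuts u. basis_vec (ew (std (fst p)), ew (std (snd p))))
       (\<Sum>p\<in>cuts v. basis_vec (ew (std (fst p)), ew (std (snd p))))
    = (\<Sum>p\<in>cuts u. \<Sum>q\<in>cuts v. basis_vec (mul ?H (ew (std (fst p))) (ew (std (fst q))), mul ?H (ew (std (snd p))) (ew (std (snd q)))))"
    by (simp add: tensor2_mul_def)
  let ?R = "multilinear_rels (scal ?H) (carr ?H) (slots2 (carr ?H))"
  have scal: "scal ?H = fm_scale"
    by (simp add: ubp_hopf_def)
  have sub: "fm.subspace ?R"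
    by (simp add: multilinear_rels_def)
  have carr_sub: "fm.subspace (carr ?H)"
    unfolding ubp_carr span_basis_vec[symmetric] by simp
  have "basis_vec (mul ?H (ew (std (fst p))) (ew (std (fst q))), mul ?H (ew (std (snd p))) (ew (std (snd q))))
      - ?S p (std (fst q)) (std (snd q)) \<in> ?R" if p: "p \<in> cuts u" and q: "q \<in> cuts v" for p q
  proof -
    have sw': "std (fst p) \<in> std_words (length (fst p))" "std (snd p) \<in> std_words (length (snd p))"
        "std (fst q) \<in> std_words (length (fst q))" "std (snd q) \<in> std_words (length (snd q))"
      using p_bw[OF p] q_bw[OF q] by (auto intro: std_in_std_words)
    have m: "mul ?H (ew (std (fst p))) (ew (std (fst q))) = (\<Sum>x\<in>shuffles (std (fst p)) (map (shift (length (fst p))) (std (fst q))). ew x)"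
      "mul ?H (ew (std (snd p))) (ew (std (snd q))) = (\<Sum>x\<in>shuffles (std (snd p)) (map (shift (length (snd p))) (std (snd q))). ew x)"
      using p_bw[OF p] q_bw[OF q] by (simp_all add: mul_ew std_in_SW)
    show ?thesis
      unfolding m scal
    proof (rule fm.tensor2_sum[OF carr_sub])
      show "ew x \<in> carr ?H" if "x \<in> shuffles (std (fst p)) (map (shift (length (fst p))) (std (fst q)))" for x
        using shuffles_in_std_words[OF sw'(1,3) that] by (intro ew_carr) (auto simp: SW_def)
      show "ew x \<in> carr ?H" if "x \<in> shuffles (std (snd p)) (map (shift (length (snd p))) (std (snd q)))" for x
        using shuffles_in_std_words[OF sw'(2,4) that] by (intro ew_carr) (auto simp: SW_def)
    qed auto
  qed
  then have "(\<Sum>p\<in>cuts u. \<Sum>q\<in>cuts v. ?S p (std (fst q)) (std (snd q)) -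
    basis_vec (mul ?H (ew (std (fst p))) (ew (std (fst q))), mul ?H (ew (std (snd p))) (ew (std (snd q))))) \<in> ?R"
    by (intro fm.subspace_sum sub) (metis fm.subspace_neg[OF sub] minus_diff_eq)
  then show ?thesis
    unfolding tensor2_eq_def 1 2 by (simp add: sum_subtractf)
qed

lemma hopf_basis_ubp:
  "hopf_basis (ubp_hopf :: ('k::comm_ring_1, blockmap \<Rightarrow>\<^sub>0 'k) hopf) SW ew [] length Dw"
proof (rule hopf_basis.intro)
  let ?H = "ubp_hopf :: ('k, blockmap \<Rightarrow>\<^sub>0 'k) hopf"
  have scal: "scal ?H = fm_scale"
    by (simp add: ubp_hopf_def)
  show "module (scal ?H)"
    by (simp add: scal module_fm_scale)
  have ew_image: "ew ` K = basis_vec ` bmap ` K" for K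
    by (auto simp: ew_def)
  show "carr ?H = module.span (scal ?H) (ew ` SW)"
    by (simp add: scal ew_image span_basis_vec ubp_carr)
  have SW_n: "{i \<in> SW. length i = n} = std_words n" for n
    by (auto simp: SW_iff std_words_length)
  show deg: "deg_part ?H n = module.span (scal ?H) (ew ` {i \<in> SW. length i = n})" for n
    unfolding scal ew_image span_basis_vec SW_n by (simp add: ubp_hopf_def ubp_eq_bmap)
  show "c = 0" if "Poly_Mapping.keys c \<subseteq> SW" "lin_ext (scal ?H) ew c = 0" for c
  proof (rule poly_mapping_eqI)
    fix i
    have "lin_ext fm_scale (\<lambda>j. basis_vec (bmap j)) c = (0 :: blockmap \<Rightarrow>\<^sub>0 'k)"
      using that(2) by (simp add: scal ew_def[abs_def])
    then show "Poly_Mapping.lookup c i = Poly_Mapping.lookup 0 i"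
      using lookup_lin_ext_inj[OF inj_on_bmap_SW that(1), of i] that(1)
      by (cases "i \<in> SW") (auto simp: in_keys_iff)
  qed
  show "[] \<in> SW" by simp
  show "one ?H = ew []"
    by (simp add: ubp_hopf_def ew_def)
  show "(length i = 0) = (i = [])" for i :: "nat set list" by simp
  show "linear_on (carr ?H) (scal ?H) (scal ?H) (\<lambda>x. mul ?H x y)" "linear_on (carr ?H) (scal ?H) (scal ?H) (mul ?H x)" for x y
    unfolding scal by (rule mul_ubp_linear)+
  show "mul ?H (ew i) (ew j) \<in> deg_part ?H (length i + length j)" if "i \<in> SW" "j \<in> SW" for i j
  proof -
    have "z \<in> std_words (length i + length j)" if "z \<in> shuffles i (map (shift (length i)) j)" for z
      using that \<open>i \<in> SW\<close> \<open>j \<in> SW\<close> by (intro shuffles_in_std_words[of i _ j]) (auto simp: SW_iff)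
    then show ?thesis
      unfolding mul_ew[OF that] deg SW_n scal by (intro fm.span_sum fm.span_base) auto
  qed
  show "mul ?H (mul ?H (ew i) (ew j)) (ew k) = mul ?H (ew i) (mul ?H (ew j) (ew k))"
    if "i \<in> SW" "j \<in> SW" "k \<in> SW" for i j k
    using that by (rule mul_ew_assoc)
  \<comment> \<open>The empty word has length 0, so multiplying by it from the left shifts
    nothing.\<close>
  have "shift 0 = id"
    by (auto simp: shift_def)
  then show "mul ?H (ew []) (ew i) = ew i" "mul ?H (ew i) (ew []) = ew i" if "i \<in> SW" for i
    using that by (simp_all add: mul_ew)
  show "linear_on (carr ?H) (scal ?H) (*) (counit ?H)"
    by (simp add: linear_on_def ubp_hopf_def lookup_add)
  show "counit ?H (ew i) = (if i = [] then 1 else 0)" for i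
    by (simp add: ubp_hopf_def ew_def lookup_single when_def)
  show "Poly_Mapping.keys (comul ?H x) \<subseteq> carr ?H \<times> carr ?H" if "x \<in> carr ?H" for x
  proof -
    have "Poly_Mapping.keys (ubp_coproduct f) \<subseteq> carr ?H \<times> carr ?H" if "f \<in> Poly_Mapping.keys x" for f
    proof -
      obtain w where w: "w \<in> SW" "f = bmap w"
        using \<open>x \<in> carr ?H\<close> \<open>f \<in> Poly_Mapping.keys x\<close> by (auto simp: ubp_carr)
      have bw: "block_word (fst p)" "block_word (snd p)" if "p \<in> cuts w" for p
        using cuts_block_word[of "fst p" "snd p" w] SW_block_word[OF w(1)] that by simp_all
      have "ubp_coproduct f = comul ?H (ew w)"
        by (simp add: ubp_hopf_def ew_def w)
      also have "\<dots> = (\<Sum>p\<in>cuts w. basis_vec (ew (std (fst p)), ew (std (snd p))))"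
        by (rule comul_ew[OF w(1)])
      finally show ?thesis
        using bw by (auto intro!: order.trans[OF keys_sum] ew_carr std_in_SW)
    qed
    moreover have "comul ?H x = lin_ext fm_scale ubp_coproduct x"
      by (simp add: ubp_hopf_def)
    ultimately show ?thesis
      using order.trans[OF keys_lin_ext UN_least] by metis
  qed
  have rels_0: "0 \<in> multilinear_rels (scal ?H) (carr ?H) (slots2 (carr ?H))"
    by (simp add: multilinear_rels_def fm.span_zero)
  show "lin_mod (carr ?H) (scal ?H) fm_scale (multilinear_rels (scal ?H) (carr ?H) (slots2 (carr ?H))) (comul ?H)"
    by (intro lin_mod_linear_on rels_0) (simp add: ubp_hopf_def linear_on_lin_ext_id module_fm_scale)
  show "tensor2_eq ?H (comul ?H (ew i)) (lin_ext fm_scale (\<lambda>(a, b). basis_vec (ew a, ew b)) (Dw i))" if "i \<in> SW" for i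
    by (simp add: tensor2_eq_def comul_ew that Dw_ew rels_0)
  show "a \<in> SW \<and> b \<in> SW \<and> length a + length b = length i"
    if "i \<in> SW" "(a, b) \<in> Poly_Mapping.keys (Dw i :: _ \<Rightarrow>\<^sub>0 'k)" for a b i
  proof -
    have "(a, b) \<in> (\<Union>p\<in>cuts i. {(std (fst p), std (snd p))})"
      using that(2) keys_sum[of "\<lambda>p. basis_vec (std (fst p), std (snd p))" "cuts i"] unfolding Dw_def by fastforce
    then obtain u v where uv: "(u, v) \<in> cuts i" "a = std u" "b = std v"
      by auto
    then show ?thesis
      using cuts_block_word[OF uv(1) SW_block_word[OF that(1)]] by (auto simp: cuts_def std_in_SW)
  qed
  show "lin_ext fm_scale (\<lambda>(a, b). lin_ext fm_scale (\<lambda>(a1, a2). basis_vec (a1, a2, b)) (Dw a)) (Dw i)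
     = (lin_ext fm_scale (\<lambda>(a, b). lin_ext fm_scale (\<lambda>(b1, b2). basis_vec (a, b1, b2)) (Dw b)) (Dw i) :: _ \<Rightarrow>\<^sub>0 'k)"
    if "i \<in> SW" for i
    using coassoc_cuts[OF SW_block_word[OF that], of "\<lambda>a b c. basis_vec (a, b, c)"] by (simp add: Dw_def)
  show "lin_ext fm_scale (\<lambda>(a, b). if a = [] then basis_vec b else 0) (Dw i) = (basis_vec i :: _ \<Rightarrow>\<^sub>0 'k)" if "i \<in> SW" for i
  proof -
    have "(\<Sum>p\<in>cuts i. if fst p = [] then basis_vec (std (snd p)) else (0 :: _ \<Rightarrow>\<^sub>0 'k)) = (\<Sum>p\<in>{([] :: nat set list, i)}. basis_vec (std (snd p)))"
      by (rule sum.mono_neutral_cong_right[OF finite_cuts]) (auto simp: cuts_def)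
    then show ?thesis
      using that std_std_words[of i] by (simp add: Dw_def SW_iff)
  qed
  show "lin_ext fm_scale (\<lambda>(a, b). if b = [] then basis_vec a else 0) (Dw i) = (basis_vec i :: _ \<Rightarrow>\<^sub>0 'k)" if "i \<in> SW" for i
  proof -
    have "(\<Sum>p\<in>cuts i. if snd p = [] then basis_vec (std (fst p)) else (0 :: _ \<Rightarrow>\<^sub>0 'k)) = (\<Sum>p\<in>{(i, [] :: nat set list)}. basis_vec (std (fst p)))"
      by (rule sum.mono_neutral_cong_right[OF finite_cuts]) (auto simp: cuts_def)
    then show ?thesis
      using that std_std_words[of i] by (simp add: Dw_def SW_iff)
  qed
  show "tensor2_eq ?H (comul ?H (mul ?H (ew i) (ew j)))
      (tensor2_mul ?H (lin_ext fm_scale (\<lambda>(a, b). basis_vec (ew a, ew b)) (Dw i)) (lin_ext fm_scale (\<lambda>(a, b). basis_vec (ew a, ew b)) (Dw j)))"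
    if "i \<in> SW" "j \<in> SW" for i j
    unfolding Dw_ew by (rule comul_mul_ew[OF that])
qed

interpretation P: hopf_basis ubp_hopf SW ew "[]" length Dw
  by (rule hopf_basis_ubp)

section \<open>Isomorphisms\<close>

text \<open>Degrees and coproduct constants are shared through the parameters \<open>d\<close> and
  \<open>D\<close>. The constants of the product are not parameters of \<open>hopf_basis\<close>, so
  their agreement is an assumption of its own.\<close>

locale hopf_basis_pair =
  H: hopf_basis H I e i0 d D + K: hopf_basis K I e' i0 d D
  for H :: "('k::comm_ring_1, 'a::ab_group_add) hopf" and K :: "('k, 'b::ab_group_add) hopf"
    and I :: "'i set" and e :: "'i \<Rightarrow> 'a" and e' :: "'i \<Rightarrow> 'b" and i0 d D +
  assumes mul_const: "i \<in> I \<Longrightarrow> j \<in> I \<Longrightarrow> \<exists>c. Poly_Mapping.keys c \<subseteq> I \<and>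
    mul H (e i) (e j) = lin_ext (scal H) e c \<and> mul K (e' i) (e' j) = lin_ext (scal K) e' c"
begin

definition iso :: "'a \<Rightarrow> 'b" where
  "iso = H.free.extend (scal K) e'"

lemma iso_lin_ext: "Poly_Mapping.keys c \<subseteq> I \<Longrightarrow> iso (lin_ext (scal H) e c) = lin_ext (scal K) e' c"
  by (simp add: iso_def H.free.extend_lin_ext)

lemma iso_basis: "i \<in> I \<Longrightarrow> iso (e i) = e' i"
  by (simp add: iso_def H.free.extend_basis K.module_scal)

lemma iso_lin: "linear_on (carr H) (scal H) (scal K) iso"
  unfolding iso_def by (rule H.extend_linear_on[OF K.module_scal])

lemma iso_image_span: "J \<subseteq> I \<Longrightarrow> iso ` module.span (scal H) (e ` J) = module.span (scal K) (e' ` J)"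
  unfolding H.free.span_eq_lin_ext_image K.free.span_eq_lin_ext_image image_image
  by (intro image_cong refl iso_lin_ext) auto

lemma iso_carr [simp]: "x \<in> carr H \<Longrightarrow> iso x \<in> carr K"
  using iso_image_span[of I] by (auto simp: H.carr_eq K.carr_eq)

lemma iso_bij: "bij_betw iso (carr H) (carr K)"
proof (rule bij_betw_imageI)
  show "inj_on iso (carr H)"
  proof (rule inj_onI)
    fix x y assume "x \<in> carr H" "y \<in> carr H" "iso x = iso y"
    moreover then obtain c c' where "x = lin_ext (scal H) e c" "Poly_Mapping.keys c \<subseteq> I"
      "y = lin_ext (scal H) e c'" "Poly_Mapping.keys c' \<subseteq> I"
      by (metis H.carrE)
    ultimately show "x = y"
      using K.free.basis_inj[of c c'] by (simp add: iso_lin_ext)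
  qed
  show "iso ` carr H = carr K"
    using iso_image_span[of I] by (simp add: H.carr_eq K.carr_eq)
qed

lemma iso_mul_hom:
  assumes "x \<in> carr H" "y \<in> carr H"
  shows "iso (mul H x y) = mul K (iso x) (iso y)"
proof -
  have comp: "linear_on (carr H) (scal H) (scal K) (\<lambda>x. F (iso x))" if "linear_on (carr K) (scal K) (scal K) F" for F
    using that iso_lin by (auto simp: linear_on_def)
  have 1: "iso (mul H (e i) (e j)) = mul K (iso (e i)) (iso (e j))" if "i \<in> I" "j \<in> I" for i j
    using mul_const[OF that] that by (auto simp: iso_basis iso_lin_ext)
  have 2: "iso (mul H x (e j)) = mul K (iso x) (iso (e j))" if "j \<in> I" "x \<in> carr H" for x j
    by (rule H.eq_on_carr[OF K.module_scal H.linear_on_mul_left[where f=iso]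
          comp[of "\<lambda>x. mul K x (iso (e j))"] _ that(2)])
      (simp_all add: that iso_lin K.mul_left 1)
  show ?thesis
    by (rule H.eq_on_carr[OF K.module_scal H.linear_on_mul_right[where f=iso]
          comp[of "mul K (iso x)"] _ assms(2)])
      (simp_all add: assms iso_lin K.mul_right 2)
qed

text \<open>Shows that the map induced by \<open>iso\<close> on pairs is well defined on
  tensors.\<close>

lemma iso_rels:
  assumes "x \<in> H.rels2"
  shows "lin_ext fm_scale (\<lambda>(a, b). basis_vec (iso a, iso b)) x \<in> K.rels2"
proof (rule H.tensor2_map[OF module_fm_scale K.subspace_rels _ _ assms])
  have comp: "lin_mod (carr H) (scal H) fm_scale K.rels2 (\<lambda>x. F (iso x))" if "lin_mod (carr K) (scal K) fm_scale K.rels2 F" for F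
    using that iso_lin by (auto simp: lin_mod_def linear_on_def)
  fix b assume "b \<in> carr H"
  then show "lin_mod (carr H) (scal H) fm_scale K.rels2 (\<lambda>x. case (x, b) of (a, b) \<Rightarrow> basis_vec (iso a, iso b))"
    "lin_mod (carr H) (scal H) fm_scale K.rels2 (\<lambda>x. case (b, x) of (a, b) \<Rightarrow> basis_vec (iso a, iso b))"
    unfolding prod.case
    by (intro comp[of "\<lambda>x. basis_vec (x, iso b)"] comp[of "\<lambda>x. basis_vec (iso b, x)"] K.slot2_lin_mod iso_carr; assumption)+
qed

lemma iso_comul:
  assumes "x \<in> carr H"
  shows "tensor2_eq K (lin_ext fm_scale (\<lambda>(a, b). basis_vec (iso a, iso b)) (comul H x)) (comul K (iso x))"
  unfolding tensor2_eq_def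
proof (rule H.eq_mod_on_carr[OF module_fm_scale K.subspace_rels _ _ _ assms])
  let ?L = "lin_ext fm_scale (\<lambda>(a, b). basis_vec (iso a, iso b))"
  show "lin_mod (carr H) (scal H) fm_scale K.rels2 (\<lambda>x. ?L (comul H x))"
    by (intro lin_mod_comp_lin_ext[OF module_fm_scale H.comul_lin_mod] iso_rels)
  show "lin_mod (carr H) (scal H) fm_scale K.rels2 (\<lambda>x. comul K (iso x))"
    using K.comul_lin_mod iso_lin by (auto simp: lin_mod_def linear_on_def)
  fix i assume i: "i \<in> I"
  have "?L (comul H (e i) - H.De i) \<in> K.rels2"
    using H.comul_basis[OF i] by (intro iso_rels) (simp add: tensor2_eq_def H.De_def)
  moreover have "?L (H.De i) = K.De i"
    unfolding H.De_def K.De_def fm.lin_ext_lin_ext using H.D_keys[OF i]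
    by (intro fm.lin_ext_cong) (auto simp: iso_basis)
  moreover have "comul K (e' i) - K.De i \<in> K.rels2"
    using K.comul_basis[OF i] by (simp add: tensor2_eq_def K.De_def)
  ultimately have "(?L (comul H (e i)) - K.De i) - (comul K (e' i) - K.De i) \<in> K.rels2"
    by (metis fm.subspace_diff[OF K.subspace_rels] fm.lin_ext_diff)
  then show "?L (comul H (e i)) - comul K (iso (e i)) \<in> K.rels2"
    by (simp add: iso_basis i)
qed

text \<open>Both antipodes obey the recursion of \<open>antipode_rec\<close>, and \<open>iso\<close>
  carries one recursion into the other because it is multiplicative.\<close>

lemma iso_antipode:
  assumes S: "is_antipode H S" and T: "is_antipode K T" and x: "x \<in> carr H"
  shows "iso (S x) = T (iso x)"
proof -
  have S_in: "S ` carr H \<subseteq> carr H" and S_lin: "linear_on (carr H) (scal H) (scal H) S"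
    and T_in: "T ` carr K \<subseteq> carr K" and T_lin: "linear_on (carr K) (scal K) (scal K) T"
    using S T by (auto simp: is_antipode_def)
  have "iso (S (e i)) = T (e' i)" if "i \<in> I" for i
    using that
  proof (induction "d i" arbitrary: i rule: less_induct)
    case less
    show ?case
    proof (cases "i = i0")
      case True
      then show ?thesis
        by (simp add: H.antipode_one[OF S] K.antipode_one[OF T] iso_basis H.i0_in)
    next
      case False
      let ?F = "\<lambda>(a, b). if d a < d i then mul H (S (e a)) (e b) else 0"
      have F: "?F p \<in> carr H" if "p \<in> Poly_Mapping.keys (D i)" for p
      proof -
        obtain a b where p: "p = (a, b)" by (cases p)
        have ab: "a \<in> I" "b \<in> I"
          using H.D_keys[OF less.prems] that p by blast+
        then have "mul H (S (e a)) (e b) \<in> carr H"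
          using S_in by (intro H.mul_in) auto
        then show ?thesis
          using H.free.subspace_0[OF H.carr_subspace] by (simp add: p)
      qed
      \<comment> \<open>\<open>linear_on\<close> speaks of sums and multiples only, so a negative is
        treated as the multiple by -1.\<close>
      have neg: "iso (- y) = - iso y" if "y \<in> carr H" for y
      proof -
        have "iso (scal H (- 1) y) = scal K (- 1) (iso y)"
          using iso_lin that unfolding linear_on_def by blast
        then show ?thesis by simp
      qed
      have iso_0: "iso 0 = 0"
        using iso_lin_ext[of 0] by simp
      have "iso (lin_ext (scal H) ?F (D i)) = lin_ext (scal K) (\<lambda>p. iso (?F p)) (D i)"
        by (rule H.free.linear_on_lin_ext[OF K.module_scal H.carr_subspace iso_lin F])
      also have "\<dots> = lin_ext (scal K) (\<lambda>(a, b). if d a < d i then mul K (T (e' a)) (e' b) else 0) (D i)"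
      proof (intro K.free.lin_ext_cong refl)
        fix p assume p: "p \<in> Poly_Mapping.keys (D i)"
        obtain a b where ab: "p = (a, b)" by (cases p)
        then have "a \<in> I" "b \<in> I"
          using H.D_keys[OF less.prems] p by blast+
        moreover then have "S (e a) \<in> carr H"
          using S_in by auto
        ultimately show "iso (?F p) = (case p of (a, b) \<Rightarrow> if d a < d i then mul K (T (e' a)) (e' b) else 0)"
          using less.hyps[of a] by (simp add: ab iso_mul_hom iso_basis iso_0)
      qed
      finally show ?thesis
        unfolding H.antipode_rec[OF S less.prems False] K.antipode_rec[OF T less.prems False]
        using neg[OF H.free.lin_ext_in_subspace[OF H.carr_subspace F, of "D i"]] by simp
    qed
  qed
  then have *: "iso (S (e i)) = T (iso (e i))" if "i \<in> I" for i
    using that by (simp add: iso_basis)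
  show ?thesis
  proof (rule H.eq_on_carr[where F="\<lambda>x. iso (S x)" and G="\<lambda>x. T (iso x)", OF K.module_scal _ _ * x])
    show "linear_on (carr H) (scal H) (scal K) (\<lambda>x. iso (S x))"
      using S_in S_lin iso_lin by (auto simp: linear_on_def image_subset_iff)
    show "linear_on (carr H) (scal H) (scal K) (\<lambda>x. T (iso x))"
      using T_lin iso_lin by (auto simp: linear_on_def)
  qed
qed

theorem graded_hopf_iso: "graded_hopf_iso H K iso"
proof -
  interpret GH: graded_hopf_algebra H by (rule H.graded_hopf)
  interpret GK: graded_hopf_algebra K by (rule K.graded_hopf)
  have counit: "counit K (iso x) = counit H x" if "x \<in> carr H" for x
  proof (rule H.eq_on_carr[OF H.counit_in_UNIV _ H.counit_lin _ that])
    show "linear_on (carr H) (scal H) (*) (\<lambda>x. counit K (iso x))"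
      using K.counit_lin iso_lin by (auto simp: linear_on_def)
  qed (simp add: iso_basis H.counit_basis K.counit_basis)
  have deg: "iso ` deg_part H n = deg_part K n" for n
    unfolding H.deg_part_eq K.deg_part_eq by (rule iso_image_span) auto
  show ?thesis
    by unfold_locales
      (simp_all add: iso_lin iso_bij iso_mul_hom iso_comul counit iso_antipode deg H.one_eq K.one_eq iso_basis H.i0_in)
qed

end

section \<open>Set partitions\<close>

text \<open>The size \<open>n\<close> can be read off from the union of the blocks, which removes
  the existential quantifier over it.\<close>

lemma set_partitions_iff: "A \<in> set_partitions \<longleftrightarrow> partition_on {1..card (\<Union>A)} A"
proof
  assume "A \<in> set_partitions"
  then obtain n where A: "partition_on {1..n} A"
    by (auto simp: set_partitions_def)
  then have "\<Union>A = {1..n}"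
    by (simp add: partition_on_def)
  then show "partition_on {1..card (\<Union>A)} A"
    using A by simp
qed (auto simp: set_partitions_def)

lemma set_partitions_Union: "A \<in> set_partitions \<Longrightarrow> \<Union>A = {1..card (\<Union>A)}"
  by (simp add: set_partitions_iff partition_on_def)

lemma set_partitions_finite: "A \<in> set_partitions \<Longrightarrow> finite A"
  by (metis finite_UnionD finite_atLeastAtMost set_partitions_Union)

lemma set_partitions_finite_Union: "A \<in> set_partitions \<Longrightarrow> finite (\<Union>A)"
  by (metis finite_atLeastAtMost set_partitions_Union)

lemma empty_in_set_partitions [simp]: "{} \<in> set_partitions"
  by (simp add: set_partitions_iff partition_on_def)

lemma partition_on_card: "partition_on {1..n} A \<Longrightarrow> card (\<Union>A) = n"
  by (simp add: partition_on_def)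

lemma part_std_eq_image: "part_std S = (`) (rk (\<Union>S)) ` S"
  by (simp add: part_std_def rk_def[abs_def])

lemma part_std_empty_iff [simp]: "part_std S = {} \<longleftrightarrow> S = {}"
  by (simp add: part_std_eq_image)

lemma Union_part_std: "finite (\<Union>S) \<Longrightarrow> \<Union>(part_std S) = {1..card (\<Union>S)}"
  unfolding part_std_eq_image image_Union[symmetric] by (rule rk_image)

lemma card_Union_part_std: "finite (\<Union>S) \<Longrightarrow> card (\<Union>(part_std S)) = card (\<Union>S)"
  by (simp add: Union_part_std)

lemma part_std_in:
  assumes "A \<in> set_partitions" "S \<subseteq> A" shows "part_std S \<in> set_partitions"
proof -
  have fin: "finite (\<Union>S)"
    using finite_subset[OF Union_mono[OF assms(2)] set_partitions_finite_Union[OF assms(1)]] .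
  have A: "disjoint A" "{} \<notin> A"
    using assms(1) by (auto simp: set_partitions_iff partition_on_def)
  have "disjoint (part_std S)"
    unfolding part_std_eq_image using A assms(2) by (intro disjoint_image rk_inj fin) (auto intro: pairwise_subset)
  moreover have "{} \<notin> part_std S"
    using A assms(2) by (auto simp: part_std_eq_image)
  ultimately show ?thesis
    unfolding set_partitions_iff partition_on_def card_Union_part_std[OF fin] using Union_part_std[OF fin] by simp
qed

lemma part_std_map:
  assumes "finite (\<Union>S)" "strict_mono_on (\<Union>S) \<phi>"
  shows "part_std ((`) \<phi> ` S) = part_std S"
proof -
  have "rk (\<phi> ` \<Union>S) ` \<phi> ` A = rk (\<Union>S) ` A" if "A \<in> S" for A
    unfolding image_image using that assms by (intro image_cong refl rk_comp) auto
  moreover have "\<Union>((`) \<phi> ` S) = \<phi> ` \<Union>S"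
    by auto
  ultimately show ?thesis
    unfolding part_std_eq_image by (simp add: image_comp cong: image_cong)
qed

lemma part_std_self: assumes "A \<in> set_partitions" shows "part_std A = A"
proof -
  have "rk (\<Union>A) ` B = id ` B" if "B \<in> A" for B
  proof (intro image_cong refl)
    fix j assume "j \<in> B"
    then have "j \<in> {1..card (\<Union>A)}"
      using that set_partitions_Union[OF assms] by blast
    then show "rk (\<Union>A) j = id j"
      using rk_interval[of j "card (\<Union>A)"] set_partitions_Union[OF assms] by simp
  qed
  then show ?thesis
    by (simp add: part_std_eq_image)
qed

text \<open>Subsets of \<open>S\<close> correspond to subsets of its standardization, and a second
  standardization changes nothing. It plays the part that \<open>sum_cuts_std\<close> plays for
  words.\<close>

lemma sum_Pow_part_std:
  fixes F :: "nat set set \<Rightarrow> nat set set \<Rightarrow> 'm::comm_monoid_add"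
  assumes fin: "finite (\<Union>S)"
  shows "(\<Sum>T\<in>Pow (part_std S). F (part_std T) (part_std (part_std S - T))) = (\<Sum>T\<in>Pow S. F (part_std T) (part_std (S - T)))"
proof -
  let ?f = "(`) (rk (\<Union>S))"
  have inj: "inj_on ?f S"
    by (intro inj_on_image rk_inj fin)
  have std: "part_std (?f ` T) = part_std T" if "T \<subseteq> S" for T
    using finite_subset[OF Union_mono[OF that] fin] monotone_on_subset[OF rk_strict_mono[OF fin] Union_mono[OF that]]
    by (intro part_std_map)
  have "Pow (part_std S) = (`) ?f ` Pow S"
    by (simp add: part_std_eq_image image_Pow_surj)
  then have "(\<Sum>T\<in>Pow (part_std S). F (part_std T) (part_std (part_std S - T)))
    = (\<Sum>T\<in>Pow S. F (part_std (?f ` T)) (part_std (part_std S - ?f ` T)))"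
    by (simp add: sum.reindex[OF inj_on_image_Pow[OF inj]] o_def)
  also have "\<dots> = (\<Sum>T\<in>Pow S. F (part_std T) (part_std (S - T)))"
  proof (intro sum.cong refl)
    fix T assume T: "T \<in> Pow S"
    then have "part_std S - ?f ` T = ?f ` (S - T)"
      unfolding part_std_eq_image[of S] using inj_on_image_set_diff[OF inj, of S T] by auto
    then show "F (part_std (?f ` T)) (part_std (part_std S - ?f ` T)) = F (part_std T) (part_std (S - T))"
      using T by (simp add: std)
  qed
  finally show ?thesis .
qed

text \<open>Both sides run over the ordered decompositions of \<open>A\<close> into three disjoint
  parts.\<close>

lemma sum_Pow_assoc:
  fixes F :: "'a set \<Rightarrow> 'a set \<Rightarrow> 'a set \<Rightarrow> 'm::comm_monoid_add"
  assumes "finite A"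
  shows "(\<Sum>S\<in>Pow A. \<Sum>T\<in>Pow S. F T (S - T) (A - S)) = (\<Sum>S\<in>Pow A. \<Sum>T\<in>Pow (A - S). F S T (A - S - T))"
proof -
  have fin: "\<forall>S\<in>Pow A. finite (Pow S)" "\<forall>S\<in>Pow A. finite (Pow (A - S))"
    using assms finite_subset by (auto simp: finite_subset[OF _ assms])
  show ?thesis
    unfolding sum.Sigma[OF finite_Pow_iff[THEN iffD2, OF assms] fin(1)] sum.Sigma[OF finite_Pow_iff[THEN iffD2, OF assms] fin(2)]
    by (rule sum.reindex_bij_witness[where i="\<lambda>(S, T). (S \<union> T, S)" and j="\<lambda>(S, T). (T, S - T)"])
      (auto simp: Diff_Diff_Int intro!: arg_cong3[where f=F])
qed

section \<open>Concatenation of set partitions and the common structure constants\<close>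

definition part_concat :: "nat set set \<Rightarrow> nat set set \<Rightarrow> nat set set" where
  "part_concat A B = A \<union> shift (card (\<Union>A)) ` B"

lemma Union_shift_image: "\<Union>(shift n ` B) = (\<lambda>a. a + n) ` \<Union>B"
  by (auto simp: shift_def)

lemma part_concat_props:
  assumes A: "A \<in> set_partitions" and B: "B \<in> set_partitions"
  shows "part_concat A B \<in> set_partitions"
    and "card (\<Union>(part_concat A B)) = card (\<Union>A) + card (\<Union>B)"
    and "A \<inter> shift (card (\<Union>A)) ` B = {}"
proof -
  let ?n = "card (\<Union>A)" and ?m = "card (\<Union>B)"
  have UA: "\<Union>A = {1..?n}" and UB: "\<Union>B = {1..?m}"
    using set_partitions_Union[OF A] set_partitions_Union[OF B] .
  have Us: "\<Union>(shift ?n ` B) = {?n + 1..?n + ?m}"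
    unfolding Union_shift_image by (subst UB) (simp add: add.commute)
  have disj: "\<Union>A \<inter> \<Union>(shift ?n ` B) = {}"
    unfolding Us by (subst UA) auto
  have U: "\<Union>(part_concat A B) = {1..?n + ?m}"
    unfolding part_concat_def Union_Un_distrib Us by (subst UA) auto
  show c: "card (\<Union>(part_concat A B)) = ?n + ?m"
    unfolding U by simp
  have pA: "disjoint A" "{} \<notin> A" and pB: "disjoint B" "{} \<notin> B"
    using assms by (auto simp: set_partitions_iff partition_on_def)
  have "disjoint (shift ?n ` B)"
    unfolding shift_eq_image using pB by (intro disjoint_image) auto
  then have "disjoint (part_concat A B)"
    unfolding part_concat_def using pA disj by (intro disjoint_union)
  moreover have "{} \<notin> part_concat A B"
    using pA pB by (auto simp: part_concat_def shift_def)
  ultimately show "part_concat A B \<in> set_partitions"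
    using U c by (simp add: set_partitions_iff partition_on_def)
  show "A \<inter> shift ?n ` B = {}"
  proof (rule ccontr)
    assume "A \<inter> shift ?n ` B \<noteq> {}"
    then obtain C where C: "C \<in> A" "C \<in> shift ?n ` B"
      by blast
    then have "C \<subseteq> \<Union>A \<inter> \<Union>(shift ?n ` B)"
      by blast
    then have "C = {}"
      unfolding disj by simp
    then show False
      using C pA by simp
  qed
qed

lemma part_concat_assoc:
  assumes "A \<in> set_partitions" "B \<in> set_partitions"
  shows "part_concat (part_concat A B) C = part_concat A (part_concat B C)"
  unfolding part_concat_def[of "part_concat A B"] part_concat_props(2)[OF assms]
  by (auto simp: part_concat_def image_Un image_image shift_def ac_simps)

lemma part_concat_empty [simp]: "part_concat {} A = A" "part_concat A {} = A"
  by (auto simp: part_concat_def shift_def)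

text \<open>The elements of \<open>\<Union>S\<close> lie below the shifted elements of
  \<open>\<Union>T\<close>, so ranks in the union split. Standardization closes the gaps left by
  missing blocks: the second part ends up shifted by \<open>card (\<Union>S)\<close> instead of
  \<open>card (\<Union>A)\<close>.\<close>

lemma part_std_Un_shift:
  assumes A: "A \<in> set_partitions" and B: "B \<in> set_partitions" and S: "S \<subseteq> A" and T: "T \<subseteq> B"
  shows "part_std (S \<union> shift (card (\<Union>A)) ` T) = part_concat (part_std S) (part_std T)"
proof -
  let ?n = "card (\<Union>A)"
  let ?U = "\<Union>S" and ?V = "(\<lambda>a. a + ?n) ` \<Union>T"
  have fin: "finite ?U" "finite (\<Union>T)"
    using finite_subset[OF Union_mono[OF S] set_partitions_finite_Union[OF A]]
      finite_subset[OF Union_mono[OF T] set_partitions_finite_Union[OF B]] by auto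
  have less: "a < b" if ab: "a \<in> ?U" "b \<in> ?V" for a b
  proof -
    have "a \<in> {1..?n}"
      using ab(1) S set_partitions_Union[OF A] by blast
    moreover obtain c where "c \<in> \<Union>T" "b = c + ?n"
      using ab(2) by blast
    moreover from this have "c \<in> {1..card (\<Union>B)}"
      using T set_partitions_Union[OF B] by blast
    ultimately show ?thesis by auto
  qed
  have UV: "\<Union>(S \<union> shift ?n ` T) = ?U \<union> ?V"
    by (auto simp: shift_def)
  have 1: "rk (?U \<union> ?V) ` C = rk ?U ` C" if "C \<in> S" for C
    using that less by (intro image_cong refl rk_Un_left) auto
  have 2: "rk (?U \<union> ?V) ` shift ?n C = shift (card ?U) (rk (\<Union>T) ` C)" if "C \<in> T" for C
  proof -
    have "rk (?U \<union> ?V) (a + ?n) = rk (\<Union>T) a + card ?U" if "a \<in> C" for a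
    proof -
      have a: "a \<in> \<Union>T"
        using that \<open>C \<in> T\<close> by auto
      have "rk (?U \<union> ?V) (a + ?n) = rk ?V (a + ?n) + card ?U"
        using fin a by (intro rk_Un_right less) auto
      also have "rk ?V (a + ?n) = rk (\<Union>T) a"
        using rk_comp[OF fin(2) strict_mono_on_add a] .
      finally show ?thesis .
    qed
    then show ?thesis
      by (simp add: shift_def image_image)
  qed
  show ?thesis
    unfolding part_concat_def card_Union_part_std[OF fin(1)]
    unfolding part_std_eq_image UV image_Un
      image_image[of "(`) (rk (?U \<union> ?V))" "shift ?n"] image_image[of "shift (card ?U)" "(`) (rk (\<Union>T))"]
    by (intro arg_cong2[where f="(\<union>)"] image_cong[OF refl] 1 2)
qed

text \<open>One family of constants serves both structures that are compared, as
  \<open>hopf_basis_pair\<close> requires.\<close>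

definition DS :: "nat set set \<Rightarrow> (nat set set \<times> nat set set \<Rightarrow>\<^sub>0 'k::comm_ring_1)" where
  "DS A = (\<Sum>S\<in>Pow A. basis_vec (part_std S, part_std (A - S)))"

text \<open>The hypotheses shared by the two structures that the theorem compares.\<close>

locale setpart_hopf =
  fixes H :: "('k::comm_ring_1, 'a::ab_group_add) hopf" and e :: "nat set set \<Rightarrow> 'a"
  assumes module_scal: "module (scal H)"
    and carr_eq: "carr H = module.span (scal H) (e ` set_partitions)"
    and deg_part_eq: "deg_part H n = module.span (scal H) (e ` {A. partition_on {1..n} A})"
    and indep: "Poly_Mapping.keys c \<subseteq> set_partitions \<Longrightarrow> lin_ext (scal H) e c = 0 \<Longrightarrow> c = 0"
    and one_eq: "one H = e {}"
    and mul_left: "y \<in> carr H \<Longrightarrow> linear_on (carr H) (scal H) (scal H) (\<lambda>x. mul H x y)"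
    and mul_right: "x \<in> carr H \<Longrightarrow> linear_on (carr H) (scal H) (scal H) (mul H x)"
    and mul_basis: "A \<in> set_partitions \<Longrightarrow> B \<in> set_partitions \<Longrightarrow> mul H (e A) (e B) = e (part_concat A B)"
    and counit_lin: "linear_on (carr H) (scal H) (*) (counit H)"
    and counit_basis: "A \<in> set_partitions \<Longrightarrow> counit H (e A) = (if A = {} then 1 else 0)"
    and comul_keys: "x \<in> carr H \<Longrightarrow> Poly_Mapping.keys (comul H x) \<subseteq> carr H \<times> carr H"
    and comul_lin_mod: "lin_mod (carr H) (scal H) fm_scale
      (multilinear_rels (scal H) (carr H) (slots2 (carr H))) (comul H)"
    and comul_basis: "A \<in> set_partitions \<Longrightarrow>
      tensor2_eq H (comul H (e A)) (\<Sum>S\<in>Pow A. basis_vec (e (part_std S), e (part_std (A - S))))"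
begin

lemma DS_e: "lin_ext fm_scale (\<lambda>(a, b). basis_vec (e a, e b)) (DS A) = (\<Sum>S\<in>Pow A. basis_vec (e (part_std S), e (part_std (A - S))))"
  by (simp add: DS_def)

theorem hopf_basis: "hopf_basis H set_partitions e {} (\<lambda>A. card (\<Union>A)) DS"
proof (rule hopf_basis.intro)
  interpret s: module "scal H" by (rule module_scal)
  show "module (scal H)" by (rule module_scal)
  show "carr H = module.span (scal H) (e ` set_partitions)" by (rule carr_eq)
  have deg: "{A \<in> set_partitions. card (\<Union>A) = n} = {A. partition_on {1..n} A}" for n
    using partition_on_card by (auto simp: set_partitions_iff)
  then show deg_part: "deg_part H n = module.span (scal H) (e ` {A \<in> set_partitions. card (\<Union>A) = n})" for n
    by (simp add: deg_part_eq)
  show "c = 0" if "Poly_Mapping.keys c \<subseteq> set_partitions" "lin_ext (scal H) e c = 0" for c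
    using that by (rule indep)
  show "{} \<in> set_partitions" "one H = e {}"
    by (simp_all add: one_eq)
  show "(card (\<Union>A) = 0) = (A = {})" if "A \<in> set_partitions" for A
    using that by (auto simp: set_partitions_iff partition_on_def)
  show "linear_on (carr H) (scal H) (scal H) (\<lambda>x. mul H x y)" if "y \<in> carr H" for y
    using that by (rule mul_left)
  show "linear_on (carr H) (scal H) (scal H) (mul H x)" if "x \<in> carr H" for x
    using that by (rule mul_right)
  show "mul H (e A) (e B) \<in> deg_part H (card (\<Union>A) + card (\<Union>B))" if "A \<in> set_partitions" "B \<in> set_partitions" for A B
    unfolding mul_basis[OF that] deg_part using part_concat_props[OF that] by (intro s.span_base) auto
  show "mul H (mul H (e A) (e B)) (e C) = mul H (e A) (mul H (e B) (e C))"
    if "A \<in> set_partitions" "B \<in> set_partitions" "C \<in> set_partitions" for A B C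
    using that by (simp add: mul_basis part_concat_props part_concat_assoc)
  show "mul H (e {}) (e A) = e A" "mul H (e A) (e {}) = e A" if "A \<in> set_partitions" for A
    using that by (simp_all add: mul_basis)
  show "linear_on (carr H) (scal H) (*) (counit H)" by (rule counit_lin)
  show "counit H (e A) = (if A = {} then 1 else 0)" if "A \<in> set_partitions" for A
    using that by (rule counit_basis)
  show "Poly_Mapping.keys (comul H x) \<subseteq> carr H \<times> carr H" if "x \<in> carr H" for x
    using that by (rule comul_keys)
  show "lin_mod (carr H) (scal H) fm_scale (multilinear_rels (scal H) (carr H) (slots2 (carr H))) (comul H)"
    by (rule comul_lin_mod)
  show "tensor2_eq H (comul H (e A)) (lin_ext fm_scale (\<lambda>(a, b). basis_vec (e a, e b)) (DS A))" if "A \<in> set_partitions" for A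
    unfolding DS_e using that by (rule comul_basis)
  have fin: "finite (\<Union>S)" if "A \<in> set_partitions" "S \<subseteq> A" for A S :: "nat set set"
    using finite_subset[OF Union_mono[OF that(2)] set_partitions_finite_Union[OF that(1)]] .
  show "B \<in> set_partitions \<and> C \<in> set_partitions \<and> card (\<Union>B) + card (\<Union>C) = card (\<Union>A)"
    if "A \<in> set_partitions" "(B, C) \<in> Poly_Mapping.keys (DS A :: _ \<Rightarrow>\<^sub>0 'k)" for A B C
  proof -
    have "(B, C) \<in> (\<Union>S\<in>Pow A. {(part_std S, part_std (A - S))})"
      using that(2) keys_sum[of "\<lambda>S. basis_vec (part_std S, part_std (A - S))" "Pow A"] unfolding DS_def by fastforce
    then obtain S where S: "S \<subseteq> A" "B = part_std S" "C = part_std (A - S)"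
      by auto
    have A: "disjoint A"
      using that(1) by (auto simp: set_partitions_iff partition_on_def)
    have "\<Union>S \<inter> \<Union>(A - S) = {}"
    proof (rule ccontr)
      assume "\<Union>S \<inter> \<Union>(A - S) \<noteq> {}"
      then obtain x P Q where "x \<in> P" "P \<in> S" "x \<in> Q" "Q \<in> A" "Q \<notin> S" by auto
      then show False
        using disjointD[OF A, of P Q] S(1) by auto
    qed
    moreover have "\<Union>S \<union> \<Union>(A - S) = \<Union>A"
      using S(1) by auto
    ultimately have "card (\<Union>S) + card (\<Union>(A - S)) = card (\<Union>A)"
      using card_Un_disjoint[OF fin[OF that(1) S(1)] fin[OF that(1) Diff_subset]] by metis
    then show ?thesis
      unfolding S using part_std_in[OF that(1)] S(1) fin[OF that(1)] by (simp add: card_Union_part_std)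
  qed
  show "lin_ext fm_scale (\<lambda>(a, b). lin_ext fm_scale (\<lambda>(a1, a2). basis_vec (a1, a2, b)) (DS a)) (DS A)
     = (lin_ext fm_scale (\<lambda>(a, b). lin_ext fm_scale (\<lambda>(b1, b2). basis_vec (a, b1, b2)) (DS b)) (DS A) :: _ \<Rightarrow>\<^sub>0 'k)"
    if A: "A \<in> set_partitions" for A
  proof -
    let ?p = part_std
    let ?F = "\<lambda>a b c. basis_vec (a, b, c) :: nat set set \<times> nat set set \<times> nat set set \<Rightarrow>\<^sub>0 'k"
    have "(\<Sum>S\<in>Pow A. \<Sum>T\<in>Pow (?p S). ?F (?p T) (?p (?p S - T)) (?p (A - S)))
       = (\<Sum>S\<in>Pow A. \<Sum>T\<in>Pow S. ?F (?p T) (?p (S - T)) (?p (A - S)))"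
      using fin[OF A] by (intro sum.cong[OF refl] sum_Pow_part_std[where F="\<lambda>a b. ?F a b (?p (A - _))"]) auto
    also have "\<dots> = (\<Sum>S\<in>Pow A. \<Sum>T\<in>Pow (A - S). ?F (?p S) (?p T) (?p (A - S - T)))"
      by (rule sum_Pow_assoc[where F="\<lambda>a b c. ?F (?p a) (?p b) (?p c)", OF set_partitions_finite[OF A]])
    also have "\<dots> = (\<Sum>S\<in>Pow A. \<Sum>T\<in>Pow (?p (A - S)). ?F (?p S) (?p T) (?p (?p (A - S) - T)))"
      using fin[OF A] by (intro sum.cong[OF refl] sum_Pow_part_std[symmetric, where F="\<lambda>a b. ?F (?p _) a b"]) auto
    finally show ?thesis
      by (simp add: DS_def)
  qed
  show "lin_ext fm_scale (\<lambda>(a, b). if a = {} then basis_vec b else 0) (DS A) = (basis_vec A :: _ \<Rightarrow>\<^sub>0 'k)" if "A \<in> set_partitions" for A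
  proof -
    have "(\<Sum>S\<in>Pow A. if S = {} then basis_vec (part_std (A - S)) else (0 :: _ \<Rightarrow>\<^sub>0 'k)) = (\<Sum>S\<in>{{}}. basis_vec (part_std (A - S)))"
      using set_partitions_finite[OF that] by (intro sum.mono_neutral_cong_right) auto
    then show ?thesis
      using that by (simp add: DS_def part_std_self)
  qed
  show "lin_ext fm_scale (\<lambda>(a, b). if b = {} then basis_vec a else 0) (DS A) = (basis_vec A :: _ \<Rightarrow>\<^sub>0 'k)" if "A \<in> set_partitions" for A
  proof -
    have "(\<Sum>S\<in>Pow A. if A - S = {} then basis_vec (part_std S) else (0 :: _ \<Rightarrow>\<^sub>0 'k)) = (\<Sum>S\<in>{A}. basis_vec (part_std S))"
      using set_partitions_finite[OF that] by (intro sum.mono_neutral_cong_right) auto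
    then show ?thesis
      using that by (simp add: DS_def part_std_self)
  qed
  show "tensor2_eq H (comul H (mul H (e A) (e B)))
      (tensor2_mul H (lin_ext fm_scale (\<lambda>(a, b). basis_vec (e a, e b)) (DS A)) (lin_ext fm_scale (\<lambda>(a, b). basis_vec (e a, e b)) (DS B)))"
    if A: "A \<in> set_partitions" and B: "B \<in> set_partitions" for A B
  proof -
    let ?p = part_std and ?sh = "(`) (shift (card (\<Union>A)))"
    let ?G = "\<lambda>a b. basis_vec (e a, e b) :: 'a \<times> 'a \<Rightarrow>\<^sub>0 'k"
    have inj_sh: "inj (shift n)" for n
      by (auto simp: inj_def shift_eq_image inj_image_eq_iff)
    have disj: "A \<inter> ?sh B = {}"
      by (rule part_concat_props(3)[OF A B])
    have "tensor2_mul H (\<Sum>S\<in>Pow A. ?G (?p S) (?p (A - S))) (\<Sum>T\<in>Pow B. ?G (?p T) (?p (B - T)))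
      = (\<Sum>S\<in>Pow A. \<Sum>T\<in>Pow B. ?G (part_concat (?p S) (?p T)) (part_concat (?p (A - S)) (?p (B - T))))"
      using part_std_in[OF A] part_std_in[OF B] by (simp add: tensor2_mul_def mul_basis)
    also have "\<dots> = (\<Sum>S\<in>Pow A. \<Sum>T\<in>Pow B. ?G (?p (S \<union> ?sh T)) (?p (part_concat A B - (S \<union> ?sh T))))"
    proof (rule sum.cong[OF refl], rule sum.cong[OF refl])
      fix S T assume ST: "S \<in> Pow A" "T \<in> Pow B"
      \<comment> \<open>Complements split because no block of \<open>A\<close> is a shifted block of
        \<open>B\<close> and the shift is injective on blocks.\<close>
      then have "part_concat A B - (S \<union> ?sh T) = (A - S) \<union> ?sh (B - T)"
        unfolding part_concat_def using disj image_set_diff[OF inj_sh, of _ B T] by blast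
      then show "?G (part_concat (?p S) (?p T)) (part_concat (?p (A - S)) (?p (B - T)))
        = ?G (?p (S \<union> ?sh T)) (?p (part_concat A B - (S \<union> ?sh T)))"
        using ST part_std_Un_shift[OF A B, of S T] part_std_Un_shift[OF A B, of "A - S" "B - T"] by simp
    qed
    also have "\<dots> = (\<Sum>(S, T)\<in>Pow A \<times> Pow B. ?G (?p (S \<union> ?sh T)) (?p (part_concat A B - (S \<union> ?sh T))))"
      by (rule sum.cartesian_product)
    \<comment> \<open>Choosing blocks of the concatenation amounts to choosing blocks of each factor
      independently.\<close>
    also have "\<dots> = (\<Sum>R\<in>Pow (part_concat A B). ?G (?p R) (?p (part_concat A B - R)))"
    proof (rule sum.reindex_bij_witness[where j="\<lambda>(S, T). S \<union> ?sh T" and i="\<lambda>R. (R \<inter> A, shift (card (\<Union>A)) -` R \<inter> B)"])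
      fix r assume "r \<in> Pow A \<times> Pow B"
      then obtain S T where r: "r = (S, T)" "S \<subseteq> A" "T \<subseteq> B" by auto
      have "(S \<union> ?sh T) \<inter> A = S"
        using r disj by auto
      moreover have "shift (card (\<Union>A)) -` (S \<union> ?sh T) \<inter> B = T"
        using r disj inj_sh[of "card (\<Union>A)"] by (auto simp: inj_eq)
      ultimately show "(\<lambda>R. (R \<inter> A, shift (card (\<Union>A)) -` R \<inter> B)) (case r of (S, T) \<Rightarrow> S \<union> ?sh T) = r"
        by (simp add: r)
    qed (auto simp: part_concat_def)
    finally have *: "tensor2_mul H (\<Sum>S\<in>Pow A. ?G (?p S) (?p (A - S))) (\<Sum>T\<in>Pow B. ?G (?p T) (?p (B - T)))
      = (\<Sum>R\<in>Pow (part_concat A B). ?G (?p R) (?p (part_concat A B - R)))" .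
    show ?thesis
      unfolding DS_e * mul_basis[OF that] by (rule comul_basis[OF part_concat_props(1)[OF that]])
  qed
qed

end

section \<open>The Hopf subalgebra spanned by the \<open>Z_elem A\<close>\<close>

lemma words_on_std_words: "partition_on {1..n} A \<Longrightarrow> words_on A \<subseteq> std_words n"
  by (auto simp: words_on_def std_words_def partition_on_def)

text \<open>Domain blocks are letters, so prescribing the domain prescribes the set of letters and
  leaves their arrangement free.\<close>

lemma ubp_with_domain:
  assumes "A \<in> set_partitions"
  shows "{f. f \<in> (\<Union>n. ubp n) \<and> Domain f = A} = bmap ` words_on A"
proof (intro set_eqI iffI)
  fix f assume "f \<in> {f. f \<in> (\<Union>n. ubp n) \<and> Domain f = A}"
  then obtain n w where "w \<in> std_words n" "f = bmap w" "set w = A"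
    by (auto simp: ubp_eq_bmap)
  then show "f \<in> bmap ` words_on A"
    by (auto simp: words_on_def std_words_def)
next
  fix f assume "f \<in> bmap ` words_on A"
  then obtain w where w: "f = bmap w" "w \<in> words_on A" by auto
  then have "f \<in> ubp (card (\<Union>A))"
    using assms words_on_std_words[of "card (\<Union>A)" A] by (auto simp: set_partitions_iff intro: bmap_in_ubp)
  moreover have "Domain f = A"
    using w by (simp add: words_on_def)
  ultimately show "f \<in> {f. f \<in> (\<Union>n. ubp n) \<and> Domain f = A}"
    by blast
qed

lemma words_on_SW: "A \<in> set_partitions \<Longrightarrow> words_on A \<subseteq> SW"
  using words_on_std_words by (auto simp: SW_def set_partitions_iff)

lemma Z_elem_eq:
  assumes "A \<in> set_partitions"
  shows "Z_elem A = (\<Sum>w\<in>words_on A. ew w)"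
proof -
  have "inj_on bmap (words_on A)"
    using inj_on_bmap_SW words_on_SW[OF assms] by (rule inj_on_subset)
  then show ?thesis
    unfolding Z_elem_def ubp_with_domain[OF assms] by (simp add: sum.reindex ew_def)
qed

lemma Z_elem_empty: "Z_elem {} = basis_vec {}"
proof -
  have "words_on {} = {[]}"
    by (auto simp: words_on_def)
  then show ?thesis
    by (simp add: Z_elem_eq ew_def)
qed

lemma ubp_carr_subspace: "fm.subspace (carr ubp_hopf)"
  unfolding ubp_carr span_basis_vec[symmetric] by simp

lemma comul_ubp_sum: "comul ubp_hopf (\<Sum>j\<in>J. f j) = (\<Sum>j\<in>J. comul ubp_hopf (f j))"
  by (simp add: ubp_hopf_def)

lemma Z_elem_carr: "A \<in> set_partitions \<Longrightarrow> Z_elem A \<in> carr ubp_hopf"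
  using words_on_SW[of A] by (auto simp: Z_elem_eq intro!: fm.subspace_sum ubp_carr_subspace ew_carr)

text \<open>Shuffling all arrangements of \<open>A\<close> with all shifted arrangements of
  \<open>B\<close> produces each arrangement of the concatenated partition exactly once.\<close>

lemma mul_Z_elem:
  assumes A: "A \<in> set_partitions" and B: "B \<in> set_partitions"
  shows "mul ubp_hopf (Z_elem A) (Z_elem B) = Z_elem (part_concat A B)"
proof -
  let ?n = "card (\<Union>A)"
  have SW: "u \<in> SW" if "u \<in> words_on A \<or> u \<in> words_on B" for u
    using that words_on_SW[OF A] words_on_SW[OF B] by auto
  have len: "length u = ?n" if "u \<in> words_on A" for u
    using that by (auto simp: words_on_def block_word_length)
  have UA: "\<Union>A = {1..?n}"
    using A by (rule set_partitions_Union)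
  have "{1..?n} \<inter> (\<lambda>a. a + ?n) ` {1..card (\<Union>B)} = {}"
    by auto
  then have "\<Union>A \<inter> (\<lambda>a. a + ?n) ` \<Union>B = {}"
    using UA set_partitions_Union[OF B] by (simp only:)
  then have disj: "\<Union>A \<inter> \<Union>(shift ?n ` B) = {}"
    unfolding Union_shift_image .
  have "mul ubp_hopf (Z_elem A) (Z_elem B) = (\<Sum>u\<in>words_on A. \<Sum>v\<in>words_on B. mul ubp_hopf (ew u) (ew v))"
    unfolding Z_elem_eq[OF A] Z_elem_eq[OF B] mul_ubp_sum(1) unfolding mul_ubp_sum(2) ..
  also have "\<dots> = (\<Sum>u\<in>words_on A. \<Sum>v\<in>words_on B. \<Sum>z\<in>shuffles u (map (shift ?n) v). ew z)"
    using SW len by (intro sum.cong refl) (simp add: mul_ew)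
  also have "\<dots> = (\<Sum>u\<in>words_on A. \<Sum>v\<in>words_on (shift ?n ` B). \<Sum>z\<in>shuffles u v. ew z)"
    unfolding shift_eq_image by (intro sum.cong refl sum_words_on_map[symmetric]) auto
  also have "\<dots> = (\<Sum>z\<in>words_on (part_concat A B). ew z)"
    unfolding part_concat_def by (rule sum_words_on_shuffles[OF disj])
  finally show ?thesis
    using part_concat_props(1)[OF A B] by (simp add: Z_elem_eq)
qed

lemma scal_ubp [simp]: "scal ubp_hopf = fm_scale"
  by (simp add: ubp_hopf_def)

text \<open>Cutting all arrangements of \<open>A\<close> and grouping by the letters on the left
  gives an equality with a double sum for each \<open>S\<close>. Only the passage from this double
  sum to one tensor of two sums uses the relations.\<close>

lemma comul_Z_elem:
  assumes A: "A \<in> set_partitions"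
  shows "tensor2_eq ubp_hopf (\<Sum>S\<in>Pow A. basis_vec (Z_elem (part_std S), Z_elem (part_std (A - S)))) (comul ubp_hopf (Z_elem A))"
proof -
  have disj: "disjoint A"
    using A by (simp add: set_partitions_iff partition_on_def)
  have fin: "finite (\<Union>S)" if "S \<subseteq> A" for S
    using finite_subset[OF Union_mono[OF that] set_partitions_finite_Union[OF A]] .
  have "comul ubp_hopf (Z_elem A) = (\<Sum>w\<in>words_on A. comul ubp_hopf (ew w))"
    by (simp add: Z_elem_eq A comul_ubp_sum)
  also have "\<dots> = (\<Sum>w\<in>words_on A. \<Sum>p\<in>cuts w. basis_vec (ew (std (fst p)), ew (std (snd p))))"
    using words_on_SW[OF A] by (intro sum.cong refl comul_ew) auto
  also have "\<dots> = (\<Sum>S\<in>Pow A. \<Sum>u\<in>words_on S. \<Sum>v\<in>words_on (A - S). basis_vec (ew (std u), ew (std v)))"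
    by (rule sum_words_on_cuts[OF disj set_partitions_finite[OF A], of "\<lambda>u v. basis_vec (ew (std u), ew (std v))"])
  also have "\<dots> = (\<Sum>S\<in>Pow A. \<Sum>u\<in>words_on (part_std S). \<Sum>v\<in>words_on (part_std (A - S)). basis_vec (ew u, ew v))"
    using fin by (intro sum.cong[OF refl, of "Pow A"]) (simp add: sum_words_on_part_std)
  finally have *: "comul ubp_hopf (Z_elem A) = (\<Sum>S\<in>Pow A. \<Sum>u\<in>words_on (part_std S). \<Sum>v\<in>words_on (part_std (A - S)). basis_vec (ew u, ew v))" .
  have "(\<Sum>S\<in>Pow A. basis_vec (Z_elem (part_std S), Z_elem (part_std (A - S))) -
      (\<Sum>u\<in>words_on (part_std S). \<Sum>v\<in>words_on (part_std (A - S)). basis_vec (ew u, ew v))) \<in> multilinear_rels fm_scale (carr ubp_hopf) (slots2 (carr ubp_hopf))"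
  proof (intro fm.subspace_sum)
    show "fm.subspace (multilinear_rels fm_scale (carr ubp_hopf) (slots2 (carr ubp_hopf)))"
      by (simp add: multilinear_rels_def)
    fix S assume "S \<in> Pow A"
    then have S: "part_std S \<in> set_partitions" "part_std (A - S) \<in> set_partitions"
      using part_std_in[OF A] by auto
    show "basis_vec (Z_elem (part_std S), Z_elem (part_std (A - S))) -
      (\<Sum>u\<in>words_on (part_std S). \<Sum>v\<in>words_on (part_std (A - S)). basis_vec (ew u, ew v)) \<in> multilinear_rels fm_scale (carr ubp_hopf) (slots2 (carr ubp_hopf))"
      unfolding Z_elem_eq[OF S(1)] Z_elem_eq[OF S(2)]
      using words_on_SW[OF S(1)] words_on_SW[OF S(2)] by (intro fm.tensor2_sum ubp_carr_subspace ew_carr) auto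
  qed
  then show ?thesis
    unfolding tensor2_eq_def * by (simp add: sum_subtractf)
qed

lemma Z_space_eq: "Z_space = fm.span (Z_elem ` set_partitions)"
proof (rule antisym)
  show "Z_space \<subseteq> fm.span (Z_elem ` set_partitions)"
    unfolding Z_space_def
  proof (rule fm.span_minimal)
    show "(\<Union>n. Z_part n) \<subseteq> fm.span (Z_elem ` set_partitions)"
      unfolding Z_part_def set_partitions_def by (intro UN_least fm.span_mono) auto
  qed simp
  show "fm.span (Z_elem ` set_partitions) \<subseteq> Z_space"
    unfolding Z_space_def
  proof (rule fm.span_minimal)
    show "Z_elem ` set_partitions \<subseteq> fm.span (\<Union>n. Z_part n)"
      unfolding Z_part_def set_partitions_def by (auto intro!: fm.span_base)
  qed simp
qed

lemma Z_elem_in [simp]: "A \<in> set_partitions \<Longrightarrow> Z_elem A \<in> Z_space"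
  by (auto simp: Z_space_eq intro: fm.span_base)

lemma Z_space_subspace: "fm.subspace Z_space"
  by (simp add: Z_space_eq)

lemma Z_space_carr: "Z_space \<subseteq> carr ubp_hopf"
  unfolding Z_space_eq
  by (rule fm.span_minimal[OF _ ubp_carr_subspace]) (auto intro: Z_elem_carr)

section \<open>Linear independence and a retraction onto \<open>Z_space\<close>\<close>

definition id_ubp :: "nat set set \<Rightarrow> blockmap" where
  "id_ubp A = (\<lambda>B. (B, B)) ` A"

lemma Domain_id_ubp [simp]: "Domain (id_ubp A) = A"
  by (simp add: id_ubp_def Domain_fst image_image)

lemma id_ubp_in: "A \<in> set_partitions \<Longrightarrow> id_ubp A \<in> bmap ` words_on A"
proof -
  assume A: "A \<in> set_partitions"
  have "Range (id_ubp A) = A"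
    by (simp add: id_ubp_def Range_snd image_image)
  then have "id_ubp A \<in> ubp (card (\<Union>A))"
  proof -
    have "single_valued (id_ubp A)" "single_valued ((id_ubp A)\<inverse>)" "\<forall>(B, C)\<in>id_ubp A. card B = card C"
      by (auto simp: id_ubp_def single_valued_def)
    then show ?thesis
      using A \<open>Range (id_ubp A) = A\<close> unfolding ubp_def set_partitions_iff by simp
  qed
  then show ?thesis
    unfolding ubp_with_domain[OF A, symmetric] by auto
qed

text \<open>Among the summands of \<open>Z_elem B\<close> the identity of \<open>A\<close> can only
  occur if its domain is \<open>B\<close>. So the coefficients at identities are dual to the
  elements \<open>Z_elem A\<close>; they yield independence as well as the projection.\<close>

lemma lookup_Z_elem_id:
  assumes "A \<in> set_partitions" "B \<in> set_partitions"
  shows "Poly_Mapping.lookup (Z_elem B) (id_ubp A) = (if B = A then 1 else 0)"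
proof -
  have "Poly_Mapping.lookup (Z_elem B) (id_ubp A) = (\<Sum>f\<in>bmap ` words_on B. if f = id_ubp A then 1 else 0)"
    unfolding Z_elem_def ubp_with_domain[OF assms(2)] by (simp add: lookup_sum lookup_single when_def)
  also have "\<dots> = (if id_ubp A \<in> bmap ` words_on B then 1 else 0)"
    by (subst sum.delta) auto
  also have "id_ubp A \<in> bmap ` words_on B \<longleftrightarrow> B = A"
  proof
    assume "id_ubp A \<in> bmap ` words_on B"
    then obtain w where w: "id_ubp A = bmap w" "set w = B"
      by (auto simp: words_on_def)
    then show "B = A"
      by (metis Domain_bmap Domain_id_ubp)
  qed (use id_ubp_in[OF assms(1)] in simp)
  finally show ?thesis .
qed

lemma Z_elem_indep:
  assumes "Poly_Mapping.keys c \<subseteq> set_partitions" "lin_ext fm_scale Z_elem c = 0"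
  shows "c = 0"
proof (rule poly_mapping_eqI)
  fix A
  show "Poly_Mapping.lookup c A = Poly_Mapping.lookup 0 A"
  proof (cases "A \<in> set_partitions")
    case True
    have *: "Poly_Mapping.lookup (Z_elem B) (id_ubp A) = (if B = A then 1 else 0)" if "B \<in> Poly_Mapping.keys c" for B
      using assms(1) that True by (intro lookup_Z_elem_id) auto
    have "0 = Poly_Mapping.lookup (lin_ext fm_scale Z_elem c) (id_ubp A)"
      by (simp add: assms(2))
    also have "\<dots> = (\<Sum>B\<in>Poly_Mapping.keys c. if B = A then Poly_Mapping.lookup c A else 0)"
      unfolding lin_ext_def lookup_sum by (intro sum.cong refl) (simp add: *)
    also have "\<dots> = Poly_Mapping.lookup c A"
      by (auto simp: in_keys_iff)
    finally show ?thesis by simp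
  qed (use assms(1) in \<open>auto simp: in_keys_iff\<close>)
qed

text \<open>A linear projection onto \<open>Z_space\<close>, which makes \<open>Z \<otimes> Z \<rightarrow> P \<otimes> P\<close> injective.\<close>

definition Z_proj :: "(blockmap \<Rightarrow>\<^sub>0 'k::comm_ring_1) \<Rightarrow> (blockmap \<Rightarrow>\<^sub>0 'k)" where
  "Z_proj = lin_ext fm_scale (\<lambda>f. if f = id_ubp (Domain f) then Z_elem (Domain f) else 0)"

lemma Z_proj_in: assumes "x \<in> carr ubp_hopf" shows "Z_proj x \<in> Z_space"
  unfolding Z_proj_def
proof (intro fm.lin_ext_in_subspace Z_space_subspace)
  fix f assume "f \<in> Poly_Mapping.keys x"
  then obtain n where "f \<in> ubp n"
    using assms by (auto simp: ubp_hopf_def)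
  then have "Domain f \<in> set_partitions"
    by (auto simp: set_partitions_def ubp_def)
  then show "(if f = id_ubp (Domain f) then Z_elem (Domain f) else 0) \<in> Z_space"
    using fm.subspace_0[OF Z_space_subspace] by (auto intro: Z_elem_in)
qed

lemma Z_proj_Z_elem: assumes A: "A \<in> set_partitions" shows "Z_proj (Z_elem A) = Z_elem A"
proof -
  have "Z_proj (Z_elem A) = (\<Sum>f\<in>bmap ` words_on A. if f = id_ubp (Domain f) then Z_elem (Domain f) else 0)"
    unfolding Z_proj_def Z_elem_def[of A] ubp_with_domain[OF A] by simp
  also have "\<dots> = (\<Sum>f\<in>bmap ` words_on A. if f = id_ubp A then Z_elem A else 0)"
  proof (intro sum.cong refl)
    fix f assume "f \<in> bmap ` words_on A"
    then obtain w where "f = bmap w" "set w = A"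
      by (auto simp: words_on_def)
    then have "Domain f = A"
      by simp
    then show "(if f = id_ubp (Domain f) then Z_elem (Domain f) else 0) = (if f = id_ubp A then Z_elem A else 0)"
      by (simp only:)
  qed
  also have "\<dots> = Z_elem A"
    using id_ubp_in[OF A] by (subst sum.delta) auto
  finally show ?thesis .
qed

lemma linear_on_Z_proj: "linear_on B fm_scale fm_scale Z_proj"
  unfolding Z_proj_def by (rule linear_on_lin_ext_id[OF module_fm_scale])

lemma Z_proj_id: assumes "x \<in> Z_space" shows "Z_proj x = x"
proof -
  have "Z_proj x - x \<in> {0}"
  proof (rule fm.lin_mod_eq_on_span[OF module_fm_scale _ _ _ order_refl])
    show "lin_mod (fm.span (Z_elem ` set_partitions)) fm_scale fm_scale {0} Z_proj"
      by (simp add: lin_mod_0_iff linear_on_Z_proj)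
    show "lin_mod (fm.span (Z_elem ` set_partitions)) fm_scale fm_scale {0} (\<lambda>x. x)"
      by (simp add: lin_mod_0_iff linear_on_def)
  qed (use assms in \<open>auto simp: Z_space_eq Z_proj_Z_elem\<close>)
  then show ?thesis by simp
qed

abbreviation "Z_rels \<equiv> multilinear_rels fm_scale Z_space (slots2 Z_space)"

text \<open>Apply the projection to both factors: it sends relations over the whole algebra to
  relations over \<open>Z_space\<close>, and it fixes formal sums of pairs that already lie in
  \<open>Z_space\<close>.\<close>

lemma Z_tensor_inj:
  assumes "x \<in> multilinear_rels fm_scale (carr ubp_hopf) (slots2 (carr ubp_hopf))" "Poly_Mapping.keys x \<subseteq> Z_space \<times> Z_space"
  shows "x \<in> Z_rels"
proof -
  have sub: "fm.subspace Z_rels"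
    by (simp add: multilinear_rels_def)
  have "lin_ext fm_scale (\<lambda>(a, b). basis_vec (Z_proj a, Z_proj b)) x \<in> Z_rels"
  proof (rule multilinear_rels_lin_ext[OF module_fm_scale sub _ assms(1)])
    have comp: "lin_mod (carr ubp_hopf) fm_scale fm_scale Z_rels (\<lambda>x. basis_vec (\<sigma> (Z_proj x)))" if "\<sigma> \<in> slots2 Z_space" for \<sigma>
    proof -
      have add: "Z_proj (x + y) = Z_proj x + Z_proj y" and scale: "Z_proj (fm_scale a x) = fm_scale a (Z_proj x)" for x y a
        using linear_on_Z_proj[of UNIV] by (auto simp: linear_on_def)
      show ?thesis
        using slot_lin_mod[OF that, of Z_space fm_scale] Z_proj_in unfolding lin_mod_def add scale by blast
    qed
    fix \<sigma> assume "\<sigma> \<in> slots2 (carr (ubp_hopf :: ('a, blockmap \<Rightarrow>\<^sub>0 'a) hopf))"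
    then obtain b where b: "b \<in> carr ubp_hopf" "\<sigma> = (\<lambda>x. (x, b)) \<or> \<sigma> = (\<lambda>x. (b, x))"
      by (auto simp: slots2_def)
    then have "(\<lambda>x. (x, Z_proj b)) \<in> slots2 Z_space" "(\<lambda>x. (Z_proj b, x)) \<in> slots2 Z_space"
      using Z_proj_in[OF b(1)] by (auto simp: slots2_def)
    from comp[OF this(1)] comp[OF this(2)] b(2)
    show "lin_mod (carr ubp_hopf) fm_scale fm_scale Z_rels (\<lambda>x. case \<sigma> x of (a, b) \<Rightarrow> basis_vec (Z_proj a, Z_proj b))"
      by auto
  qed
  moreover have "lin_ext fm_scale (\<lambda>(a, b). basis_vec (Z_proj a, Z_proj b)) x = lin_ext fm_scale basis_vec x"
    using assms(2) by (intro fm.lin_ext_cong) (auto simp: Z_proj_id)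
  ultimately show ?thesis
    by (simp add: lin_ext_basis_vec)
qed

section \<open>Closure of \<open>Z_space\<close> under the Hopf algebra operations\<close>

lemma mul_Z_space:
  assumes "x \<in> Z_space" "y \<in> Z_space" shows "mul ubp_hopf x y \<in> Z_space"
proof -
  obtain c where c: "x = lin_ext fm_scale Z_elem c" "Poly_Mapping.keys c \<subseteq> set_partitions"
    using assms(1) unfolding Z_space_eq fm.span_eq_lin_ext_image by auto
  obtain c' where c': "y = lin_ext fm_scale Z_elem c'" "Poly_Mapping.keys c' \<subseteq> set_partitions"
    using assms(2) unfolding Z_space_eq fm.span_eq_lin_ext_image by auto
  have "mul ubp_hopf x y = lin_ext fm_scale (\<lambda>A. mul ubp_hopf (Z_elem A) y) c"
    unfolding c(1) by (rule fm.linear_on_lin_ext[where A=UNIV and L="\<lambda>x. mul ubp_hopf x y"]) (auto simp: module_fm_scale mul_ubp_linear)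
  also have "\<dots> = lin_ext fm_scale (\<lambda>A. lin_ext fm_scale (\<lambda>B. mul ubp_hopf (Z_elem A) (Z_elem B)) c') c"
    unfolding c'(1) by (intro fm.lin_ext_cong refl fm.linear_on_lin_ext[where A=UNIV]) (auto simp: module_fm_scale mul_ubp_linear)
  also have "\<dots> \<in> Z_space"
    using c(2) c'(2) by (intro fm.lin_ext_in_subspace Z_space_subspace) (auto simp: subset_iff mul_Z_elem part_concat_props)
  finally show ?thesis .
qed

lemma comul_Z_space:
  assumes "x \<in> Z_space"
  shows "\<exists>t. Poly_Mapping.keys t \<subseteq> Z_space \<times> Z_space \<and> tensor2_eq ubp_hopf t (comul ubp_hopf x)"
proof -
  obtain c where c: "x = lin_ext fm_scale Z_elem c" "Poly_Mapping.keys c \<subseteq> set_partitions"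
    using assms(1) unfolding Z_space_eq fm.span_eq_lin_ext_image by auto
  let ?D = "\<lambda>A. \<Sum>S\<in>Pow A. basis_vec (Z_elem (part_std S), Z_elem (part_std (A - S)))"
  have "comul ubp_hopf x = lin_ext fm_scale (\<lambda>A. comul ubp_hopf (Z_elem A)) c"
    unfolding c(1) ubp_hopf_def by (simp add: fm.lin_ext_lin_ext)
  then have "lin_ext fm_scale ?D c - comul ubp_hopf x = lin_ext fm_scale (\<lambda>A. ?D A - comul ubp_hopf (Z_elem A)) c"
    by (simp add: fm.lin_ext_diff_fun)
  also have "\<dots> \<in> multilinear_rels fm_scale (carr ubp_hopf) (slots2 (carr ubp_hopf))"
    using c(2) comul_Z_elem by (intro fm.lin_ext_in_subspace) (auto simp: multilinear_rels_def tensor2_eq_def subset_iff)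
  finally have "tensor2_eq ubp_hopf (lin_ext fm_scale ?D c) (comul ubp_hopf x)"
    by (simp add: tensor2_eq_def)
  moreover have "Poly_Mapping.keys (?D A) \<subseteq> Z_space \<times> Z_space" if "A \<in> set_partitions" for A
    using part_std_in[OF that] by (intro order.trans[OF keys_sum]) auto
  then have "Poly_Mapping.keys (lin_ext fm_scale ?D c) \<subseteq> Z_space \<times> Z_space"
    using c(2) by (intro order.trans[OF keys_lin_ext]) blast
  ultimately show ?thesis by blast
qed

text \<open>The antipode axiom at \<open>Z_elem A\<close>, solved for the term with right factor the
  unit, involves only standardizations of proper subsets of the blocks of \<open>A\<close>. Omitting
  a block, which is non-empty, lowers \<open>card (\<Union>A)\<close>.\<close>

lemma antipode_Z_space:
  assumes S: "is_antipode ubp_hopf S" and x: "x \<in> Z_space"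
  shows "S x \<in> Z_space"
proof -
  have S_in: "S ` carr ubp_hopf \<subseteq> carr ubp_hopf" and S_lin: "linear_on (carr ubp_hopf) fm_scale fm_scale S"
    using S by (auto simp: is_antipode_def)
  have "S (Z_elem A) \<in> Z_space" if "A \<in> set_partitions" for A
    using that
  proof (induction "card (\<Union>A)" arbitrary: A rule: less_induct)
    case less
    note A = \<open>A \<in> set_partitions\<close>
    show ?case
    proof (cases "A = {}")
      case True
      then show ?thesis
        using P.antipode_one[OF S] Z_elem_in[OF empty_in_set_partitions] by (simp add: Z_elem_empty ew_def)
    next
      case False
      let ?F = "\<lambda>T. mul ubp_hopf (S (Z_elem (part_std T))) (Z_elem (part_std (A - T)))"
      have fin: "finite (Pow A)"
        using set_partitions_finite[OF A] by simp
      have S_Z: "S (Z_elem B) \<in> carr ubp_hopf" if "B \<in> set_partitions" for B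
        using S_in Z_elem_carr[OF that] by auto
      have "counit ubp_hopf (Z_elem A) = 0"
      proof -
        have "{} \<notin> bmap ` words_on A"
          using False by (auto simp: words_on_def dest: sym[of "{}"])
        then show ?thesis
          unfolding ubp_hopf_def Z_elem_def ubp_with_domain[OF A] by (simp add: lookup_sum lookup_single when_def)
      qed
      moreover have "lin_ext fm_scale (\<lambda>(a, b). mul ubp_hopf (S a) b) (comul ubp_hopf (Z_elem A))
          = fm_scale (counit ubp_hopf (Z_elem A)) (one ubp_hopf)"
        using S Z_elem_carr[OF A] unfolding is_antipode_def scal_ubp by blast
      ultimately have "0 = lin_ext fm_scale (\<lambda>(a, b). mul ubp_hopf (S a) b) (comul ubp_hopf (Z_elem A))"
        by (metis fm.scale_zero_left)
      \<comment> \<open>A bilinear expression may be evaluated on any representative of the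
        coproduct; the one chosen here has all its entries in \<open>Z_space\<close>.\<close>
      also have "\<dots> = lin_ext fm_scale (\<lambda>(a, b). mul ubp_hopf (S a) b) (\<Sum>T\<in>Pow A. basis_vec (Z_elem (part_std T), Z_elem (part_std (A - T))))"
        by (rule P.tensor2_eq_bilinear[OF module_fm_scale comul_Z_elem[OF A], symmetric, simplified scal_ubp])
          (use S_lin S_in in \<open>auto intro!: P.linear_on_mul_left'[simplified scal_ubp] mul_ubp_linear\<close>)
      also have "\<dots> = (\<Sum>T\<in>Pow A. ?F T)"
        by simp
      also have "\<dots> = ?F A + (\<Sum>T\<in>Pow A - {A}. ?F T)"
        using fin by (intro sum.remove) auto
      also have "?F A = S (Z_elem A)"
        using P.mul_one_carr[OF S_Z[OF A]] A by (simp add: part_std_self Z_elem_empty P.one_eq ew_def)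
      finally have "S (Z_elem A) = - (\<Sum>T\<in>Pow A - {A}. ?F T)"
        by (simp add: eq_neg_iff_add_eq_0)
      also have "\<dots> \<in> Z_space"
      proof (intro fm.subspace_neg fm.subspace_sum Z_space_subspace mul_Z_space)
        fix T assume T: "T \<in> Pow A - {A}"
        then obtain B where B: "B \<in> A" "B \<notin> T" by auto
        have disj: "disjoint A" "{} \<notin> A"
          using A by (auto simp: set_partitions_iff partition_on_def)
        have finU: "finite (\<Union>A)"
          by (rule set_partitions_finite_Union[OF A])
        obtain b where b: "b \<in> B"
          using B disj by (metis ex_in_conv)
        have "b \<notin> \<Union>T"
        proof
          assume "b \<in> \<Union>T"
          then obtain C where "C \<in> T" "b \<in> C" by auto
          then show False
            using disjointD[OF disj(1), of B C] B b T by auto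
        qed
        then have "\<Union>T \<subset> \<Union>A"
          using T B b by blast
        then have "card (\<Union>T) < card (\<Union>A)"
          using finU by (intro psubset_card_mono)
        moreover have "card (\<Union>(part_std T)) = card (\<Union>T)"
          using T finite_subset[OF Union_mono finU] by (intro card_Union_part_std) auto
        ultimately show "S (Z_elem (part_std T)) \<in> Z_space"
          using less.hyps[of "part_std T"] part_std_in[OF A] T by auto
        show "Z_elem (part_std (A - T)) \<in> Z_space"
          using part_std_in[OF A] by auto
      qed
      finally show ?thesis .
    qed
  qed note basis = this
  obtain c where c: "x = lin_ext fm_scale Z_elem c" "Poly_Mapping.keys c \<subseteq> set_partitions"
    using x unfolding Z_space_eq fm.span_eq_lin_ext_image by auto
  have "S x = lin_ext fm_scale (\<lambda>A. S (Z_elem A)) c"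
    unfolding c(1) using c(2) by (intro fm.linear_on_lin_ext[OF module_fm_scale ubp_carr_subspace S_lin]) (auto intro: Z_elem_carr)
  also have "\<dots> \<in> Z_space"
    using c(2) basis by (intro fm.lin_ext_in_subspace Z_space_subspace) auto
  finally show ?thesis .
qed

theorem hopf_subalgebra_Z: "hopf_subalgebra ubp_hopf Z_space"
proof -
  interpret G: graded_hopf_algebra ubp_hopf by (rule P.graded_hopf)
  show ?thesis
  proof unfold_locales
    show "Z_space \<subseteq> carr ubp_hopf" by (rule Z_space_carr)
    show "module.subspace (scal ubp_hopf) Z_space"
      by (simp add: Z_space_subspace)
    show "one ubp_hopf \<in> Z_space"
      using Z_elem_in[OF empty_in_set_partitions] by (simp add: Z_elem_empty ubp_hopf_def)
    show "mul ubp_hopf x y \<in> Z_space" if "x \<in> Z_space" "y \<in> Z_space" for x y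
      using that by (rule mul_Z_space)
    show "tensor2_eq (ubp_hopf\<lparr>carr := Z_space\<rparr>) s t"
      if "Poly_Mapping.keys s \<subseteq> Z_space \<times> Z_space" "Poly_Mapping.keys t \<subseteq> Z_space \<times> Z_space" "tensor2_eq ubp_hopf s t" for s t
    proof -
      have "Poly_Mapping.keys (s - t) \<subseteq> Z_space \<times> Z_space"
        using keys_diff[of s t] that by blast
      then show ?thesis
        using that(3) Z_tensor_inj[of "s - t"] by (simp add: tensor2_eq_def)
    qed
    show "\<exists>t. Poly_Mapping.keys t \<subseteq> Z_space \<times> Z_space \<and> tensor2_eq ubp_hopf t (comul ubp_hopf x)" if "x \<in> Z_space" for x
      using that by (rule comul_Z_space)
    show "S ` Z_space \<subseteq> Z_space" if "is_antipode ubp_hopf S" for S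
      using antipode_Z_space[OF that] by auto
  qed
qed

text \<open>The restricted coproduct is a choice of representatives with entries in
  \<open>Z_space\<close>, and it equals the original one only modulo relations over the whole
  algebra. \<open>Z_tensor_inj\<close> brings each comparison back to relations over
  \<open>Z_space\<close>.\<close>

lemma setpart_hopf_Z: "setpart_hopf (restrict_hopf ubp_hopf Z_space Z_part) (Z_elem :: _ \<Rightarrow> (blockmap \<Rightarrow>\<^sub>0 'k::comm_ring_1))"
proof -
  let ?P = "ubp_hopf :: ('k, blockmap \<Rightarrow>\<^sub>0 'k) hopf"
  let ?H = "restrict_hopf ?P Z_space Z_part"
  have sel [simp]: "carr ?H = Z_space" "scal ?H = fm_scale" "mul ?H = mul ?P" "one ?H = one ?P"
      "counit ?H = counit ?P" "deg_part ?H = Z_part"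
    by (simp_all add: restrict_hopf_def)
  have comul: "Poly_Mapping.keys (comul ?H x) \<subseteq> Z_space \<times> Z_space" "tensor2_eq ?P (comul ?H x) (comul ?P x)" if "x \<in> Z_space" for x
    using someI_ex[OF comul_Z_space[OF that]] by (simp_all add: restrict_hopf_def)
  let ?R = "multilinear_rels fm_scale (carr ?P) (slots2 (carr ?P))"
  have sub: "fm.subspace ?R"
    by (simp add: multilinear_rels_def)
  have diff: "comul ?H x - comul ?P x \<in> ?R" if "x \<in> Z_space" for x
    using comul(2)[OF that] by (simp add: tensor2_eq_def)
  have comul_P: "comul ?P = lin_ext fm_scale ubp_coproduct"
    by (simp add: ubp_hopf_def)
  show ?thesis
  proof
    show "carr ?H = module.span (scal ?H) (Z_elem ` set_partitions)"
      unfolding sel by (rule Z_space_eq)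
    show "deg_part ?H n = module.span (scal ?H) (Z_elem ` {A. partition_on {1..n} A})" for n
      by (simp add: Z_part_def)
    show "c = 0" if "Poly_Mapping.keys c \<subseteq> set_partitions" "lin_ext (scal ?H) Z_elem c = 0" for c
      using that by (intro Z_elem_indep) auto
    show "one ?H = Z_elem {}"
      by (simp add: Z_elem_empty) (simp add: ubp_hopf_def)
    show "linear_on (carr ?H) (scal ?H) (scal ?H) (\<lambda>x. mul ?H x y)" "linear_on (carr ?H) (scal ?H) (scal ?H) (mul ?H x)" for x y
      by (simp_all add: mul_ubp_linear)
    show "mul ?H (Z_elem A) (Z_elem B) = Z_elem (part_concat A B)" if "A \<in> set_partitions" "B \<in> set_partitions" for A B
      using that by (simp add: mul_Z_elem)
    show "linear_on (carr ?H) (scal ?H) (*) (counit ?H)"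
      by (simp add: linear_on_def) (simp add: ubp_hopf_def lookup_add)
    show "counit ?H (Z_elem A) = (if A = {} then 1 else 0)" if "A \<in> set_partitions" for A
    proof -
      \<comment> \<open>The counit reads the coefficient at the empty block map, which is the
        identity of the empty partition; so the dual functionals compute it.\<close>
      have "counit ?P (Z_elem A) = Poly_Mapping.lookup (Z_elem A) (id_ubp {})"
        by (simp add: ubp_hopf_def id_ubp_def)
      then show ?thesis
        unfolding sel lookup_Z_elem_id[OF empty_in_set_partitions that] .
    qed
    show "Poly_Mapping.keys (comul ?H x) \<subseteq> carr ?H \<times> carr ?H" if "x \<in> carr ?H" for x
      using comul(1) that by simp
    show "lin_mod (carr ?H) (scal ?H) fm_scale (multilinear_rels (scal ?H) (carr ?H) (slots2 (carr ?H))) (comul ?H)"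
      unfolding lin_mod_def sel
    proof (intro conjI ballI allI)
      fix x y :: "blockmap \<Rightarrow>\<^sub>0 'k" assume xy: "x \<in> Z_space" "y \<in> Z_space"
      then have xy': "x + y \<in> Z_space"
        by (intro fm.subspace_add Z_space_subspace)
      \<comment> \<open>The original coproduct is linear on formal sums, so the defect of the chosen
        one is a combination of three errors of choice.\<close>
      have "comul ?H (x + y) - comul ?H x - comul ?H y = (comul ?H (x + y) - comul ?P (x + y)) - (comul ?H x - comul ?P x) - (comul ?H y - comul ?P y)"
        by (simp add: comul_P)
      also have "\<dots> \<in> ?R"
        by (rule diff[OF xy(1)] diff[OF xy(2)] diff[OF xy'] fm.subspace_diff[OF sub])+
      finally show "comul ?H (x + y) - comul ?H x - comul ?H y \<in> Z_rels"
        by (rule Z_tensor_inj)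
          (use comul(1)[OF xy(1)] comul(1)[OF xy(2)] comul(1)[OF xy'] keys_diff[of "comul ?H (x + y) - comul ?H x" "comul ?H y"]
              keys_diff[of "comul ?H (x + y)" "comul ?H x"] in blast)
    next
      fix c and x :: "blockmap \<Rightarrow>\<^sub>0 'k" assume x: "x \<in> Z_space"
      then have cx: "fm_scale c x \<in> Z_space"
        by (intro fm.subspace_scale Z_space_subspace)
      have "comul ?H (fm_scale c x) - fm_scale c (comul ?H x) = (comul ?H (fm_scale c x) - comul ?P (fm_scale c x)) - fm_scale c (comul ?H x - comul ?P x)"
        by (simp add: comul_P fm.scale_right_diff_distrib)
      also have "\<dots> \<in> ?R"
        by (rule diff[OF x] diff[OF cx] fm.subspace_diff[OF sub] fm.subspace_scale[OF sub])+
      finally show "comul ?H (fm_scale c x) - fm_scale c (comul ?H x) \<in> Z_rels"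
        by (rule Z_tensor_inj)
          (use comul(1)[OF x] comul(1)[OF cx] keys_diff[of "comul ?H (fm_scale c x)" "fm_scale c (comul ?H x)"]
              keys_fm_scale[of c "comul ?H x"] in blast)
    qed
    show "tensor2_eq ?H (comul ?H (Z_elem A)) (\<Sum>S\<in>Pow A. basis_vec (Z_elem (part_std S), Z_elem (part_std (A - S))))"
      if A: "A \<in> set_partitions" for A
      unfolding tensor2_eq_def sel
    proof (rule Z_tensor_inj)
      let ?D = "\<Sum>S\<in>Pow A. basis_vec (Z_elem (part_std S), Z_elem (part_std (A - S)))"
      have "comul ?H (Z_elem A) - ?D = (comul ?H (Z_elem A) - comul ?P (Z_elem A)) - (?D - comul ?P (Z_elem A))"
        by simp
      also have "\<dots> \<in> ?R"
        by (rule diff[OF Z_elem_in[OF A]] comul_Z_elem[OF A, unfolded tensor2_eq_def scal_ubp] fm.subspace_diff[OF sub])+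
      finally show "comul ?H (Z_elem A) - ?D \<in> ?R" .
      have "Poly_Mapping.keys ?D \<subseteq> Z_space \<times> Z_space"
        using part_std_in[OF A] by (intro order.trans[OF keys_sum]) auto
      then show "Poly_Mapping.keys (comul ?H (Z_elem A) - ?D) \<subseteq> Z_space \<times> Z_space"
        using comul(1)[OF Z_elem_in[OF A]] keys_diff[of "comul ?H (Z_elem A)" ?D] by blast
    qed
  qed (simp_all add: module_fm_scale[unfolded module_def])
qed

section \<open>Symmetric functions in non-commuting variables\<close>

lemma module_ncs_scale: "module ncs_scale"
  by standard (auto simp: ncs_scale_def algebra_simps)

interpretation ncs: module ncs_scale
  by (rule module_ncs_scale)

lemma word_kernel_eq: "word_kernel w = fib w ` set w"
  by (simp add: word_kernel_def fib_def)

text \<open>A pointwise substitute for refinement of the kernel, which is easier to follow through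
  cutting a word. As before, positions start at 1 and list indices at 0.\<close>

definition const_on :: "nat set set \<Rightarrow> 'x list \<Rightarrow> bool" where
  "const_on A w \<longleftrightarrow> (\<forall>B\<in>A. \<forall>i\<in>B. \<forall>j\<in>B. w ! (i - 1) = w ! (j - 1))"

lemma refines_word_kernel:
  "refines {1..length w} A (word_kernel w) \<longleftrightarrow> partition_on {1..length w} A \<and> const_on A w"
proof (intro iffI conjI)
  assume r: "refines {1..length w} A (word_kernel w)"
  then show "partition_on {1..length w} A"
    by (simp add: refines_def)
  show "const_on A w"
    unfolding const_on_def
  proof (intro ballI)
    fix B i j assume B: "B \<in> A" "i \<in> B" "j \<in> B"
    then obtain a where "B \<subseteq> fib w a"
      using r by (auto simp: refines_def word_kernel_eq)
    then have "i \<in> fib w a" "j \<in> fib w a"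
      using B by auto
    then show "w ! (i - 1) = w ! (j - 1)"
      by (simp add: fib_def)
  qed
next
  assume A: "partition_on {1..length w} A \<and> const_on A w"
  have "\<exists>C\<in>fib w ` set w. B \<subseteq> C" if B: "B \<in> A" for B
  proof -
    obtain i where i: "i \<in> B"
      using B A partition_onD3 by (metis ex_in_conv)
    have sub: "B \<subseteq> {1..length w}"
      using A B partition_onD1 by blast
    have "B \<subseteq> fib w (w ! (i - 1))"
    proof
      fix j assume j: "j \<in> B"
      then have "w ! (j - 1) = w ! (i - 1)"
        using A B i unfolding const_on_def by blast
      then show "j \<in> fib w (w ! (i - 1))"
        using j sub unfolding fib_def by blast
    qed
    moreover have "w ! (i - 1) \<in> set w"
      using in_fib[of i w] sub i by blast
    ultimately show ?thesis by blast
  qed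
  then show "refines {1..length w} A (word_kernel w)"
    using A partition_on_fib[of w] by (simp add: refines_def word_kernel_eq)
qed

lemma p_elem_eq:
  assumes "A \<in> set_partitions"
  shows "p_elem X A w = (if w \<in> lists X \<and> length w = card (\<Union>A) \<and> const_on A w then 1 else 0)"
proof -
  have "partition_on {1..length w} A \<longleftrightarrow> length w = card (\<Union>A)"
  proof
    assume "partition_on {1..length w} A"
    then show "length w = card (\<Union>A)"
      using partition_on_card by metis
  next
    assume "length w = card (\<Union>A)"
    then show "partition_on {1..length w} A"
      using assms by (simp only: set_partitions_iff)
  qed
  then show ?thesis
    by (simp only: p_elem_def refines_word_kernel)
qed

text \<open>No block of the concatenation crosses from the first \<open>card (\<Union>A)\<close>
  positions to the others, so the condition splits at this cut.\<close>

lemma const_on_part_concat: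
  assumes A: "A \<in> set_partitions" and B: "B \<in> set_partitions"
    and w: "length w = card (\<Union>A) + card (\<Union>B)"
  shows "const_on (part_concat A B) w \<longleftrightarrow> const_on A (take (card (\<Union>A)) w) \<and> const_on B (drop (card (\<Union>A)) w)"
proof -
  let ?n = "card (\<Union>A)"
  have iA: "1 \<le> i \<and> i \<le> ?n" if "C \<in> A" "i \<in> C" for C i
    using set_partitions_Union[OF A] that by (metis UnionI atLeastAtMost_iff)
  have iB: "1 \<le> i" if "C \<in> B" "i \<in> C" for C i
    using set_partitions_Union[OF B] that by (metis UnionI atLeastAtMost_iff)
  have 1: "const_on A w \<longleftrightarrow> const_on A (take ?n w)"
  proof -
    have "take ?n w ! (i - 1) = w ! (i - 1)" if "C \<in> A" "i \<in> C" for C i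
      using iA[OF that] by (intro nth_take) auto
    then show ?thesis
      by (simp add: const_on_def)
  qed
  have 2: "const_on (shift ?n ` B) w \<longleftrightarrow> const_on B (drop ?n w)"
  proof -
    have "drop ?n w ! (i - 1) = w ! (i + ?n - 1)" if "C \<in> B" "i \<in> C" for C i
      using iB[OF that] w by (simp add: add.commute)
    then show ?thesis
      by (simp add: const_on_def shift_def)
  qed
  show ?thesis
    unfolding 1[symmetric] 2[symmetric] by (auto simp: part_concat_def const_on_def)
qed

text \<open>The series of \<open>A\<close> lives on words of length \<open>card (\<Union>A)\<close>,
  so only one cut of a word contributes to the convolution.\<close>

lemma mul_p_elem:
  assumes A: "A \<in> set_partitions" and B: "B \<in> set_partitions"
  shows "ncs_mul (p_elem X A) (p_elem X B) = p_elem X (part_concat A B)"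
proof
  fix w
  let ?n = "card (\<Union>A)" and ?m = "card (\<Union>B)"
  have C: "part_concat A B \<in> set_partitions" "card (\<Union>(part_concat A B)) = ?n + ?m"
    using part_concat_props[OF A B] by auto
  have "ncs_mul (p_elem X A) (p_elem X B) w = (\<Sum>i\<le>length w. if i = ?n then p_elem X A (take ?n w) * p_elem X B (drop ?n w) else 0)"
    unfolding ncs_mul_def by (intro sum.cong refl) (auto simp: p_elem_eq[OF A])
  also have "\<dots> = (if ?n \<le> length w then p_elem X A (take ?n w) * p_elem X B (drop ?n w) else 0)"
    by (simp add: sum.delta)
  also have "\<dots> = p_elem X (part_concat A B) w"
  proof (cases "length w = ?n + ?m")
    case True
    have "w \<in> lists X \<longleftrightarrow> take ?n w \<in> lists X \<and> drop ?n w \<in> lists X"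
      by (metis append_in_lists_conv append_take_drop_id)
    then show ?thesis
      using True by (simp add: p_elem_eq[OF A] p_elem_eq[OF B] p_elem_eq[OF C(1)] C(2) const_on_part_concat[OF A B True])
  next
    case False
    then show ?thesis
      by (auto simp: p_elem_eq[OF B] p_elem_eq[OF C(1)] C(2))
  qed
  finally show "ncs_mul (p_elem X A) (p_elem X B) w = p_elem X (part_concat A B) w" .
qed

text \<open>An infinite alphabet has a separate letter for each of the finitely many blocks; the
  word repeats this letter along its block.\<close>

lemma word_with_kernel:
  assumes "infinite X" and A: "A \<in> set_partitions"
  shows "\<exists>w. w \<in> lists X \<and> length w = card (\<Union>A) \<and> word_kernel w = A"
proof -
  let ?n = "card (\<Union>A)"
  have part: "partition_on {1..?n} A"
    using A by (simp add: set_partitions_iff)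
  obtain Y where Y: "Y \<subseteq> X" "finite Y" "card Y = card A"
    using infinite_arbitrarily_large[OF assms(1)] by blast
  obtain g where g: "bij_betw g A Y"
    using finite_same_card_bij[OF set_partitions_finite[OF A] Y(2)] Y(3) by metis
  define blk where "blk j = (THE B. B \<in> A \<and> j \<in> B)" for j
  have blk: "blk j = B" if "B \<in> A" "j \<in> B" for j B
    unfolding blk_def
    by (rule the_equality) (use that disjointD[OF partition_onD2[OF part]] in blast)+
  have ex: "\<exists>B\<in>A. j \<in> B" if "j \<in> {1..?n}" for j
    using that partition_onD1[OF part] by blast
  define w where "w = map (\<lambda>j. g (blk j)) [1..<Suc ?n]"
  have len: "length w = ?n"
    by (simp add: w_def)
  have nth: "w ! (j - 1) = g (blk j)" if "j \<in> {1..?n}" for j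
  proof -
    have "j - 1 < length [1..<Suc ?n]" "[1..<Suc ?n] ! (j - 1) = j"
      using that by (auto simp: nth_upt simp del: upt_Suc)
    then show ?thesis
      unfolding w_def by (simp del: upt_Suc)
  qed
  have sub: "B \<subseteq> {1..?n}" "B \<noteq> {}" if "B \<in> A" for B
    using that partition_onD1[OF part] partition_onD3[OF part] by auto
  have fib: "fib w (g B) = B" if B: "B \<in> A" for B
  proof (intro set_eqI iffI)
    fix j assume "j \<in> fib w (g B)"
    then have j: "j \<in> {1..?n}" "g (blk j) = g B"
      using nth[of j] unfolding fib_def len by simp_all
    then obtain C where C: "C \<in> A" "j \<in> C"
      using ex by blast
    then have "C = B"
      using j(2) blk[OF C] g B by (auto simp: bij_betw_def inj_on_def)
    then show "j \<in> B"
      using C by simp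
  next
    fix j assume "j \<in> B"
    then show "j \<in> fib w (g B)"
      using sub(1)[OF B] blk[OF B, of j] nth[of j] unfolding fib_def len by blast
  qed
  have "set w = (\<lambda>j. g (blk j)) ` {1..?n}"
    unfolding w_def set_map set_upt atLeastLessThanSuc_atLeastAtMost ..
  also have "\<dots> = g ` A"
  proof (intro set_eqI iffI)
    fix y assume "y \<in> (\<lambda>j. g (blk j)) ` {1..?n}"
    then obtain j where j: "j \<in> {1..?n}" "y = g (blk j)" by blast
    obtain B where "B \<in> A" "j \<in> B"
      using ex[OF j(1)] by blast
    then show "y \<in> g ` A"
      using j(2) blk by simp
  next
    fix y assume "y \<in> g ` A"
    then obtain B where B: "B \<in> A" "y = g B" by auto
    then obtain j where j: "j \<in> B" using sub by blast
    then have "j \<in> {1..?n}" "blk j = B"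
      using B sub(1) blk by blast+
    then show "y \<in> (\<lambda>j. g (blk j)) ` {1..?n}"
      using B by (intro image_eqI[where x=j]) simp_all
  qed
  finally have set_w: "set w = g ` A" .
  then have "w \<in> lists X"
    using Y(1) bij_betw_imp_surj_on[OF g] by auto
  moreover have "word_kernel w = A"
    unfolding word_kernel_eq set_w image_image using fib by (simp cong: image_cong)
  ultimately show ?thesis
    using len by blast
qed

text \<open>Evaluate a linear relation at a word whose kernel is minimal, that is finest, in the support.\<close>

lemma p_elem_indep:
  fixes X :: "'x set" and c :: "nat set set \<Rightarrow>\<^sub>0 'k::comm_ring_1"
  assumes "infinite X" "Poly_Mapping.keys c \<subseteq> set_partitions" "lin_ext ncs_scale (p_elem X) c = 0"
  shows "c = 0"
proof (rule ccontr)
  assume "c \<noteq> 0"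
  let ?K = "Poly_Mapping.keys c" and ?R = "\<lambda>B A. refines (\<Union>A) B A \<and> B \<noteq> A"
  have "?K \<noteq> {}"
    using \<open>c \<noteq> 0\<close> by simp
  have U: "\<Union>B = \<Union>A" if "refines (\<Union>A) B A" for A B :: "nat set set"
    using that by (simp add: refines_def partition_on_def)
  have "asymp_on ?K ?R"
  proof (rule asymp_onI)
    fix A B :: "nat set set" assume "?R A B"
    then show "\<not> ?R B A"
      using refines_asym[of "\<Union>A" A B] U[of B A] by auto
  qed
  moreover have "transp_on ?K ?R"
  proof (rule transp_onI)
    fix A B C :: "nat set set" assume *: "?R A B" "?R B C"
    have BC: "\<Union>B = \<Union>C"
      using * by (intro U) auto
    then have "refines (\<Union>C) A B"
      using * by simp
    then have "refines (\<Union>C) A C"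
      using refines_trans[of "\<Union>C" A B C] * by auto
    moreover have "A \<noteq> C"
      using * \<open>refines (\<Union>C) A B\<close> refines_asym[of "\<Union>C" B C] by auto
    ultimately show "?R A C" by simp
  qed
  ultimately obtain A where A: "A \<in> ?K" "\<And>B. B \<in> ?K \<Longrightarrow> B \<noteq> A \<Longrightarrow> \<not> ?R B A"
    using Finite_Set.bex_min_element[of ?K ?R] \<open>?K \<noteq> {}\<close> by auto
  have A_sp: "A \<in> set_partitions"
    using A(1) assms(2) by auto
  obtain w where w: "w \<in> lists X" "length w = card (\<Union>A)" "word_kernel w = A"
    using word_with_kernel[OF assms(1) A_sp] by blast
  have UA: "{1..length w} = \<Union>A"
    using set_partitions_Union[OF A_sp] w(2) by simp
  \<comment> \<open>A partition contributes at \<open>w\<close> only if it refines \<open>A\<close>,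
    and minimality leaves no other such partition in the support.\<close>
  have p: "p_elem X B w = (if B = A then 1 else 0)" if "B \<in> ?K" for B
  proof (cases "B = A")
    case True
    have "refines (\<Union>A) A A"
      using A_sp UA w(2) by (intro refines_refl) (simp add: set_partitions_iff)
    then show ?thesis
      unfolding p_elem_def UA w(3) True using w(1) by simp
  next
    case False
    then have "\<not> refines (\<Union>A) B A"
      using A(2)[OF that] by blast
    then show ?thesis
      unfolding p_elem_def UA w(3) using False by simp
  qed
  have "0 = lin_ext ncs_scale (p_elem X) c w"
    by (simp add: assms(3))
  also have "\<dots> = (\<Sum>B\<in>?K. Poly_Mapping.lookup c B * p_elem X B w)"
  proof -
    have "sum f J w = (\<Sum>j\<in>J. f j w)" for f :: "nat set set \<Rightarrow> 'x list \<Rightarrow> 'k" and J :: "nat set set set"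
      by (induction J rule: infinite_finite_induct) auto
    then show ?thesis
      by (simp add: lin_ext_def ncs_scale_def)
  qed
  also have "\<dots> = (\<Sum>B\<in>?K. if B = A then Poly_Mapping.lookup c A else 0)"
    by (intro sum.cong refl) (simp add: p)
  also have "\<dots> = Poly_Mapping.lookup c A"
    using A(1) by simp
  finally show False
    using A(1) by (simp add: in_keys_iff)
qed

lemma ncs_mul_linear:
  "linear_on A ncs_scale ncs_scale (\<lambda>x. ncs_mul x y)" "linear_on A ncs_scale ncs_scale (ncs_mul x)"
  by (auto simp: linear_on_def ncs_mul_def ncs_scale_def fun_eq_iff algebra_simps sum.distrib sum_distrib_left)

lemma setpart_hopf_Pi:
  assumes X: "infinite X"
  shows "setpart_hopf (Pi_hopf X :: ('k::comm_ring_1, ('k, 'x) ncseries) hopf) (p_elem X)"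
proof -
  let ?H = "Pi_hopf X :: ('k, ('k, 'x) ncseries) hopf"
  interpret free: free_basis "ncs_scale :: 'k \<Rightarrow> ('k, 'x) ncseries \<Rightarrow> _" set_partitions "p_elem X"
    by (intro free_basis.intro module_ncs_scale free_basis_axioms.intro p_elem_indep[OF X])
  let ?C = "ncs.span (p_elem X ` set_partitions) :: ('k, 'x) ncseries set"
  have sel: "carr ?H = ?C" "scal ?H = ncs_scale" "mul ?H = ncs_mul" "one ?H = p_elem X {}" "counit ?H = (\<lambda>x. x [])"
    "deg_part ?H = (\<lambda>n. ncs.span (p_elem X ` {A. partition_on {1..n} A}))"
    by (simp_all add: Pi_hopf_def)
  have comul: "comul ?H = (\<lambda>x. lin_ext fm_scale (p_coproduct X) (free.coords x))"
    by (simp add: Pi_hopf_def p_coords_def[abs_def] free.coords_def[abs_def])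
  have keys: "Poly_Mapping.keys (p_coproduct X A :: _ \<Rightarrow>\<^sub>0 'k) \<subseteq> ?C \<times> ?C" if "A \<in> set_partitions" for A
    unfolding p_coproduct_def using part_std_in[OF that]
    by (intro order.trans[OF keys_sum]) (auto intro!: ncs.span_base)
  have rels_0: "0 \<in> multilinear_rels ncs_scale ?C (slots2 ?C)"
    by (simp add: multilinear_rels_def fm.span_zero)
  show ?thesis
  proof (rule setpart_hopf.intro)
    show "module (scal ?H)"
      by (simp add: sel module_ncs_scale)
    show "carr ?H = module.span (scal ?H) (p_elem X ` set_partitions)"
      "deg_part ?H n = module.span (scal ?H) (p_elem X ` {A. partition_on {1..n} A})" "one ?H = p_elem X {}" for n
      by (simp_all add: sel)
    show "c = 0" if "Poly_Mapping.keys c \<subseteq> set_partitions" "lin_ext (scal ?H) (p_elem X) c = 0" for c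
      using that unfolding sel by (rule p_elem_indep[OF X])
    show "linear_on (carr ?H) (scal ?H) (scal ?H) (\<lambda>x. mul ?H x y)" "linear_on (carr ?H) (scal ?H) (scal ?H) (mul ?H x)" for x y
      unfolding sel by (rule ncs_mul_linear)+
    show "mul ?H (p_elem X A) (p_elem X B) = p_elem X (part_concat A B)" if "A \<in> set_partitions" "B \<in> set_partitions" for A B
      unfolding sel using that by (rule mul_p_elem)
    show "linear_on (carr ?H) (scal ?H) (*) (counit ?H)"
      by (simp add: sel linear_on_def ncs_scale_def)
    show "counit ?H (p_elem X A) = (if A = {} then 1 else 0)" if "A \<in> set_partitions" for A
    proof -
      have "card (\<Union>A) = 0 \<longleftrightarrow> A = {}"
        using that by (auto simp: set_partitions_iff partition_on_def)
      moreover have "const_on {} w" for w :: "'x list"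
        by (simp add: const_on_def)
      ultimately show ?thesis
        by (auto simp: sel p_elem_eq[OF that])
    qed
    show "Poly_Mapping.keys (comul ?H x) \<subseteq> carr ?H \<times> carr ?H" if x: "x \<in> carr ?H" for x
    proof -
      obtain c where "x = lin_ext ncs_scale (p_elem X) c" "Poly_Mapping.keys c \<subseteq> set_partitions"
        using x unfolding sel by (rule free.spanE)
      then have "Poly_Mapping.keys (free.coords x) \<subseteq> set_partitions"
        by (simp add: free.coords_lin_ext)
      then show ?thesis
        unfolding comul sel using keys by (intro order.trans[OF keys_lin_ext]) blast
    qed
    \<comment> \<open>Here the coproduct is linear exactly and not just modulo relations, because
      coordinates in a free basis are unique.\<close>
    show "lin_mod (carr ?H) (scal ?H) fm_scale (multilinear_rels (scal ?H) (carr ?H) (slots2 (carr ?H))) (comul ?H)"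
      unfolding sel comul using free.linear_on_coords
      by (intro lin_mod_linear_on rels_0) (simp add: linear_on_def)
    show "tensor2_eq ?H (comul ?H (p_elem X A)) (\<Sum>S\<in>Pow A. basis_vec (p_elem X (part_std S), p_elem X (part_std (A - S))))"
      if "A \<in> set_partitions" for A
      using rels_0 that by (simp add: tensor2_eq_def sel comul free.coords_basis p_coproduct_def)
  qed
qed

theorem theorem3p1:
  fixes X :: "'x set"
  assumes "countable X" and "infinite X"
  shows "hopf_subalgebra (ubp_hopf :: ('k::comm_ring_1, blockmap \<Rightarrow>\<^sub>0 'k) hopf) Z_space \<and>
    (\<exists>\<phi>. graded_hopf_iso
        (restrict_hopf (ubp_hopf :: ('k, blockmap \<Rightarrow>\<^sub>0 'k) hopf) Z_space Z_part) (Pi_hopf X) \<phi> \<and>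
      (\<forall>n A. partition_on {1..n} A \<longrightarrow> \<phi> (Z_elem A) = p_elem X A))"
proof
  let ?Z = "restrict_hopf (ubp_hopf :: ('k, blockmap \<Rightarrow>\<^sub>0 'k) hopf) Z_space Z_part"
  let ?Pi = "Pi_hopf X :: ('k, ('k, 'x) ncseries) hopf"
  show "hopf_subalgebra (ubp_hopf :: ('k, blockmap \<Rightarrow>\<^sub>0 'k) hopf) Z_space"
    by (rule hopf_subalgebra_Z)
  interpret Z: setpart_hopf ?Z Z_elem
    by (rule setpart_hopf_Z)
  interpret Pi: setpart_hopf ?Pi "p_elem X"
    by (rule setpart_hopf_Pi[OF assms(2)])
  interpret hopf_basis_pair ?Z ?Pi set_partitions Z_elem "p_elem X" "{}" "\<lambda>A. card (\<Union>A)" DS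
  proof (intro hopf_basis_pair.intro Z.hopf_basis Pi.hopf_basis hopf_basis_pair_axioms.intro)
    fix A B assume AB: "A \<in> set_partitions" "B \<in> set_partitions"
    interpret z: module "scal ?Z" by (rule Z.module_scal)
    interpret p: module "scal ?Pi" by (rule Pi.module_scal)
    \<comment> \<open>On both sides a product of two basis elements is the basis element of the
      concatenation, so one coordinate vector serves for both.\<close>
    show "\<exists>c. Poly_Mapping.keys c \<subseteq> set_partitions \<and> mul ?Z (Z_elem A) (Z_elem B) = lin_ext (scal ?Z) Z_elem c \<and>
        mul ?Pi (p_elem X A) (p_elem X B) = lin_ext (scal ?Pi) (p_elem X) c"
      using part_concat_props(1)[OF AB] AB
      by (intro exI[of _ "basis_vec (part_concat A B)"]) (simp add: Z.mul_basis Pi.mul_basis)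
  qed
  show "\<exists>\<phi>. graded_hopf_iso ?Z ?Pi \<phi> \<and> (\<forall>n A. partition_on {1..n} A \<longrightarrow> \<phi> (Z_elem A) = p_elem X A)"
  proof (intro exI conjI allI impI)
    show "graded_hopf_iso ?Z ?Pi iso"
      by (rule graded_hopf_iso)
    show "iso (Z_elem A) = p_elem X A" if "partition_on {1..n} A" for n A
      using that by (intro iso_basis) (auto simp: set_partitions_def)
  qed
qed

end
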